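(* Let $M$ be a compact connected manifold with a metric $d_{M}$, and let $K>0$. Let $\mathbf{G}=(\Lambda,(G_{\lambda})_{\lambda\in\Lambda},(i_{\lambda\mu})_{\lambda\le\mu})$ be a direct system of torsion groups indexed by a directed set $\Lambda$, where the transition homomorphism $i_{\lambda\mu}\colon G_{\lambda}\to G_{\mu}$ is a monomorphism for all $\lambda\leq\mu$ in $\Lambda$. If for each $\lambda\in\Lambda$ there exists an effective $K$-Lipschitz action of $G_{\lambda}$ on $M$, then there exists an effective $K$-Lipschitz action of the direct limit $\varinjlim\mathbf{G}$ on $M$. (The constant $K$ is the same throughout; no compatibility between the given actions of the various $G_\lambda$ and the maps $i_{\lambda\mu}$ is assumed.)
   Context: "Manifold with a metric" means a topological manifold equipped with a distance function $d_M$ that induces its topology. An action of a group $G$ on a metric space $(M,d_M)$ is called effective if for each $g\in G\setminus\{e_G\}$ there is some $x\in M$ with $d_M(x,gx)>0$. For $K>0$, an action is called $K$-Lipschitz if $d_M(gx,gy)\le K\,d_M(x,y)$ for all $g\in G$ and all $x,y\in M$. A torsion group is a group in which every element has finite order. The direct limit $\varinjlim\mathbf{G}$ is the colimit in the category of groups of the direct system $\mathbf{G}$. *)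

theory Defs
  imports "HOL-Analysis.Analysis" "HOL-Algebra.Group_Action"
begin

section \<open>Manifolds with a metric\<close>

text \<open>Manifolds are without boundary. The second countability axiom is automatic for
  compact metrizable spaces.\<close>

definition topological_manifold :: "nat \<Rightarrow> 'a topology \<Rightarrow> bool" where
  "topological_manifold n X \<longleftrightarrow>
     Hausdorff_space X \<and> second_countable X \<and>
     (\<forall>x \<in> topspace X. \<exists>U V. openin X U \<and> x \<in> U \<and> openin (Euclidean_space n) V \<and>
        subtopology X U homeomorphic_space subtopology (Euclidean_space n) V)"

definition manifold_with_metric :: "nat \<Rightarrow> 'a topology \<Rightarrow> ('a \<Rightarrow> 'a \<Rightarrow> real) \<Rightarrow> bool" where
  "manifold_with_metric n X d \<longleftrightarrow>
     topological_manifold n X \<and>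
     Metric_space (topspace X) d \<and> Metric_space.mtopology (topspace X) d = X"


section \<open>Actions on metric spaces\<close>

definition effective_action ::
    "('g, 'm) monoid_scheme \<Rightarrow> 'a set \<Rightarrow> ('a \<Rightarrow> 'a \<Rightarrow> real) \<Rightarrow> ('g \<Rightarrow> 'a \<Rightarrow> 'a) \<Rightarrow> bool" where
  "effective_action G M d \<phi> \<longleftrightarrow>
     group_action G M \<phi> \<and> (\<forall>g \<in> carrier G - {\<one>\<^bsub>G\<^esub>}. \<exists>x \<in> M. d x (\<phi> g x) > 0)"

definition Lipschitz_action ::
    "real \<Rightarrow> ('g, 'm) monoid_scheme \<Rightarrow> 'a set \<Rightarrow> ('a \<Rightarrow> 'a \<Rightarrow> real) \<Rightarrow> ('g \<Rightarrow> 'a \<Rightarrow> 'a) \<Rightarrow> bool" where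
  "Lipschitz_action K G M d \<phi> \<longleftrightarrow>
     group_action G M \<phi> \<and>
     (\<forall>g \<in> carrier G. \<forall>x \<in> M. \<forall>y \<in> M. d (\<phi> g x) (\<phi> g y) \<le> K * d x y)"


section \<open>Direct systems of groups and their limits\<close>

definition torsion_group :: "('g, 'm) monoid_scheme \<Rightarrow> bool" where
  "torsion_group G \<longleftrightarrow>
     group G \<and> (\<forall>g \<in> carrier G. \<exists>n::nat. n > 0 \<and> g [^]\<^bsub>G\<^esub> n = \<one>\<^bsub>G\<^esub>)"

locale direct_system =
  fixes \<Lambda> :: "'i set"
    and leq :: "'i \<Rightarrow> 'i \<Rightarrow> bool"
    and G :: "'i \<Rightarrow> ('g, 'm) monoid_scheme"
    and i :: "'i \<Rightarrow> 'i \<Rightarrow> 'g \<Rightarrow> 'g"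
  assumes nonempty: "\<Lambda> \<noteq> {}"
    and leq_refl: "\<alpha> \<in> \<Lambda> \<Longrightarrow> leq \<alpha> \<alpha>"
    and leq_trans: "\<lbrakk>\<alpha> \<in> \<Lambda>; \<beta> \<in> \<Lambda>; \<gamma> \<in> \<Lambda>; leq \<alpha> \<beta>; leq \<beta> \<gamma>\<rbrakk> \<Longrightarrow> leq \<alpha> \<gamma>"
    and directed: "\<lbrakk>\<alpha> \<in> \<Lambda>; \<beta> \<in> \<Lambda>\<rbrakk> \<Longrightarrow> \<exists>\<gamma> \<in> \<Lambda>. leq \<alpha> \<gamma> \<and> leq \<beta> \<gamma>"
    and group: "\<alpha> \<in> \<Lambda> \<Longrightarrow> group (G \<alpha>)"
    and hom: "\<lbrakk>\<alpha> \<in> \<Lambda>; \<beta> \<in> \<Lambda>; leq \<alpha> \<beta>\<rbrakk> \<Longrightarrow> i \<alpha> \<beta> \<in> hom (G \<alpha>) (G \<beta>)"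
    and ident: "\<lbrakk>\<alpha> \<in> \<Lambda>; x \<in> carrier (G \<alpha>)\<rbrakk> \<Longrightarrow> i \<alpha> \<alpha> x = x"
    and comp: "\<lbrakk>\<alpha> \<in> \<Lambda>; \<beta> \<in> \<Lambda>; \<gamma> \<in> \<Lambda>; leq \<alpha> \<beta>; leq \<beta> \<gamma>; x \<in> carrier (G \<alpha>)\<rbrakk>
                 \<Longrightarrow> i \<beta> \<gamma> (i \<alpha> \<beta> x) = i \<alpha> \<gamma> x"

text \<open>The direct limit is realised as the disjoint union of the groups modulo the relation of
  becoming equal at some later index. That this is the colimit in the category of groups is
  shown below in \<open>group_dlim\<close>, \<open>inc_hom\<close>, \<open>inc_compat\<close> and \<open>direct_limit_universal\<close>.
  In the multiplication, all classes in the union on the right-hand side coincide.\<close>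

definition direct_limit_rel ::
    "'i set \<Rightarrow> ('i \<Rightarrow> 'i \<Rightarrow> bool) \<Rightarrow> ('i \<Rightarrow> ('g, 'm) monoid_scheme) \<Rightarrow> ('i \<Rightarrow> 'i \<Rightarrow> 'g \<Rightarrow> 'g)
      \<Rightarrow> (('i \<times> 'g) \<times> ('i \<times> 'g)) set" where
  "direct_limit_rel \<Lambda> leq G i =
     {((\<alpha>, x), (\<beta>, y)). \<alpha> \<in> \<Lambda> \<and> \<beta> \<in> \<Lambda> \<and> x \<in> carrier (G \<alpha>) \<and> y \<in> carrier (G \<beta>) \<and>
        (\<exists>\<gamma> \<in> \<Lambda>. leq \<alpha> \<gamma> \<and> leq \<beta> \<gamma> \<and> i \<alpha> \<gamma> x = i \<beta> \<gamma> y)}"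

definition direct_limit_map ::
    "'i set \<Rightarrow> ('i \<Rightarrow> 'i \<Rightarrow> bool) \<Rightarrow> ('i \<Rightarrow> ('g, 'm) monoid_scheme) \<Rightarrow> ('i \<Rightarrow> 'i \<Rightarrow> 'g \<Rightarrow> 'g)
      \<Rightarrow> 'i \<Rightarrow> 'g \<Rightarrow> ('i \<times> 'g) set" where
  "direct_limit_map \<Lambda> leq G i \<alpha> x = direct_limit_rel \<Lambda> leq G i `` {(\<alpha>, x)}"

definition direct_limit ::
    "'i set \<Rightarrow> ('i \<Rightarrow> 'i \<Rightarrow> bool) \<Rightarrow> ('i \<Rightarrow> ('g, 'm) monoid_scheme) \<Rightarrow> ('i \<Rightarrow> 'i \<Rightarrow> 'g \<Rightarrow> 'g)
      \<Rightarrow> ('i \<times> 'g) set monoid" where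
  "direct_limit \<Lambda> leq G i =
     \<lparr>carrier = (SIGMA \<alpha>:\<Lambda>. carrier (G \<alpha>)) // direct_limit_rel \<Lambda> leq G i,
      mult = (\<lambda>A B. \<Union>{direct_limit_map \<Lambda> leq G i \<gamma> (i \<alpha> \<gamma> x \<otimes>\<^bsub>G \<gamma>\<^esub> i \<beta> \<gamma> y) | \<alpha> x \<beta> y \<gamma>.
                        (\<alpha>, x) \<in> A \<and> (\<beta>, y) \<in> B \<and> \<gamma> \<in> \<Lambda> \<and> leq \<alpha> \<gamma> \<and> leq \<beta> \<gamma>}),
      one = (\<Union>\<alpha> \<in> \<Lambda>. direct_limit_map \<Lambda> leq G i \<alpha> \<one>\<^bsub>G \<alpha>\<^esub>)\<rparr>"

context direct_system
begin

abbreviation "rel \<equiv> direct_limit_rel \<Lambda> leq G i"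
abbreviation "inc \<equiv> direct_limit_map \<Lambda> leq G i"
abbreviation "dlim \<equiv> direct_limit \<Lambda> leq G i"

lemma trans_closed:
  "\<lbrakk>\<alpha> \<in> \<Lambda>; \<beta> \<in> \<Lambda>; leq \<alpha> \<beta>; x \<in> carrier (G \<alpha>)\<rbrakk> \<Longrightarrow> i \<alpha> \<beta> x \<in> carrier (G \<beta>)"
  using hom by (auto simp: hom_def)

lemma trans_mult:
  "\<lbrakk>\<alpha> \<in> \<Lambda>; \<beta> \<in> \<Lambda>; leq \<alpha> \<beta>; x \<in> carrier (G \<alpha>); y \<in> carrier (G \<alpha>)\<rbrakk>
    \<Longrightarrow> i \<alpha> \<beta> (x \<otimes>\<^bsub>G \<alpha>\<^esub> y) = i \<alpha> \<beta> x \<otimes>\<^bsub>G \<beta>\<^esub> i \<alpha> \<beta> y"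
  using hom by (auto simp: hom_def)

lemma trans_one: "\<lbrakk>\<alpha> \<in> \<Lambda>; \<beta> \<in> \<Lambda>; leq \<alpha> \<beta>\<rbrakk> \<Longrightarrow> i \<alpha> \<beta> \<one>\<^bsub>G \<alpha>\<^esub> = \<one>\<^bsub>G \<beta>\<^esub>"
  using hom_one[OF hom] group by blast

lemma mult_closed:
  "\<lbrakk>\<alpha> \<in> \<Lambda>; x \<in> carrier (G \<alpha>); y \<in> carrier (G \<alpha>)\<rbrakk> \<Longrightarrow> x \<otimes>\<^bsub>G \<alpha>\<^esub> y \<in> carrier (G \<alpha>)"
  using group group.is_monoid monoid.m_closed by metis

lemma one_closed: "\<alpha> \<in> \<Lambda> \<Longrightarrow> \<one>\<^bsub>G \<alpha>\<^esub> \<in> carrier (G \<alpha>)"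
  using group group.is_monoid monoid.one_closed by metis

lemma equiv_rel: "equiv (SIGMA \<alpha>:\<Lambda>. carrier (G \<alpha>)) rel"
proof (rule equivI)
  show "rel \<subseteq> (SIGMA \<alpha>:\<Lambda>. carrier (G \<alpha>)) \<times> (SIGMA \<alpha>:\<Lambda>. carrier (G \<alpha>))"
    by (auto simp: direct_limit_rel_def)
  show "refl_on (SIGMA \<alpha>:\<Lambda>. carrier (G \<alpha>)) rel"
    using leq_refl by (force simp: direct_limit_rel_def refl_on_def)
  show "sym rel"
    by (rule symI) (force simp: direct_limit_rel_def)
  show "trans rel"
  proof (rule transI)
    fix p q r assume "(p, q) \<in> rel" "(q, r) \<in> rel"
    then obtain a x b y c z m n where
      pqr: "p = (a, x)" "q = (b, y)" "r = (c, z)"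
      and in\<Lambda>: "a \<in> \<Lambda>" "b \<in> \<Lambda>" "c \<in> \<Lambda>" "m \<in> \<Lambda>" "n \<in> \<Lambda>"
      and car: "x \<in> carrier (G a)" "y \<in> carrier (G b)" "z \<in> carrier (G c)"
      and m: "leq a m" "leq b m" "i a m x = i b m y"
      and n: "leq b n" "leq c n" "i b n y = i c n z"
      by (auto simp: direct_limit_rel_def)
    obtain k where k: "k \<in> \<Lambda>" "leq m k" "leq n k" using directed in\<Lambda> by blast
    have "i a k x = i m k (i a m x)" using comp[of a m k x] in\<Lambda> k m car by simp
    also have "\<dots> = i b k y" using comp[of b m k y] in\<Lambda> k m car by simp
    also have "\<dots> = i n k (i b n y)" using comp[of b n k y] in\<Lambda> k n car by simp
    also have "\<dots> = i c k z" using comp[of c n k z] in\<Lambda> k n car by simp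
    finally have "i a k x = i c k z" .
    moreover have "leq a k" "leq c k" using leq_trans in\<Lambda> k m n by blast+
    ultimately show "(p, r) \<in> rel"
      using pqr in\<Lambda> car k by (auto simp: direct_limit_rel_def)
  qed
qed

lemma inc_eq_iff:
  assumes "\<alpha> \<in> \<Lambda>" "x \<in> carrier (G \<alpha>)" "\<beta> \<in> \<Lambda>" "y \<in> carrier (G \<beta>)"
  shows "inc \<alpha> x = inc \<beta> y \<longleftrightarrow> (\<exists>\<gamma> \<in> \<Lambda>. leq \<alpha> \<gamma> \<and> leq \<beta> \<gamma> \<and> i \<alpha> \<gamma> x = i \<beta> \<gamma> y)"
  unfolding direct_limit_map_def
  using assms eq_equiv_class_iff[OF equiv_rel, of "(\<alpha>, x)" "(\<beta>, y)"]
  by (simp add: direct_limit_rel_def)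

lemma inc_compat:
  assumes "\<alpha> \<in> \<Lambda>" "\<beta> \<in> \<Lambda>" "leq \<alpha> \<beta>" "x \<in> carrier (G \<alpha>)"
  shows "inc \<beta> (i \<alpha> \<beta> x) = inc \<alpha> x"
proof -
  have "i \<beta> \<beta> (i \<alpha> \<beta> x) = i \<alpha> \<beta> x" using assms ident trans_closed by blast
  then show ?thesis using assms inc_eq_iff trans_closed leq_refl by metis
qed

lemma mem_inc_iff:
  assumes "\<alpha> \<in> \<Lambda>" "x \<in> carrier (G \<alpha>)"
  shows "(\<beta>, y) \<in> inc \<alpha> x \<longleftrightarrow> \<beta> \<in> \<Lambda> \<and> y \<in> carrier (G \<beta>) \<and> inc \<beta> y = inc \<alpha> x"
  using assms inc_eq_iff[OF assms, of \<beta> y]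
  by (auto simp: direct_limit_map_def direct_limit_rel_def)

lemma carrier_dlim: "carrier dlim = {inc \<alpha> x | \<alpha> x. \<alpha> \<in> \<Lambda> \<and> x \<in> carrier (G \<alpha>)}"
  by (auto simp: direct_limit_def quotient_def direct_limit_map_def)

lemma inc_closed: "\<lbrakk>\<alpha> \<in> \<Lambda>; x \<in> carrier (G \<alpha>)\<rbrakk> \<Longrightarrow> inc \<alpha> x \<in> carrier dlim"
  using carrier_dlim by blast

lemma one_dlim:
  assumes "\<alpha> \<in> \<Lambda>"
  shows "\<one>\<^bsub>dlim\<^esub> = inc \<alpha> \<one>\<^bsub>G \<alpha>\<^esub>"
proof -
  have "inc \<beta> \<one>\<^bsub>G \<beta>\<^esub> = inc \<alpha> \<one>\<^bsub>G \<alpha>\<^esub>" if \<beta>: "\<beta> \<in> \<Lambda>" for \<beta>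
  proof -
    obtain \<gamma> where "\<gamma> \<in> \<Lambda>" "leq \<alpha> \<gamma>" "leq \<beta> \<gamma>" using directed[OF assms \<beta>] by blast
    then show ?thesis
      using inc_eq_iff[OF \<beta> one_closed[OF \<beta>] assms one_closed[OF assms]] trans_one assms \<beta>
      by auto
  qed
  then have "(\<Union>\<beta> \<in> \<Lambda>. inc \<beta> \<one>\<^bsub>G \<beta>\<^esub>) = inc \<alpha> \<one>\<^bsub>G \<alpha>\<^esub>"
    using assms by blast
  then show ?thesis by (simp add: direct_limit_def)
qed

lemma mult_inc:
  assumes a: "a \<in> \<Lambda>" "x \<in> carrier (G a)" and b: "b \<in> \<Lambda>" "y \<in> carrier (G b)"
    and c: "c \<in> \<Lambda>" "leq a c" "leq b c"
  shows "inc a x \<otimes>\<^bsub>dlim\<^esub> inc b y = inc c (i a c x \<otimes>\<^bsub>G c\<^esub> i b c y)"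
proof -
  have *: "inc c' (i a' c' x' \<otimes>\<^bsub>G c'\<^esub> i b' c' y') = inc c (i a c x \<otimes>\<^bsub>G c\<^esub> i b c y)"
    if "(a', x') \<in> inc a x" "(b', y') \<in> inc b y" and c': "c' \<in> \<Lambda>" "leq a' c'" "leq b' c'"
    for a' x' b' y' c'
  proof -
    have a': "a' \<in> \<Lambda>" "x' \<in> carrier (G a')" "inc a' x' = inc a x"
      and b': "b' \<in> \<Lambda>" "y' \<in> carrier (G b')" "inc b' y' = inc b y"
      using that mem_inc_iff a b by auto
    have car: "i a' c' x' \<in> carrier (G c')" "i b' c' y' \<in> carrier (G c')"
      "i a c x \<in> carrier (G c)" "i b c y \<in> carrier (G c)"
      using trans_closed a b c a' b' c' by auto
    have "inc c' (i a' c' x') = inc c (i a c x)" "inc c' (i b' c' y') = inc c (i b c y)"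
      using a b c a' b' c' inc_compat by simp_all
    then obtain m n where m: "m \<in> \<Lambda>" "leq c' m" "leq c m" "i c' m (i a' c' x') = i c m (i a c x)"
      and n: "n \<in> \<Lambda>" "leq c' n" "leq c n" "i c' n (i b' c' y') = i c n (i b c y)"
      using inc_eq_iff[OF c'(1) car(1) c(1) car(3)] inc_eq_iff[OF c'(1) car(2) c(1) car(4)] by auto
    obtain k where k: "k \<in> \<Lambda>" "leq m k" "leq n k" using directed m n by blast
    have le: "leq c k" "leq c' k" using leq_trans k m c c' by blast+
    have "i c' k (i a' c' x') = i c k (i a c x)"
      using comp[of c' m k "i a' c' x'"] comp[of c m k "i a c x"] m k car c c' by metis
    moreover have "i c' k (i b' c' y') = i c k (i b c y)"
      using comp[of c' n k "i b' c' y'"] comp[of c n k "i b c y"] n k car c c' by metis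
    ultimately have "i c' k (i a' c' x' \<otimes>\<^bsub>G c'\<^esub> i b' c' y') = i c k (i a c x \<otimes>\<^bsub>G c\<^esub> i b c y)"
      using trans_mult[OF c'(1) k(1) le(2) car(1,2)] trans_mult[OF c(1) k(1) le(1) car(3,4)]
      by simp
    then show ?thesis
      using inc_eq_iff mult_closed car c c' k le by metis
  qed
  have "(a, x) \<in> inc a x" "(b, y) \<in> inc b y" using mem_inc_iff a b by auto
  then have "{inc c' (i a' c' x' \<otimes>\<^bsub>G c'\<^esub> i b' c' y') | a' x' b' y' c'.
        (a', x') \<in> inc a x \<and> (b', y') \<in> inc b y \<and> c' \<in> \<Lambda> \<and> leq a' c' \<and> leq b' c'}
      = {inc c (i a c x \<otimes>\<^bsub>G c\<^esub> i b c y)}"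
    using * c by blast
  then show ?thesis by (simp add: direct_limit_def)
qed

lemma mult_inc_same:
  assumes "a \<in> \<Lambda>" "x \<in> carrier (G a)" "y \<in> carrier (G a)"
  shows "inc a x \<otimes>\<^bsub>dlim\<^esub> inc a y = inc a (x \<otimes>\<^bsub>G a\<^esub> y)"
  using mult_inc[of a x a y a] assms leq_refl ident by simp

lemma lift_common:
  assumes "A \<in> carrier dlim" "B \<in> carrier dlim"
  obtains c x y where "c \<in> \<Lambda>" "x \<in> carrier (G c)" "y \<in> carrier (G c)" "A = inc c x" "B = inc c y"
proof -
  obtain a x where a: "a \<in> \<Lambda>" "x \<in> carrier (G a)" "A = inc a x"
    using assms carrier_dlim by blast
  obtain b y where b: "b \<in> \<Lambda>" "y \<in> carrier (G b)" "B = inc b y"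
    using assms carrier_dlim by blast
  obtain c where "c \<in> \<Lambda>" "leq a c" "leq b c" using directed a b by blast
  then show ?thesis using that a b inc_compat trans_closed by metis
qed

lemma lift_common3:
  assumes "A \<in> carrier dlim" "B \<in> carrier dlim" "C \<in> carrier dlim"
  obtains c x y z where "c \<in> \<Lambda>" "x \<in> carrier (G c)" "y \<in> carrier (G c)" "z \<in> carrier (G c)"
    "A = inc c x" "B = inc c y" "C = inc c z"
proof -
  obtain a x y where a: "a \<in> \<Lambda>" "x \<in> carrier (G a)" "y \<in> carrier (G a)" "A = inc a x" "B = inc a y"
    using lift_common assms by metis
  obtain b z where b: "b \<in> \<Lambda>" "z \<in> carrier (G b)" "C = inc b z"
    using assms carrier_dlim by blast
  obtain c where "c \<in> \<Lambda>" "leq a c" "leq b c" using directed a b by blast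
  then show ?thesis using that a b inc_compat trans_closed by metis
qed

lemma group_dlim: "group dlim"
proof (rule groupI)
  show "A \<otimes>\<^bsub>dlim\<^esub> B \<in> carrier dlim" if "A \<in> carrier dlim" "B \<in> carrier dlim" for A B
    using lift_common[OF that] mult_inc_same mult_closed inc_closed by metis
  show "\<one>\<^bsub>dlim\<^esub> \<in> carrier dlim"
    using nonempty one_dlim one_closed inc_closed by fastforce
  show "A \<otimes>\<^bsub>dlim\<^esub> B \<otimes>\<^bsub>dlim\<^esub> C = A \<otimes>\<^bsub>dlim\<^esub> (B \<otimes>\<^bsub>dlim\<^esub> C)"
    if ABC: "A \<in> carrier dlim" "B \<in> carrier dlim" "C \<in> carrier dlim" for A B C
  proof -
    obtain c x y z where *: "c \<in> \<Lambda>" "x \<in> carrier (G c)" "y \<in> carrier (G c)" "z \<in> carrier (G c)"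
      "A = inc c x" "B = inc c y" "C = inc c z"
      using lift_common3 ABC by metis
    interpret group "G c" using group * by blast
    show ?thesis using * by (simp add: mult_inc_same m_assoc)
  qed
  fix A assume "A \<in> carrier dlim"
  then obtain c x where *: "c \<in> \<Lambda>" "x \<in> carrier (G c)" "A = inc c x"
    using carrier_dlim by blast
  interpret group "G c" using group * by blast
  show "\<one>\<^bsub>dlim\<^esub> \<otimes>\<^bsub>dlim\<^esub> A = A"
    using * by (simp add: mult_inc_same one_dlim[of c])
  have "inc c (inv\<^bsub>G c\<^esub> x) \<otimes>\<^bsub>dlim\<^esub> A = \<one>\<^bsub>dlim\<^esub>"
    using * by (simp add: mult_inc_same one_dlim[of c])
  then show "\<exists>B \<in> carrier dlim. B \<otimes>\<^bsub>dlim\<^esub> A = \<one>\<^bsub>dlim\<^esub>"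
    using * inc_closed inv_closed by metis
qed

lemma inc_hom: "\<alpha> \<in> \<Lambda> \<Longrightarrow> inc \<alpha> \<in> hom (G \<alpha>) dlim"
  by (simp add: hom_def inc_closed mult_inc_same)

text \<open>Uniqueness is up to values outside the carrier, hence the restriction to
  extensional functions.\<close>

theorem direct_limit_universal:
  fixes H :: "('h, 'n) monoid_scheme" and \<psi> :: "'i \<Rightarrow> 'g \<Rightarrow> 'h"
  assumes H: "group H"
    and \<psi>: "\<And>\<alpha>. \<alpha> \<in> \<Lambda> \<Longrightarrow> \<psi> \<alpha> \<in> hom (G \<alpha>) H"
    and cocone: "\<And>\<alpha> \<beta> x. \<lbrakk>\<alpha> \<in> \<Lambda>; \<beta> \<in> \<Lambda>; leq \<alpha> \<beta>; x \<in> carrier (G \<alpha>)\<rbrakk> \<Longrightarrow> \<psi> \<beta> (i \<alpha> \<beta> x) = \<psi> \<alpha> x"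
  shows "\<exists>!h. h \<in> hom dlim H \<and> h \<in> extensional (carrier dlim) \<and>
              (\<forall>\<alpha> \<in> \<Lambda>. \<forall>x \<in> carrier (G \<alpha>). h (inc \<alpha> x) = \<psi> \<alpha> x)"
proof -
  have wd: "\<psi> a x = \<psi> b y"
    if "a \<in> \<Lambda>" "x \<in> carrier (G a)" "b \<in> \<Lambda>" "y \<in> carrier (G b)" "inc a x = inc b y" for a x b y
    using that inc_eq_iff cocone by metis
  define h where "h = (\<lambda>A \<in> carrier dlim.
    SOME z. \<exists>\<alpha> \<in> \<Lambda>. \<exists>x \<in> carrier (G \<alpha>). A = inc \<alpha> x \<and> z = \<psi> \<alpha> x)"
  have h: "h (inc \<alpha> x) = \<psi> \<alpha> x" if "\<alpha> \<in> \<Lambda>" "x \<in> carrier (G \<alpha>)" for \<alpha> x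
  proof -
    have "\<exists>\<beta> \<in> \<Lambda>. \<exists>y \<in> carrier (G \<beta>). inc \<alpha> x = inc \<beta> y \<and> h (inc \<alpha> x) = \<psi> \<beta> y"
      unfolding h_def using that inc_closed[OF that]
      by (simp del: bex_simps) (rule someI_ex, blast)
    then show ?thesis using wd[OF that] by auto
  qed
  have "h \<in> hom dlim H"
  proof (rule homI)
    show "h A \<in> carrier H" if A: "A \<in> carrier dlim" for A
    proof -
      obtain a x where "a \<in> \<Lambda>" "x \<in> carrier (G a)" "A = inc a x"
        using A carrier_dlim by blast
      then show ?thesis using h hom_in_carrier[OF \<psi>] by simp
    qed
    show "h (A \<otimes>\<^bsub>dlim\<^esub> B) = h A \<otimes>\<^bsub>H\<^esub> h B" if AB: "A \<in> carrier dlim" "B \<in> carrier dlim" for A B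
    proof -
      obtain c x y where "c \<in> \<Lambda>" "x \<in> carrier (G c)" "y \<in> carrier (G c)" "A = inc c x" "B = inc c y"
        using lift_common AB by metis
      then show ?thesis
        using h mult_closed hom_mult[OF \<psi>] mult_inc_same by simp
    qed
  qed
  moreover have "h \<in> extensional (carrier dlim)" by (simp add: h_def)
  moreover have "h' = h" if ext: "h' \<in> extensional (carrier dlim)"
    and h': "\<forall>\<alpha> \<in> \<Lambda>. \<forall>x \<in> carrier (G \<alpha>). h' (inc \<alpha> x) = \<psi> \<alpha> x" for h'
  proof (rule extensionalityI[OF ext])
    show "h \<in> extensional (carrier dlim)" by (simp add: h_def)
    show "h' A = h A" if "A \<in> carrier dlim" for A
    proof -
      obtain a x where "a \<in> \<Lambda>" "x \<in> carrier (G a)" "A = inc a x"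
        using \<open>A \<in> carrier dlim\<close> carrier_dlim by blast
      then show ?thesis using h h' by simp
    qed
  qed
  ultimately show ?thesis using h by blast
qed

end

end

theory Submission
  imports Defs "HOL-Homology.Homology" "HOL-Number_Theory.Cong"
begin

text \<open>The \<open>K\<close>-Lipschitz actions of the groups of the system, regarded as points of a power of the compact space
  \<open>X\<close>, have a cluster point by Tychonoff's theorem, and equicontinuity makes it a \<open>K\<close>-Lipschitz action of
  the direct limit. That no element acts trivially in the limit is due to Newman's theorem: there is
  \<open>\<epsilon> > 0\<close> such that every homeomorphism of prime order moves some point by at least \<open>\<epsilon>\<close> under one of its
  powers. A nontrivial torsion element has a power of prime order, whose finitely many powers
  cannot all converge to the identity.

  Newman's theorem is proved in a chart. If a map \<open>f\<close> of prime order \<open>p\<close> moves points by very little, then the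
  average \<open>F\<close> of the iterates of \<open>f\<close> is \<open>f\<close>-invariant and close to the identity, so it has degree 1 at every point
  \<open>c\<close>. If \<open>c\<close> is not fixed, then \<open>f\<close> acts freely near the level set of \<open>F\<close> at \<open>c\<close>. After a small invariant perturbation
  the level set lies in a disjoint union of translates \<open>(f ^^ j) ` P\<close> with \<open>j < p\<close>. They contribute equally
  to the degree, so \<open>p\<close> divides 1, a contradiction.\<close>

section \<open>Euclidean space with the metric of the sum norm\<close>

text \<open>The actions at different indices are unrelated, so passing to the limit only gives
  approximation at finitely many pairs of a group element and a point. The common constant
  \<open>K\<close> makes it uniform: a map of the action that moves every point of a finite
  \<open>e\<close>-net by less than \<open>e\<close> moves all points by less than
  \<open>(2 + K) * e\<close>. Newman's theorem can then be applied at one far index, because its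
  constant depends on the charts and the metric only, and not on the group or the prime. In the
  chart, primality makes every point that is not fixed free: if \<open>f ^^ j\<close> with
  \<open>0 < j < p\<close> fixes a point, so does \<open>f\<close>. No quotient by \<open>f\<close>
  is formed; the set \<open>P\<close> replaces it. It is pieced together from small balls, and the
  obstacle is that \<open>P\<close> must be open with disjoint translates, so closed balls have to
  be removed and boundary spheres get lost. The perturbation keeps the level set off these spheres,
  which is possible because a sphere has too small a dimension for a Lipschitz map to cover a
  neighbourhood of \<open>c\<close>.\<close>

text \<open>The dimension is a term, so vectors are sequences vanishing from index \<open>n\<close> on. The sum norm is
  convenient because on its spheres one coordinate is determined up to sign by the others.\<close>

definition Rn :: "nat \<Rightarrow> (nat \<Rightarrow> real) set" where
  "Rn n = {x. \<forall>i\<ge>n. x i = 0}"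

text \<open>The formula makes sense for all sequences but separates points only within
  \<open>Rn n\<close>, since the coordinates from \<open>n\<close> on are ignored.\<close>

definition dist1 :: "nat \<Rightarrow> (nat \<Rightarrow> real) \<Rightarrow> (nat \<Rightarrow> real) \<Rightarrow> real" where
  "dist1 n x y = (\<Sum>i<n. \<bar>x i - y i\<bar>)"

lemma Euclidean_space_eq_top_of_set: "Euclidean_space n = top_of_set (Rn n)"
  by (simp add: Euclidean_space_def Rn_def euclidean_product_topology)

lemma closed_Rn: "closed (Rn n)"
  using closedin_Euclidean_space[of n]
  by (simp add: topspace_Euclidean_space Rn_def euclidean_product_topology)

lemma dist1_nonneg [simp]: "0 \<le> dist1 n x y"
  by (simp add: dist1_def sum_nonneg)

lemma dist1_self [simp]: "dist1 n x x = 0"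
  by (simp add: dist1_def)

lemma dist1_commute: "dist1 n x y = dist1 n y x"
  by (simp add: dist1_def abs_minus_commute)

lemma dist1_triangle: "dist1 n x z \<le> dist1 n x y + dist1 n y z"
  unfolding dist1_def sum.distrib[symmetric] by (rule sum_mono) linarith

lemma dist1_coord_le: "i < n \<Longrightarrow> \<bar>x i - y i\<bar> \<le> dist1 n x y"
  unfolding dist1_def by (rule member_le_sum) auto

lemma dist1_eq_0_iff:
  assumes "x \<in> Rn n" "y \<in> Rn n"
  shows "dist1 n x y = 0 \<longleftrightarrow> x = y"
proof
  assume "dist1 n x y = 0"
  then have "x i = y i" for i
    using dist1_coord_le[of i n x y] assms by (cases "i < n") (auto simp: Rn_def)
  then show "x = y" by blast
qed simp

lemma continuous_on_dist1 [continuous_intros]: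
  assumes "continuous_on S f" "continuous_on S g"
  shows "continuous_on S (\<lambda>x. dist1 n (f x) (g x))"
proof -
  have "continuous_on S (\<lambda>x. f x i)" "continuous_on S (\<lambda>x. g x i)" for i
    using assms by (auto intro: continuous_on_product_then_coordinatewise)
  then show ?thesis unfolding dist1_def
    by (intro continuous_on_sum continuous_on_rabs continuous_on_diff)
qed

lemma continuous_on_dist1_right [continuous_intros]: "continuous_on S (dist1 n x)"
  using continuous_on_dist1[OF continuous_on_const continuous_on_id] by simp

text \<open>A basic open set of the product topology constrains finitely many coordinates, so the
  least of their tolerances is a positive radius; inserting 1 keeps the minimum defined when no
  coordinate is constrained.\<close>

lemma dist1_ball_subset_open:
  assumes "openin (top_of_set (Rn n)) W" "x \<in> W"
  obtains r where "r > 0" "{y \<in> Rn n. dist1 n x y < r} \<subseteq> W"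
proof -
  obtain V where V: "open V" "W = Rn n \<inter> V" using assms(1) by (auto simp: openin_open)
  then have "openin (product_topology (\<lambda>i. euclideanreal) UNIV) V"
    by (simp add: euclidean_product_topology)
  then obtain U where U: "finite {i. U i \<noteq> UNIV}" "\<And>i. open (U i)" "x \<in> Pi\<^sub>E UNIV U" "Pi\<^sub>E UNIV U \<subseteq> V"
    using assms(2) V by (auto simp: openin_product_topology_alt)
  have "\<exists>e>0. \<forall>t. \<bar>x i - t\<bar> < e \<longrightarrow> t \<in> U i" for i
  proof -
    have "x i \<in> U i" using U(3) by auto
    then show ?thesis using U(2)[of i] unfolding open_dist dist_real_def by (metis abs_minus_commute)
  qed
  then obtain e where e: "\<And>i. e i > (0::real)" "\<And>i t. \<bar>x i - t\<bar> < e i \<Longrightarrow> t \<in> U i" by metis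
  define r where "r = Min (insert 1 (e ` {i. U i \<noteq> UNIV}))"
  have r: "r > 0" "\<And>i. U i \<noteq> UNIV \<Longrightarrow> r \<le> e i" using U(1) e(1) by (auto simp: r_def)
  have "y \<in> W" if "y \<in> Rn n" "dist1 n x y < r" for y
  proof -
    have "x \<in> Rn n" using assms V by auto
    have "y i \<in> U i" for i
    proof (cases "U i = UNIV")
      case False
      have "\<bar>x i - y i\<bar> < r"
        using dist1_coord_le[of i n x y] that r(1) \<open>x \<in> Rn n\<close> by (cases "i < n") (auto simp: Rn_def)
      then show ?thesis using e(2) r(2)[OF False] by force
    qed auto
    then show ?thesis using U(4) V that by auto
  qed
  then show ?thesis using that r(1) by blast
qed

lemma openin_dist1_ball: "openin (top_of_set (Rn n)) {y \<in> Rn n. dist1 n x y < r}"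
proof -
  have "openin (top_of_set (Rn n)) (Rn n \<inter> dist1 n x -` {..<r})"
    by (intro continuous_openin_preimage_gen continuous_on_dist1_right) auto
  moreover have "Rn n \<inter> dist1 n x -` {..<r} = {y \<in> Rn n. dist1 n x y < r}" by auto
  ultimately show ?thesis by simp
qed

text \<open>The ball is a closed subset of the Tychonoff product \<open>B\<close> of intervals in
  the first \<open>n\<close> coordinates and points \<open>{0}\<close> in the others.\<close>

lemma compact_dist1_cball: "compact {y \<in> Rn n. dist1 n x y \<le> r}"
proof -
  define B where "B = Pi\<^sub>E UNIV (\<lambda>i. if i < n then {x i - r..x i + r} else {0})"
  have "compactin (product_topology (\<lambda>i::nat. euclideanreal) UNIV) B"
    unfolding B_def by (subst compactin_PiE) auto
  then have "compact B" by (simp add: euclidean_product_topology)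
  moreover have "closed {y \<in> Rn n. dist1 n x y \<le> r}"
  proof -
    have "closed (Rn n \<inter> dist1 n x -` {..r})"
      by (intro continuous_closed_preimage closed_Rn continuous_on_dist1_right) auto
    moreover have "Rn n \<inter> dist1 n x -` {..r} = {y \<in> Rn n. dist1 n x y \<le> r}" by auto
    ultimately show ?thesis by simp
  qed
  moreover have "{y \<in> Rn n. dist1 n x y \<le> r} \<subseteq> B"
  proof
    fix y assume y: "y \<in> {y \<in> Rn n. dist1 n x y \<le> r}"
    have "y i \<in> (if i < n then {x i - r..x i + r} else {0})" for i
    proof (cases "i < n")
      case True
      then have "\<bar>x i - y i\<bar> \<le> r" using dist1_coord_le[OF True, of x y] y by auto
      then show ?thesis using True by (simp add: abs_le_iff)
    qed (use y in \<open>auto simp: Rn_def\<close>)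
    then show "y \<in> B" unfolding B_def by blast
  qed
  ultimately have "compact (B \<inter> {y \<in> Rn n. dist1 n x y \<le> r})"
      and "B \<inter> {y \<in> Rn n. dist1 n x y \<le> r} = {y \<in> Rn n. dist1 n x y \<le> r}"
    by (blast intro: compact_Int_closed)+
  then show ?thesis by simp
qed

section \<open>Relative cycles and local degree\<close>

text \<open>The functional is the class map into the n-th homology of the pair followed by an
  isomorphism with the integers; the complement step reduces that group to the homology in degree 0
  of the one-point space \<open>Euclidean_space 0\<close>. It is kept as a function on chains so
  that explicit relative cycles can be compared and added.\<close>

lemma degree_functional_0:
  obtains \<theta> :: "(nat \<Rightarrow> real) chain \<Rightarrow> int" and z where
    "\<And>a b. \<lbrakk>singular_relcycle n (top_of_set (Rn n)) (Rn n - {\<lambda>_. 0}) a;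
              singular_relcycle n (top_of_set (Rn n)) (Rn n - {\<lambda>_. 0}) b\<rbrakk> \<Longrightarrow> \<theta> (a + b) = \<theta> a + \<theta> b"
    "\<And>a b. homologous_rel n (top_of_set (Rn n)) (Rn n - {\<lambda>_. 0}) a b \<Longrightarrow> \<theta> a = \<theta> b"
    "singular_relcycle n (top_of_set (Rn n)) (Rn n - {\<lambda>_. 0}) z" "\<theta> z = 1"
proof -
  let ?X = "top_of_set (Rn n)" and ?S = "Rn n - {\<lambda>_. 0}"
  let ?H = "relative_homology_group (int n) ?X ?S"
  have E0: "topspace (Euclidean_space 0) = {\<lambda>_. 0}"
    by (auto simp: topspace_Euclidean_space)
  have "closedin (Euclidean_space 0) {\<lambda>_. 0}"
    using closedin_topspace[of "Euclidean_space 0"] E0 by simp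
  from relative_homology_group_Euclidean_complement_step[OF this, of 0 n]
  have "homology_group 0 (Euclidean_space 0) \<cong> ?H"
    by (simp add: E0) (simp add: Euclidean_space_eq_top_of_set)
  then have "?H \<cong> integer_group"
    using homology_coefficients[OF E0] group.iso_sym iso_trans group_relative_homology_group by metis
  then obtain g where g: "g \<in> iso ?H integer_group" by (auto simp: is_iso_def)
  have q: "homologous_rel_set n ?X ?S \<in> hom (relcycle_group n ?X ?S) ?H"
    unfolding right_coset_singular_relboundary[symmetric]
    unfolding nontrivial_relative_homology_group
    by (rule normal.r_coset_hom_Mod[OF normal_subgroup_singular_relboundary_relcycle])
  define \<theta> where "\<theta> = g \<circ> homologous_rel_set n ?X ?S"
  have "\<theta> \<in> hom (relcycle_group n ?X ?S) integer_group"
    unfolding \<theta>_def using q g by (auto intro: hom_compose simp: iso_def)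
  then have 1: "\<theta> (a + b) = \<theta> a + \<theta> b" if "singular_relcycle n ?X ?S a" "singular_relcycle n ?X ?S b" for a b
    using that by (auto simp: hom_def integer_group_def)
  have 2: "\<theta> a = \<theta> b" if "homologous_rel n ?X ?S a b" for a b
    using that unfolding \<theta>_def o_def by (metis homologous_rel_set_eq)
  have "(1::int) \<in> g ` carrier ?H" using g by (auto simp: iso_def bij_betw_def integer_group_def)
  then obtain z where "singular_relcycle n ?X ?S z" "\<theta> z = 1"
    unfolding carrier_relative_homology_group \<theta>_def by auto
  then show ?thesis using that 1 2 by blast
qed

section \<open>Relative cycles in subspaces: inclusion, splitting and excision\<close>

lemma singular_chain_top_of_set_Int:
  "singular_chain p (top_of_set (A \<inter> B)) c \<longleftrightarrow> singular_chain p (top_of_set A) c \<and> singular_chain p (top_of_set B) c"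
  by (simp add: singular_chain_subtopology) blast

lemma singular_chain_top_of_set_mono:
  "\<lbrakk>singular_chain p (top_of_set A) c; A \<subseteq> B\<rbrakk> \<Longrightarrow> singular_chain p (top_of_set B) c"
  by (rule singular_chain_mono)

lemma singular_relcycle_mono:
  assumes "singular_relcycle p (top_of_set A) S c" "A \<subseteq> B" "A \<inter> S \<subseteq> T"
  shows "singular_relcycle p (top_of_set B) T c"
  using assms unfolding singular_relcycle subtopology_subtopology
  by (auto elim!: singular_chain_top_of_set_mono)

text \<open>An inclusion of pairs leaves chains unchanged, so the witnesses for the smaller pair
  serve for the larger one, without a \<open>chain_map\<close> of the inclusion.\<close>

lemma homologous_rel_mono:
  assumes "homologous_rel p (top_of_set A) S a b" "A \<subseteq> B" "A \<inter> S \<subseteq> T"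
  shows "homologous_rel p (top_of_set B) T a b"
proof -
  obtain d e where "singular_chain (Suc p) (top_of_set A) d" "singular_chain p (top_of_set (A \<inter> S)) e"
      "chain_boundary (Suc p) d = (a - b) + e"
    using assms(1) by (auto simp: homologous_rel_def singular_relboundary_alt subtopology_subtopology)
  moreover have "A \<inter> S \<subseteq> B \<inter> T" using assms by blast
  ultimately show ?thesis
    using singular_chain_top_of_set_mono assms(2)
    unfolding homologous_rel_def singular_relboundary_alt subtopology_subtopology by blast
qed

lemma homologous_rel_chain_map:
  assumes "homologous_rel p X S a b" "continuous_map X Y g" "g \<in> S \<rightarrow> T"
  shows "homologous_rel p Y T (chain_map p g a) (chain_map p g b)"
  using singular_relboundary_chain_map[OF _ assms(2,3)] assms(1)
  by (simp add: homologous_rel_def chain_map_diff[symmetric])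

text \<open>Only the segments over \<open>S\<close> carry a condition: convexity of
  \<open>Rn n\<close> keeps all the others inside the target.\<close>

lemma homotopic_with_linear_Rn:
  assumes f: "continuous_on B f" "f \<in> B \<rightarrow> Rn n" and g: "continuous_on B g" "g \<in> B \<rightarrow> Rn n"
    and line: "\<And>x t. \<lbrakk>x \<in> S; 0 \<le> t; t \<le> 1\<rbrakk> \<Longrightarrow> (\<lambda>i. (1 - t) * f x i + t * g x i) \<in> T"
  shows "homotopic_with (\<lambda>h. h \<in> S \<rightarrow> T) (top_of_set B) (top_of_set (Rn n)) f g"
proof -
  let ?h = "\<lambda>(t, x) i. (1 - t) * f x i + t * g x i"
  have "continuous_on ({0..1} \<times> B) ?h"
  proof (rule continuous_on_coordinatewise_then_product)
    fix i
    have "continuous_on B (\<lambda>x. f x i)" "continuous_on B (\<lambda>x. g x i)"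
      using f g by (auto intro: continuous_on_product_then_coordinatewise)
    then have "continuous_on ({0..1} \<times> B) (\<lambda>z. f (snd z) i)" "continuous_on ({0..1} \<times> B) (\<lambda>z. g (snd z) i)"
      by (auto intro: continuous_on_compose2[OF _ continuous_on_snd[OF continuous_on_id]])
    then show "continuous_on ({0..1::real} \<times> B) (\<lambda>z. ?h z i)"
      unfolding case_prod_unfold by (intro continuous_on_add continuous_on_mult continuous_on_diff
          continuous_on_const continuous_on_fst continuous_on_id)
  qed
  moreover have "?h \<in> {0..1} \<times> B \<rightarrow> Rn n" using f g by (auto simp: Rn_def Pi_iff)
  ultimately have "continuous_map (prod_topology (top_of_set {0..1}) (top_of_set B)) (top_of_set (Rn n)) ?h"
    by (simp add: prod_topology_subtopology_eu)
  then show ?thesis unfolding homotopic_with_def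
    using line by (intro exI[of _ ?h]) auto
qed

text \<open>As the standard simplex is nonempty, simplices carried by disjoint sets are different
  generators of the free abelian group. Hence nothing cancels in \<open>a + b\<close>.\<close>

lemma singular_chain_disjoint_summand:
  assumes "singular_chain p (top_of_set P) a" "singular_chain p (top_of_set Q) b" "P \<inter> Q = {}"
    and "singular_chain p (top_of_set V) (a + b)"
  shows "singular_chain p (top_of_set V) a"
proof -
  have "Poly_Mapping.keys a \<inter> Poly_Mapping.keys b = {}"
  proof (rule ccontr)
    assume "Poly_Mapping.keys a \<inter> Poly_Mapping.keys b \<noteq> {}"
    then obtain f where "f \<in> Poly_Mapping.keys a" "f \<in> Poly_Mapping.keys b" by blast
    then have "f ` standard_simplex p \<subseteq> P" "f ` standard_simplex p \<subseteq> Q"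
      using assms(1,2) by (auto simp: singular_chain_subtopology)
    then show False using assms(3) nonempty_standard_simplex[of p] by blast
  qed
  then have "f \<in> Poly_Mapping.keys (a + b)" if "f \<in> Poly_Mapping.keys a" for f
    using that by (auto simp: in_keys_iff Poly_Mapping.lookup_add)
  then show ?thesis using assms(1,4) by (auto simp: singular_chain_def)
qed

lemma frag_split_family:
  fixes z :: "'b \<Rightarrow>\<^sub>0 int"
  assumes "finite J" "Poly_Mapping.keys z \<subseteq> A \<union> (\<Union>j\<in>J. B j)"
  shows "\<exists>e \<zeta>. Poly_Mapping.keys e \<subseteq> A \<and> (\<forall>j\<in>J. Poly_Mapping.keys (\<zeta> j) \<subseteq> B j) \<and> z = e + (\<Sum>j\<in>J. \<zeta> j)"
  using assms
proof (induction J arbitrary: z rule: finite_induct)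
  case (insert k J)
  have "Poly_Mapping.keys z \<subseteq> B k \<union> (A \<union> (\<Union>j\<in>J. B j))" using insert.prems by auto
  then obtain d e where de: "Poly_Mapping.keys d \<subseteq> B k" "Poly_Mapping.keys e \<subseteq> A \<union> (\<Union>j\<in>J. B j)" "d + e = z" by (rule frag_split)
  obtain e' \<zeta> where *: "Poly_Mapping.keys e' \<subseteq> A" "\<forall>j\<in>J. Poly_Mapping.keys (\<zeta> j) \<subseteq> B j" "e = e' + (\<Sum>j\<in>J. \<zeta> j)"
    using insert.IH[OF de(2)] by blast
  have "(\<Sum>j\<in>J. (\<zeta>(k := d)) j) = (\<Sum>j\<in>J. \<zeta> j)" using insert.hyps by (intro sum.cong) auto
  then have "z = e' + (\<Sum>j\<in>insert k J. (\<zeta>(k := d)) j)"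
    using insert.hyps de * by (simp add: algebra_simps)
  then show ?case using de * insert.hyps by (intro exI[of _ e'] exI[of _ "\<zeta>(k := d)"]) auto
qed auto

text \<open>After subdivision every simplex lies in \<open>W - K\<close> or in one
  \<open>P j\<close>, and the terms are grouped accordingly. At first only the sum of the boundaries
  of the pieces is known to avoid \<open>K\<close>; as the \<open>P j\<close> are disjoint, these
  boundaries cannot cancel each other, so each piece is a relative cycle by itself.\<close>

lemma singular_relcycle_split_disjoint:
  assumes z: "singular_relcycle p (top_of_set W) (W - K) z"
    and J: "finite J" "\<And>j. j \<in> J \<Longrightarrow> openin (top_of_set W) (P j)" "disjoint_family_on P J"
    and K: "K \<subseteq> (\<Union>j\<in>J. P j)" "openin (top_of_set W) (W - K)"
  obtains \<zeta> where "\<And>j. j \<in> J \<Longrightarrow> singular_relcycle p (top_of_set (P j)) (P j - K) (\<zeta> j)"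
    "homologous_rel p (top_of_set W) (W - K) z (\<Sum>j\<in>J. \<zeta> j)"
proof -
  have PW: "P j \<subseteq> W" if "j \<in> J" for j using J(2)[OF that] openin_imp_subset by blast
  have op: "openin (top_of_set W) U" if "U \<in> insert (W - K) (P ` J)" for U using that J K by auto
  have cov: "topspace (top_of_set W) \<subseteq> \<Union> (insert (W - K) (P ` J))" using K by auto
  obtain z' where z': "singular_relcycle p (top_of_set W) (W - K) z'"
      "homologous_rel p (top_of_set W) (W - K) z z'"
      "\<And>f. f \<in> Poly_Mapping.keys z' \<Longrightarrow> \<exists>V \<in> insert (W - K) (P ` J). f \<in> standard_simplex p \<rightarrow> V"
    using small_homologous_rel_relcycle_exists[OF op cov z] by metis
  have sW: "singular_simplex p (top_of_set W) f" if "f \<in> Poly_Mapping.keys z'" for f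
    using z'(1) that by (auto simp: singular_relcycle singular_chain_def)
  have sub: "singular_simplex p (top_of_set V) f" if "f \<in> Poly_Mapping.keys z'" "f \<in> standard_simplex p \<rightarrow> V" for f V
    using sW[OF that(1)] that(2) by (auto simp: singular_simplex_subtopology)
  have "Poly_Mapping.keys z' \<subseteq> singular_simplex_set p (top_of_set (W - K)) \<union> (\<Union>j\<in>J. singular_simplex_set p (top_of_set (P j)))"
  proof
    fix f assume f: "f \<in> Poly_Mapping.keys z'"
    obtain V where "V \<in> insert (W - K) (P ` J)" "f \<in> standard_simplex p \<rightarrow> V"
      using z'(3)[OF f] by (rule bexE)
    then show "f \<in> singular_simplex_set p (top_of_set (W - K)) \<union> (\<Union>j\<in>J. singular_simplex_set p (top_of_set (P j)))"
      using sub[OF f] by auto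
  qed
  from frag_split_family[OF J(1) this] obtain e \<zeta> where
    e: "singular_chain p (top_of_set (W - K)) e" and
    \<zeta>: "\<And>j. j \<in> J \<Longrightarrow> singular_chain p (top_of_set (P j)) (\<zeta> j)" and
    eq: "z' = e + (\<Sum>j\<in>J. \<zeta> j)"
    unfolding singular_chain_def by blast
  have bd: "singular_chain (p - 1) (top_of_set (W - K)) (\<Sum>j\<in>J. chain_boundary p (\<zeta> j))"
  proof -
    have "(\<Sum>j\<in>J. chain_boundary p (\<zeta> j)) = chain_boundary p z' - chain_boundary p e"
      by (simp add: eq chain_boundary_add chain_boundary_sum)
    moreover have "W \<inter> (W - K) = W - K" by blast
    ultimately show ?thesis
      using z'(1) singular_chain_boundary[OF e]
      by (auto simp: singular_relcycle subtopology_subtopology intro: singular_chain_diff)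
  qed
  have 1: "singular_relcycle p (top_of_set (P j)) (P j - K) (\<zeta> j)" if j: "j \<in> J" for j
  proof -
    let ?Q = "\<Union>t\<in>J - {j}. P t"
    have bP: "singular_chain (p - 1) (top_of_set (P t)) (chain_boundary p (\<zeta> t))" if "t \<in> J" for t
      using singular_chain_boundary[OF \<zeta>[OF that]] by simp
    have "singular_chain (p - 1) (top_of_set ?Q) (\<Sum>t\<in>J - {j}. chain_boundary p (\<zeta> t))"
      by (intro singular_chain_sum singular_chain_top_of_set_mono[OF bP]) auto
    moreover have "P j \<inter> ?Q = {}" using J(3) j by (auto simp: disjoint_family_on_def)
    moreover have "singular_chain (p - 1) (top_of_set (W - K))
        (chain_boundary p (\<zeta> j) + (\<Sum>t\<in>J - {j}. chain_boundary p (\<zeta> t)))"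
      using bd sum.remove[OF J(1) j, of "\<lambda>j. chain_boundary p (\<zeta> j)"] by simp
    ultimately have "singular_chain (p - 1) (top_of_set (W - K)) (chain_boundary p (\<zeta> j))"
      using singular_chain_disjoint_summand[OF bP[OF j]] by blast
    then have "singular_chain (p - 1) (top_of_set (P j \<inter> (W - K))) (chain_boundary p (\<zeta> j))"
      using bP[OF j] unfolding singular_chain_top_of_set_Int by blast
    moreover have "P j \<inter> (W - K) = P j \<inter> (P j - K)" using PW[OF j] by blast
    ultimately show ?thesis
      using \<zeta>[OF j] by (simp only: singular_relcycle subtopology_subtopology)
  qed
  have "singular_chain p (subtopology (top_of_set W) (W - K)) (z' - (\<Sum>j\<in>J. \<zeta> j))"
  proof -
    have "W \<inter> (W - K) = W - K" by blast
    then show ?thesis using e by (simp add: eq subtopology_subtopology)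
  qed
  then have "homologous_rel p (top_of_set W) (W - K) z' (\<Sum>j\<in>J. \<zeta> j)"
    unfolding homologous_rel_def by (rule singular_chain_imp_relboundary)
  then have "homologous_rel p (top_of_set W) (W - K) z (\<Sum>j\<in>J. \<zeta> j)"
    using z'(2) homologous_rel_trans by blast
  then show ?thesis using that[OF 1] by blast
qed

text \<open>The part \<open>A - P\<close> is excised. What matters is injectivity of the map induced
  by the inclusion: a homology found in the large space \<open>A\<close> is replaced by one inside
  \<open>P\<close>.\<close>

lemma homologous_rel_excision:
  assumes "openin (top_of_set A) P" "closedin (top_of_set A) K" "K \<subseteq> P"
    and "singular_relcycle p (top_of_set P) (P - K) a" "singular_relcycle p (top_of_set P) (P - K) b"
    and "homologous_rel p (top_of_set A) (A - K) a b"
  shows "homologous_rel p (top_of_set P) (P - K) a b"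
proof -
  let ?X = "top_of_set A"
  have PA: "P \<subseteq> A" "K \<subseteq> A" using assms openin_imp_subset by blast+
  have "openin ?X (A - K)" using assms(2) by (simp add: openin_diff)
  moreover have "closedin ?X (A - P)" using assms(1) by (simp add: closedin_diff)
  ultimately have "?X closure_of (A - P) \<subseteq> ?X interior_of (A - K)"
    using assms(3) by (simp add: closure_of_closedin interior_of_openin) blast
  from homology_excision_axiom[OF this, of A p]
  have "hom_induced p (subtopology ?X (A - (A - P))) (A - K - (A - P)) (subtopology ?X A) (A - K) id
    \<in> iso (relative_homology_group p (subtopology ?X (A - (A - P))) (A - K - (A - P)))
        (relative_homology_group p (subtopology ?X A) (A - K))" by auto
  moreover have "subtopology ?X (A - (A - P)) = top_of_set P" "A - K - (A - P) = P - K" "subtopology ?X A = ?X"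
    using PA assms(3) by (auto simp: subtopology_subtopology Diff_Diff_Int Int_absorb1)
  ultimately have iso: "hom_induced p (top_of_set P) (P - K) ?X (A - K) id
    \<in> iso (relative_homology_group p (top_of_set P) (P - K)) (relative_homology_group p ?X (A - K))" by simp
  have im: "hom_induced p (top_of_set P) (P - K) ?X (A - K) id (homologous_rel_set p (top_of_set P) (P - K) w)
      = homologous_rel_set p ?X (A - K) w" if "singular_relcycle p (top_of_set P) (P - K) w" for w
  proof -
    have "chain_map p id w = w" using that chain_map_ident by (auto simp: singular_relcycle)
    moreover have "continuous_map (top_of_set P) ?X id" "id \<in> P - K \<rightarrow> A - K" using PA by auto
    ultimately show ?thesis
      using hom_induced_chain_map[OF _ _ that] by metis
  qed
  have "homologous_rel_set p ?X (A - K) a = homologous_rel_set p ?X (A - K) b"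
    using assms(6) by (simp add: homologous_rel_set_eq)
  then have eq: "hom_induced p (top_of_set P) (P - K) ?X (A - K) id (homologous_rel_set p (top_of_set P) (P - K) a)
      = hom_induced p (top_of_set P) (P - K) ?X (A - K) id (homologous_rel_set p (top_of_set P) (P - K) b)"
    by (simp only: im[OF assms(4)] im[OF assms(5)])
  have "homologous_rel_set p (top_of_set P) (P - K) w \<in> carrier (relative_homology_group p (top_of_set P) (P - K))"
    if "singular_relcycle p (top_of_set P) (P - K) w" for w
    using that by (simp add: carrier_relative_homology_group)
  note car = this[OF assms(4)] this[OF assms(5)]
  have "inj_on (hom_induced p (top_of_set P) (P - K) ?X (A - K) id)
      (carrier (relative_homology_group p (top_of_set P) (P - K)))"
    using iso by (simp add: iso_def bij_betw_def)
  from inj_onD[OF this eq car]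
  have "homologous_rel_set p (top_of_set P) (P - K) a = homologous_rel_set p (top_of_set P) (P - K) b" .
  then show ?thesis by (simp add: homologous_rel_set_eq)
qed

text \<open>Serves to give the boundary of a generator a positive distance from the puncture; the
  compact set is the union of the images of the finitely many simplices.\<close>

lemma singular_chain_compact_support:
  fixes c :: "(nat \<Rightarrow> real) chain"
  assumes "singular_chain p (top_of_set S) c"
  obtains C where "compact C" "C \<subseteq> S" "singular_chain p (top_of_set C) c"
proof -
  define C where "C = (\<Union>f\<in>Poly_Mapping.keys c. f ` standard_simplex p)"
  have "compact (standard_simplex p)"
    using compactin_standard_simplex[of p] by (simp add: euclidean_product_topology)
  moreover have "continuous_on (standard_simplex p) f" if "f \<in> Poly_Mapping.keys c" for f
    using assms that
    by (auto simp: singular_chain_def singular_simplex_def euclidean_product_topology)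
  ultimately have "compact C" unfolding C_def
    by (intro compact_UN finite_keys compact_continuous_image) auto
  moreover have "C \<subseteq> S" using assms by (auto simp: C_def singular_chain_subtopology)
  moreover have "singular_chain p (top_of_set C) c"
    using assms by (auto simp: C_def singular_chain_subtopology)
  ultimately show ?thesis using that by blast
qed

text \<open>The boundary of a generator at the origin stays at distance at least
  \<open>\<rho>\<close> from it. The dilation \<open>\<phi>\<close> towards \<open>c\<close> pushes
  this boundary out of the ball of radius \<open>r\<close>, excision then shrinks the cycle into the
  ball of radius \<open>R\<close>, and \<open>\<theta>\<close> undoes the dilation by
  \<open>\<psi>\<close> before measuring.\<close>

lemma degree_functional:
  assumes c: "c \<in> Rn n" and rR: "0 < r" "r < R"
  obtains \<theta> :: "(nat \<Rightarrow> real) chain \<Rightarrow> int" and z where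
    "\<And>a b. \<lbrakk>singular_relcycle n (top_of_set (Rn n)) (Rn n - {c}) a;
              singular_relcycle n (top_of_set (Rn n)) (Rn n - {c}) b\<rbrakk> \<Longrightarrow> \<theta> (a + b) = \<theta> a + \<theta> b"
    "\<And>a b. homologous_rel n (top_of_set (Rn n)) (Rn n - {c}) a b \<Longrightarrow> \<theta> a = \<theta> b"
    "singular_relcycle n (top_of_set {y \<in> Rn n. dist1 n c y < R})
       ({y \<in> Rn n. dist1 n c y < R} - {y. dist1 n c y \<le> r}) z" "\<theta> z = 1"
proof -
  let ?E = "top_of_set (Rn n)" and ?B = "{y \<in> Rn n. dist1 n c y < R}" and ?D = "{y \<in> Rn n. dist1 n c y \<le> r}"
  obtain \<theta>0 z0 where add0: "\<And>a b. \<lbrakk>singular_relcycle n ?E (Rn n - {\<lambda>_. 0}) a;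
              singular_relcycle n ?E (Rn n - {\<lambda>_. 0}) b\<rbrakk> \<Longrightarrow> \<theta>0 (a + b) = \<theta>0 a + (\<theta>0 b :: int)"
    and hom0: "\<And>a b. homologous_rel n ?E (Rn n - {\<lambda>_. 0}) a b \<Longrightarrow> \<theta>0 a = \<theta>0 b"
    and z0: "singular_relcycle n ?E (Rn n - {\<lambda>_. 0}) z0" "\<theta>0 z0 = 1"
    using degree_functional_0[of n thesis] by blast
  have "Rn n \<inter> (Rn n - {\<lambda>_. 0}) = Rn n - {\<lambda>_. 0}" by blast
  then have "singular_chain (n - 1) (top_of_set (Rn n - {\<lambda>_. 0})) (chain_boundary n z0)"
    using z0(1) by (simp add: singular_relcycle subtopology_subtopology)
  then obtain C where C: "compact C" "C \<subseteq> Rn n - {\<lambda>_. 0}"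
      "singular_chain (n - 1) (top_of_set C) (chain_boundary n z0)"
    by (rule singular_chain_compact_support)
  obtain \<rho> where \<rho>: "\<rho> > 0" "\<And>y. y \<in> C \<Longrightarrow> \<rho> \<le> dist1 n (\<lambda>_. 0) y"
  proof (cases "C = {}")
    case False
    then obtain y0 where y0: "y0 \<in> C" "\<And>y. y \<in> C \<Longrightarrow> dist1 n (\<lambda>_. 0) y0 \<le> dist1 n (\<lambda>_. 0) y"
      using continuous_attains_inf[OF C(1) False continuous_on_dist1_right] by blast
    have "dist1 n (\<lambda>_. 0) y0 \<noteq> 0"
      using dist1_eq_0_iff[of "\<lambda>_. 0" n y0] C(2) y0(1) by (auto simp: Rn_def)
    then have "dist1 n (\<lambda>_. 0) y0 > 0" using dist1_nonneg[of n "\<lambda>_. 0" y0] by linarith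
    then show ?thesis using that y0 by blast
  qed (use that[of 1] in auto)
  \<comment> \<open>This makes \<open>t * \<rho>\<close> equal to \<open>r + 1\<close>, so the
    dilated \<open>C\<close> lies outside the closed ball of radius \<open>r\<close>.\<close>
  define t where "t = (r + 1) / \<rho>"
  have t: "t > 0" "t * \<rho> > r" using rR \<rho> by (auto simp: t_def)
  define \<phi> where "\<phi> = (\<lambda>(x::nat\<Rightarrow>real) i. c i + t * x i)"
  define \<psi> where "\<psi> = (\<lambda>(y::nat\<Rightarrow>real) i. (y i - c i) / t)"
  have coord: "continuous_on A (\<lambda>x::nat\<Rightarrow>real. x i)" for A i
    by (rule continuous_on_product_then_coordinatewise) (rule continuous_on_id)
  have cont: "continuous_map ?E ?E \<phi>" "continuous_map ?E ?E \<psi>"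
    using c t unfolding \<phi>_def \<psi>_def
    by (auto simp: Rn_def intro!: continuous_on_coordinatewise_then_product continuous_on_add continuous_on_mult
          continuous_on_divide continuous_on_diff coord)
  have \<psi>\<phi>: "\<psi> (\<phi> x) = x" for x using t by (auto simp: \<phi>_def \<psi>_def)
  have d\<phi>: "dist1 n c (\<phi> x) = t * dist1 n (\<lambda>_. 0) x" for x
    using t by (simp add: dist1_def \<phi>_def sum_distrib_left abs_mult)
  have \<psi>0: "\<psi> \<in> Rn n - {c} \<rightarrow> Rn n - {\<lambda>_. 0}"
    using c t by (auto simp: \<psi>_def Rn_def fun_eq_iff)
  have "Rn n \<inter> C = C" using C by blast
  then have z0C: "singular_relcycle n ?E C z0"
    using z0(1) C by (simp add: singular_relcycle subtopology_subtopology)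
  have "\<phi> \<in> C \<rightarrow> Rn n - ?D"
  proof
    fix y assume y: "y \<in> C"
    have "r < t * dist1 n (\<lambda>_. 0) y" using \<rho>(2)[OF y] t mult_left_mono[of \<rho> "dist1 n (\<lambda>_. 0) y" t] by linarith
    then show "\<phi> y \<in> Rn n - ?D" using d\<phi>[of y] y C cont(1) by auto
  qed
  then have z1: "singular_relcycle n ?E (Rn n - ?D) (chain_map n \<phi> z0)"
    using singular_relcycle_chain_map[OF z0C cont(1)] by blast
  have BU: "Rn n - (Rn n - ?B) = ?B" "Rn n \<inter> ?B = ?B" by auto
  have "?E closure_of (Rn n - ?B) \<subseteq> ?E interior_of (Rn n - ?D)"
  proof -
    have "closedin ?E (Rn n - ?B)" using openin_dist1_ball[of n c R] by (simp add: closedin_diff)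
    moreover have "closed ?D" by (intro compact_imp_closed compact_dist1_cball)
    then have "openin ?E (Rn n - ?D)" by (metis Diff_eq open_Compl openin_open_Int)
    ultimately show ?thesis using rR by (auto simp: closure_of_closedin interior_of_openin)
  qed
  then obtain z where z: "singular_relcycle n (subtopology ?E (Rn n - (Rn n - ?B))) (Rn n - ?D - (Rn n - ?B)) z"
      "homologous_rel n (subtopology ?E (Rn n)) (Rn n - ?D) (chain_map n \<phi> z0) z"
    using excised_relcycle_exists[of ?E "Rn n - ?B" "Rn n - ?D" "Rn n" n "chain_map n \<phi> z0"] z1
    by (auto simp: subtopology_subtopology)
  define \<theta> where "\<theta> = \<theta>0 \<circ> chain_map n \<psi>"
  have hom: "\<theta> a = \<theta> b" if "homologous_rel n ?E (Rn n - {c}) a b" for a b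
    unfolding \<theta>_def o_def by (intro hom0 homologous_rel_chain_map[OF that cont(2) \<psi>0])
  have "\<theta> (a + b) = \<theta> a + \<theta> b"
    if "singular_relcycle n ?E (Rn n - {c}) a" "singular_relcycle n ?E (Rn n - {c}) b" for a b
    unfolding \<theta>_def o_def chain_map_add using that \<psi>0 cont(2)
    by (intro add0 singular_relcycle_chain_map) auto
  moreover have "\<theta> z = 1"
  proof -
    have "homologous_rel n ?E (Rn n - ?D) (chain_map n \<phi> z0) z"
      using z(2) by (simp only: subtopology_subtopology Int_absorb)
    then have "homologous_rel n ?E (Rn n - {c}) (chain_map n \<phi> z0) z"
      by (rule homologous_rel_mono) (use c rR in auto)
    then have "\<theta> z = \<theta> (chain_map n \<phi> z0)" using hom by metis
    also have "\<dots> = \<theta>0 (chain_map n (\<psi> \<circ> \<phi>) z0)" by (simp add: \<theta>_def chain_map_compose)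
    also have "chain_map n (\<psi> \<circ> \<phi>) z0 = z0"
      using z0(1) \<psi>\<phi> by (intro chain_map_id_gen[of n ?E]) (auto simp: singular_relcycle)
    finally show ?thesis using z0 by simp
  qed
  moreover have "Rn n - ?D - (Rn n - ?B) = ?B - {y. dist1 n c y \<le> r}" by auto
  then have "singular_relcycle n (top_of_set ?B) (?B - {y. dist1 n c y \<le> r}) z"
    using z(1) by (simp only: BU subtopology_subtopology)
  ultimately show ?thesis using that hom by blast
qed

lemma dist1_segment_le:
  assumes "0 \<le> t" "t \<le> 1"
  shows "dist1 n x (\<lambda>i. (1 - t) * y i + t * x i) \<le> dist1 n x y"
proof -
  have "\<bar>x i - ((1 - t) * y i + t * x i)\<bar> = (1 - t) * \<bar>x i - y i\<bar>" for i
  proof -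
    have "x i - ((1 - t) * y i + t * x i) = (1 - t) * (x i - y i)" by (simp add: algebra_simps)
    then show ?thesis using assms by (simp add: abs_mult)
  qed
  then have "dist1 n x (\<lambda>i. (1 - t) * y i + t * x i) = (1 - t) * dist1 n x y"
    by (simp add: dist1_def sum_distrib_left)
  also have "\<dots> \<le> 1 * dist1 n x y" using assms by (intro mult_right_mono) auto
  finally show ?thesis by simp
qed

section \<open>Iterates of a periodic map and the degree of an invariant map\<close>

lemma funpow_inverse_on:
  assumes "\<And>x. x \<in> W \<Longrightarrow> (f ^^ p) x = x" "x \<in> W" "j \<le> p"
  shows "(f ^^ (p - j)) ((f ^^ j) x) = x"
proof -
  have "(f ^^ (p - j)) ((f ^^ j) x) = (f ^^ (p - j + j)) x" by (simp add: funpow_add)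
  then show ?thesis using assms by simp
qed

lemma funpow_mem: "\<lbrakk>f \<in> W \<rightarrow> W; x \<in> W\<rbrakk> \<Longrightarrow> (f ^^ j) x \<in> W"
  by (induction j) auto

lemma continuous_on_funpow: "\<lbrakk>continuous_on W f; f \<in> W \<rightarrow> W\<rbrakk> \<Longrightarrow> continuous_on W (f ^^ j)"
proof (induction j)
  case (Suc j)
  have "(f ^^ j) ` W \<subseteq> W" using funpow_mem[OF Suc.prems(2)] by auto
  then have "continuous_on W (f \<circ> f ^^ j)"
    using Suc by (intro continuous_on_compose) (auto intro: continuous_on_subset)
  then show ?case by simp
qed (simp add: continuous_on_id)

text \<open>A generator \<open>z\<close> of the local homology at \<open>c\<close> is homologous to a sum of chains \<open>\<zeta> j\<close> carried by the
  disjoint translates of \<open>P\<close>. The straight-line homotopy from \<open>f ^^ j\<close> to the identity shows that \<open>f ^^ j\<close>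
  takes \<open>\<zeta> 0\<close> to \<open>\<zeta> j\<close> up to homology, so all \<open>p\<close> pieces have the same image degree under the
  invariant map \<open>F\<close>. But \<open>F\<close> is itself close to the identity and has degree 1.\<close>

lemma periodic_map_degree:
  fixes p :: nat
  assumes W: "openin (top_of_set (Rn n)) W"
    and f: "continuous_on W f" "f \<in> W \<rightarrow> W"
    and period: "\<And>x. x \<in> W \<Longrightarrow> (f ^^ p) x = x"
    and p: "p > 0"
    and F: "continuous_on W F" "F \<in> W \<rightarrow> Rn n"
    and inv: "\<And>x. x \<in> W \<Longrightarrow> F (f x) = F x"
    and c: "c \<in> Rn n" and r: "0 < r" "r < R" and ball: "{y \<in> Rn n. dist1 n c y < R} \<subseteq> W"
    and move_f: "\<And>x j. x \<in> W \<Longrightarrow> dist1 n x ((f ^^ j) x) \<le> r / 4"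
    and move_F: "\<And>x. x \<in> W \<Longrightarrow> dist1 n x (F x) \<le> r / 2"
    and P: "openin (top_of_set W) P" "disjoint_family_on (\<lambda>j. (f ^^ j) ` P) {..<p}"
      "{x \<in> W. F x = c} \<subseteq> (\<Union>j<p. (f ^^ j) ` P)"
  shows "p = 1"
proof -
  let ?E = "top_of_set (Rn n)" and ?B = "{y \<in> Rn n. dist1 n c y < R}" and ?D = "{y. dist1 n c y \<le> r}"
  obtain \<theta> z where \<theta>_add: "\<And>a b. \<lbrakk>singular_relcycle n ?E (Rn n - {c}) a;
              singular_relcycle n ?E (Rn n - {c}) b\<rbrakk> \<Longrightarrow> \<theta> (a + b) = \<theta> a + (\<theta> b :: int)"
    and \<theta>_hom: "\<And>a b. homologous_rel n ?E (Rn n - {c}) a b \<Longrightarrow> \<theta> a = \<theta> b"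
    and z: "singular_relcycle n (top_of_set ?B) (?B - ?D) z" "\<theta> z = 1"
    using degree_functional[OF c r, of thesis] by blast
  define K where "K = {x \<in> W. F x = c}"
  define Q where "Q j = (f ^^ j) ` P" for j
  have WR: "W \<subseteq> Rn n" using W openin_imp_subset by blast
  have PW: "P \<subseteq> W" using P openin_imp_subset by blast
  have fW: "(f ^^ j) x \<in> W" if "x \<in> W" for j x using funpow_mem[OF f(2) that] .
  have cf: "continuous_on W (f ^^ j)" for j using continuous_on_funpow[OF f] .
  have Ff: "F ((f ^^ j) x) = F x" if "x \<in> W" for j x
    using that by (induction j) (auto simp: inv fW)
  have K_near: "dist1 n c x \<le> r / 2" if "x \<in> K" for x
    using move_F[of x] that by (simp add: K_def dist1_commute)
  have KB: "K \<inter> (?B - ?D) = {}" "K \<subseteq> ?B" "K \<subseteq> W" "K \<subseteq> Rn n"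
    using K_near r WR by (force simp: K_def)+
  \<comment> \<open>\<open>W\<close> is merely open; closedness in the whole space comes from
    \<open>K\<close> lying in the closed ball of radius \<open>r / 2\<close>, which is contained in
    \<open>W\<close>.\<close>
  have "closed K"
  proof -
    let ?C = "{y \<in> Rn n. dist1 n c y \<le> r / 2}"
    have "?C \<subseteq> W" using ball r by force
    then have "K = {x \<in> ?C. F x = c}" using K_near WR by (auto simp: K_def)
    moreover have "closedin (top_of_set ?C) {x \<in> ?C. F x = c}"
      by (intro continuous_closedin_preimage_constant continuous_on_subset[OF F(1) \<open>?C \<subseteq> W\<close>])
    moreover have "closed ?C" by (intro compact_imp_closed compact_dist1_cball)
    ultimately show ?thesis using closedin_closed_trans[of ?C] by simp
  qed
  then have clE: "closedin ?E K" using KB by (simp add: closed_subset)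
  have opWK: "openin (top_of_set W) (W - K)"
    using \<open>closed K\<close> by (metis Diff_eq open_Compl openin_open_Int)
  have Q0: "Q 0 = P" by (simp add: Q_def)
  have QW: "Q j \<subseteq> W" for j using PW fW by (auto simp: Q_def)
  have opQ: "openin (top_of_set W) (Q j)" if "j < p" for j
  proof -
    \<comment> \<open>The image under \<open>f ^^ j\<close> is open because it is the preimage under
      the inverse iterate \<open>f ^^ (p - j)\<close>.\<close>
    have "Q j = W \<inter> (f ^^ (p - j)) -` P"
    proof (intro equalityI subsetI)
      fix x assume "x \<in> W \<inter> (f ^^ (p - j)) -` P"
      moreover have "(f ^^ j) ((f ^^ (p - j)) x) = x" if "x \<in> W"
        using funpow_inverse_on[of W p f x "p - j"] period that \<open>j < p\<close> by simp
      ultimately show "x \<in> Q j" unfolding Q_def by (auto intro!: image_eqI[where x = "(f ^^ (p - j)) x"])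
    next
      fix x assume "x \<in> Q j"
      then obtain y where "y \<in> P" "x = (f ^^ j) y" by (auto simp: Q_def)
      then show "x \<in> W \<inter> (f ^^ (p - j)) -` P"
        using funpow_inverse_on[of W p f y j] period that PW fW by auto
    qed
    moreover have "(f ^^ (p - j)) \<in> W \<rightarrow> W" using fW by auto
    ultimately show ?thesis using continuous_openin_preimage[OF cf _ P(1)] by metis
  qed
  have opQE: "openin ?E (Q j)" if "j < p" for j using opQ[OF that] W openin_trans by blast
  have disj: "Q i \<inter> Q j = {}" if "i < p" "j < p" "i \<noteq> j" for i j
    using P(2) that by (auto simp: disjoint_family_on_def Q_def)
  have "singular_relcycle n (top_of_set W) (W - K) z"
    using KB ball by (intro singular_relcycle_mono[OF z(1)]) auto
  from singular_relcycle_split_disjoint[OF this, of "{..<p}" Q] obtain \<zeta> where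
    \<zeta>: "\<And>j. j < p \<Longrightarrow> singular_relcycle n (top_of_set (Q j)) (Q j - K) (\<zeta> j)"
    and z\<zeta>: "homologous_rel n (top_of_set W) (W - K) z (\<Sum>j<p. \<zeta> j)"
    using P opWK opQ unfolding K_def[symmetric] Q_def[symmetric] by auto
  \<comment> \<open>When only the part of \<open>K\<close> in \<open>Q j\<close> has to be avoided,
    the other pieces become negligible: they are carried by sets \<open>Q t\<close> disjoint from
    \<open>Q j\<close>. So \<open>\<zeta> j\<close> alone represents \<open>z\<close>.\<close>
  have piece: "homologous_rel n (top_of_set W) (W - K \<inter> Q j) z (\<zeta> j)" if "j < p" for j
  proof -
    have "homologous_rel n (top_of_set W) (W - K \<inter> Q j) z (\<Sum>t<p. \<zeta> t)"
      by (rule homologous_rel_mono[OF z\<zeta>]) auto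
    moreover have "homologous_rel n (top_of_set W) (W - K \<inter> Q j) (\<Sum>t<p. \<zeta> t) (\<zeta> j)"
      unfolding homologous_rel_def
    proof (rule singular_chain_imp_relboundary)
      have "(\<Sum>t<p. \<zeta> t) - \<zeta> j = (\<Sum>t\<in>{..<p} - {j}. \<zeta> t)"
        using sum.remove[of "{..<p}" j \<zeta>] that by simp
      moreover have "singular_chain n (top_of_set (W \<inter> (W - K \<inter> Q j))) (\<zeta> t)" if "t \<in> {..<p} - {j}" for t
      proof (rule singular_chain_top_of_set_mono)
        show "singular_chain n (top_of_set (Q t)) (\<zeta> t)" using \<zeta>[of t] that by (simp add: singular_relcycle)
        show "Q t \<subseteq> W \<inter> (W - K \<inter> Q j)" using disj[of t j] that \<open>j < p\<close> QW[of t] by auto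
      qed
      ultimately show "singular_chain n (subtopology (top_of_set W) (W - K \<inter> Q j)) ((\<Sum>t<p. \<zeta> t) - \<zeta> j)"
        using singular_chain_sum[of "{..<p} - {j}" n "top_of_set (W \<inter> (W - K \<inter> Q j))" \<zeta>]
        by (simp add: subtopology_subtopology)
    qed
    ultimately show ?thesis using homologous_rel_trans by blast
  qed
  have \<theta>\<zeta>: "\<theta> (chain_map n F (\<zeta> j)) = \<theta> (chain_map n F (\<zeta> 0))" if j: "j < p" for j
  proof -
    let ?Kj = "K \<inter> Q j"
    have fK: "(f ^^ j) \<in> W - K \<inter> Q 0 \<rightarrow> W - ?Kj"
    proof
      fix x assume x: "x \<in> W - K \<inter> Q 0"
      show "(f ^^ j) x \<in> W - ?Kj"
      proof (rule ccontr)
        assume "(f ^^ j) x \<notin> W - ?Kj"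
        then have *: "(f ^^ j) x \<in> K" "(f ^^ j) x \<in> Q j" using x fW by auto
        then have "x \<in> K" using x Ff by (auto simp: K_def)
        moreover obtain y where y: "y \<in> P" "(f ^^ j) x = (f ^^ j) y" using * by (auto simp: Q_def)
        have "x = y"
          using funpow_inverse_on[of W p f x j] funpow_inverse_on[of W p f y j] period x y PW j
          by auto
        ultimately show False using x y Q0 by auto
      qed
    qed
    have h1: "homologous_rel n ?E (Rn n - ?Kj) (chain_map n (f ^^ j) z) (chain_map n (f ^^ j) (\<zeta> 0))"
    proof -
      have "continuous_map (top_of_set W) (top_of_set W) (f ^^ j)" using cf fW by auto
      from homologous_rel_chain_map[OF piece[OF p] this fK]
      show ?thesis by (rule homologous_rel_mono) (use WR in auto)
    qed
    \<comment> \<open>For \<open>x\<close> outside the closed ball of radius \<open>r\<close>, the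
      segment from \<open>(f ^^ j) x\<close> to \<open>x\<close> stays farther than
      \<open>r - r / 4\<close> from \<open>c\<close>, whereas \<open>K\<close> lies within
      \<open>r / 2\<close>.\<close>
    have h2: "homologous_rel n ?E (Rn n - ?Kj) (chain_map n (f ^^ j) z) (chain_map n id z)"
    proof (rule homotopic_imp_homologous_rel_chain_maps[OF _ z(1)], rule homotopic_with_linear_Rn)
      show "continuous_on ?B (f ^^ j)" using cf ball continuous_on_subset by blast
      show "(f ^^ j) \<in> ?B \<rightarrow> Rn n" using fW ball WR by auto
      show "(\<lambda>i. (1 - t) * (f ^^ j) x i + t * id x i) \<in> Rn n - ?Kj"
        if x: "x \<in> ?B - ?D" and t: "0 \<le> t" "t \<le> 1" for x t
      proof -
        let ?y = "\<lambda>i. (1 - t) * (f ^^ j) x i + t * id x i"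
        have xW: "x \<in> W" using x ball by auto
        have "dist1 n x ?y \<le> r / 4"
          using dist1_segment_le[OF t, of n x "(f ^^ j) x"] move_f[OF xW, of j] by simp
        then have "dist1 n c ?y > r / 2"
          using dist1_triangle[of n c x ?y] dist1_commute[of n x ?y] x r by auto
        then have "?y \<notin> K" using K_near by force
        moreover have "x \<in> Rn n" "(f ^^ j) x \<in> Rn n" using fW[OF xW, of j] xW WR by auto
        then have "?y \<in> Rn n" by (simp add: Rn_def)
        ultimately show ?thesis by blast
      qed
    qed (auto simp: continuous_on_id)
    have h3: "homologous_rel n ?E (Rn n - ?Kj) z (\<zeta> j)"
      by (rule homologous_rel_mono[OF piece[OF j]]) (use WR in auto)
    have "chain_map n id z = z" using z(1) chain_map_ident by (auto simp: singular_relcycle)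
    then have hE: "homologous_rel n ?E (Rn n - ?Kj) (chain_map n (f ^^ j) (\<zeta> 0)) (\<zeta> j)"
      using homologous_rel_trans[OF h3] homologous_rel_trans[OF _ h1[THEN homologous_rel_sym[THEN iffD1]]] h2 by simp
    have rj: "singular_relcycle n (top_of_set (Q j)) (Q j - ?Kj) (\<zeta> j)"
      by (rule singular_relcycle_mono[OF \<zeta>[OF j]]) auto
    have r0: "singular_relcycle n (top_of_set (Q j)) (Q j - ?Kj) (chain_map n (f ^^ j) (\<zeta> 0))"
    proof (rule singular_relcycle_chain_map[OF \<zeta>[OF p]])
      show "continuous_map (top_of_set (Q 0)) (top_of_set (Q j)) (f ^^ j)"
        using continuous_on_subset[OF cf PW] by (auto simp: Q_def)
      show "(f ^^ j) \<in> Q 0 - K \<rightarrow> Q j - ?Kj" using fK QW[of 0] by (auto simp: Q_def)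
    qed
    \<comment> \<open>Removing the other open translates from the closed set \<open>K\<close> leaves
      exactly its part in \<open>Q j\<close>.\<close>
    have "closedin ?E ?Kj"
    proof -
      have "?Kj = K - (\<Union>t\<in>{..<p} - {j}. Q t)"
        using disj[OF _ j] P(3) j unfolding K_def[symmetric] Q_def[symmetric] by auto
      moreover have "openin ?E (\<Union>t\<in>{..<p} - {j}. Q t)" using opQE by auto
      ultimately show ?thesis using clE by (simp add: closedin_diff)
    qed
    \<comment> \<open>\<open>F\<close> is controlled on \<open>W\<close> only, so the homology in
      the whole space must be brought back into \<open>Q j\<close> before \<open>F\<close> can be
      applied to it.\<close>
    from homologous_rel_excision[OF opQE[OF j] this _ r0 rj hE]
    have "homologous_rel n (top_of_set (Q j)) (Q j - ?Kj) (chain_map n (f ^^ j) (\<zeta> 0)) (\<zeta> j)" by simp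
    moreover have "continuous_map (top_of_set (Q j)) ?E F"
      using continuous_on_subset[OF F(1) QW] F(2) QW[of j] by auto
    moreover have "F \<in> Q j - ?Kj \<rightarrow> Rn n - {c}" using F(2) QW[of j] by (auto simp: K_def)
    ultimately have "homologous_rel n ?E (Rn n - {c}) (chain_map n F (chain_map n (f ^^ j) (\<zeta> 0))) (chain_map n F (\<zeta> j))"
      by (rule homologous_rel_chain_map)
    moreover have "chain_map n F (chain_map n (f ^^ j) (\<zeta> 0)) = chain_map n (F \<circ> f ^^ j) (\<zeta> 0)"
      by (simp add: chain_map_compose)
    moreover have "chain_map n (F \<circ> f ^^ j) (\<zeta> 0) = chain_map n F (\<zeta> 0)"
      using \<zeta>[OF p] Ff QW[of 0]
      by (intro chain_map_eq[of n "top_of_set (Q 0)"]) (auto simp: singular_relcycle)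
    ultimately have "homologous_rel n ?E (Rn n - {c}) (chain_map n F (\<zeta> 0)) (chain_map n F (\<zeta> j))"
      by (simp only:)
    from \<theta>_hom[OF this] show ?thesis ..
  qed
  have F\<zeta>: "singular_relcycle n ?E (Rn n - {c}) (chain_map n F (\<zeta> j))" if "j < p" for j
  proof (rule singular_relcycle_chain_map[OF \<zeta>[OF that]])
    show "continuous_map (top_of_set (Q j)) ?E F"
      using continuous_on_subset[OF F(1) QW] F(2) QW[of j] by auto
    show "F \<in> Q j - K \<rightarrow> Rn n - {c}" using F(2) QW[of j] by (auto simp: K_def)
  qed
  have \<theta>_sum: "\<theta> (\<Sum>j\<in>J. chain_map n F (\<zeta> j)) = (\<Sum>j\<in>J. \<theta> (chain_map n F (\<zeta> j)))"
    if "finite J" "J \<subseteq> {..<p}" for J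
    using that
  proof (induction J rule: finite_induct)
    case empty
    show ?case using \<theta>_add[of 0 0] by simp
  next
    case (insert k J)
    have "singular_relcycle n ?E (Rn n - {c}) (\<Sum>j\<in>J. chain_map n F (\<zeta> j))"
      using insert.prems F\<zeta> by (intro singular_relcycle_sum) auto
    then show ?case using insert F\<zeta>[of k] \<theta>_add by simp
  qed
  have "homologous_rel n ?E (Rn n - {c}) (chain_map n F z) (chain_map n F (\<Sum>j<p. \<zeta> j))"
  proof (rule homologous_rel_chain_map[OF z\<zeta>])
    show "continuous_map (top_of_set W) ?E F" using F by auto
    show "F \<in> W - K \<rightarrow> Rn n - {c}" using F by (auto simp: K_def)
  qed
  then have "\<theta> (chain_map n F z) = \<theta> (chain_map n F (\<Sum>j<p. \<zeta> j))" by (rule \<theta>_hom)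
  also have "\<dots> = \<theta> (\<Sum>j<p. chain_map n F (\<zeta> j))"
    unfolding chain_map_sum[OF finite_lessThan] o_def ..
  also have "\<dots> = (\<Sum>j<p. \<theta> (chain_map n F (\<zeta> j)))" by (rule \<theta>_sum) auto
  also have "\<dots> = (\<Sum>j<p. \<theta> (chain_map n F (\<zeta> 0)))" by (intro sum.cong refl, rule \<theta>\<zeta>) simp
  finally have 1: "\<theta> (chain_map n F z) = int p * \<theta> (chain_map n F (\<zeta> 0))" by simp
  have "homologous_rel n ?E (Rn n - {c}) (chain_map n F z) (chain_map n id z)"
  proof (rule homotopic_imp_homologous_rel_chain_maps[OF _ z(1)], rule homotopic_with_linear_Rn)
    show "continuous_on ?B F" using F(1) ball continuous_on_subset by blast
    show "F \<in> ?B \<rightarrow> Rn n" using F(2) ball by auto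
    show "(\<lambda>i. (1 - t) * F x i + t * id x i) \<in> Rn n - {c}"
      if x: "x \<in> ?B - ?D" and t: "0 \<le> t" "t \<le> 1" for x t
    proof -
      let ?y = "\<lambda>i. (1 - t) * F x i + t * id x i"
      have xW: "x \<in> W" using x ball by auto
      have "dist1 n x ?y \<le> r / 2"
        using dist1_segment_le[OF t, of n x "F x"] move_F[OF xW] by simp
      then have "dist1 n c ?y > 0"
        using dist1_triangle[of n c x ?y] dist1_commute[of n x ?y] x r by auto
      then have "?y \<noteq> c" by auto
      moreover have "x \<in> Rn n" "F x \<in> Rn n" using F(2) xW WR by auto
      then have "?y \<in> Rn n" by (simp add: Rn_def)
      ultimately show ?thesis by blast
    qed
  qed (auto simp: continuous_on_id)
  then have "\<theta> (chain_map n F z) = \<theta> (chain_map n id z)" by (rule \<theta>_hom)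
  also have "chain_map n id z = z" using z(1) chain_map_ident by (auto simp: singular_relcycle)
  finally have "\<theta> (chain_map n F z) = 1" using z(2) by simp
  then have "int p dvd 1" using 1 by (metis dvd_triv_left)
  then show ?thesis by simp
qed

section \<open>Perturbing a map off a point on a sphere\<close>

lemma continuous_on_dist1_Lipschitz:
  fixes q :: "(nat \<Rightarrow> real) \<Rightarrow> real"
  assumes "\<And>x y. \<lbrakk>x \<in> S; y \<in> S\<rbrakk> \<Longrightarrow> \<bar>q x - q y\<bar> \<le> L * dist1 n x y"
  shows "continuous_on S q"
  unfolding continuous_on_def
proof
  fix x assume x: "x \<in> S"
  have "continuous_on S (\<lambda>y. L * dist1 n x y)" by (intro continuous_intros)
  then have lim: "((\<lambda>y. L * dist1 n x y) \<longlongrightarrow> 0) (at x within S)"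
    using x unfolding continuous_on_def by fastforce
  have "\<forall>\<^sub>F y in at x within S. norm (q y - q x) \<le> L * dist1 n x y"
    unfolding eventually_at_filter using assms[OF x]
    by (intro always_eventually) (simp add: abs_minus_commute)
  from Lim_null_comparison[OF this lim] show "(q \<longlongrightarrow> q x) (at x within S)"
    by (simp add: LIM_zero_iff)
qed

text \<open>The approximation is the infimal convolution of \<open>g\<close> with a steep multiple of \<open>dist1\<close>.\<close>

lemma Lipschitz_approximation:
  fixes g :: "(nat \<Rightarrow> real) \<Rightarrow> real"
  assumes C: "compact C" "C \<subseteq> Rn n" and g: "continuous_on C g" and "\<epsilon> > 0"
  obtains q L where "L \<ge> 0" "\<And>x y. \<bar>q x - q y\<bar> \<le> L * dist1 n x y" "\<And>x. x \<in> C \<Longrightarrow> \<bar>q x - g x\<bar> \<le> \<epsilon>"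
proof (cases "C = {}")
  case True
  then show ?thesis using that[of 0 "\<lambda>_. 0"] by auto
next
  case False
  obtain M where M: "\<And>x. x \<in> C \<Longrightarrow> \<bar>g x\<bar> \<le> M"
    using compact_imp_bounded[OF compact_continuous_image[OF g C(1)]] by (auto simp: bounded_iff)
  then have M0: "M \<ge> 0" using False by fastforce
  obtain \<delta> where \<delta>: "\<delta> > 0" "\<And>x y. \<lbrakk>x \<in> C; y \<in> C; dist1 n x y < \<delta>\<rbrakk> \<Longrightarrow> \<bar>g x - g y\<bar> \<le> \<epsilon>"
  proof -
    \<comment> \<open>Uniform continuity with respect to \<open>dist1\<close>: the pairs whose
      values differ by at least \<open>\<epsilon>\<close> form a compact set off the diagonal, on
      which the distance has a positive minimum.\<close>
    define D where "D = {z \<in> C \<times> C. \<epsilon> \<le> \<bar>g (fst z) - g (snd z)\<bar>}"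
    have cont: "continuous_on (C \<times> C) (\<lambda>z. \<bar>g (fst z) - g (snd z)\<bar>)"
      by (intro continuous_intros continuous_on_compose2[OF g]) auto
    have "closedin (top_of_set (C \<times> C)) ((C \<times> C) \<inter> (\<lambda>z. \<bar>g (fst z) - g (snd z)\<bar>) -` {\<epsilon>..})"
      by (rule continuous_closedin_preimage[OF cont]) auto
    moreover have "(C \<times> C) \<inter> (\<lambda>z. \<bar>g (fst z) - g (snd z)\<bar>) -` {\<epsilon>..} = D" by (auto simp: D_def)
    ultimately have "compact D" using compact_Times[OF C(1) C(1)] closedin_compact by metis
    show ?thesis
    proof (cases "D = {}")
      case True
      then show ?thesis using that[of 1] by (force simp: D_def)
    next
      case False
      have "continuous_on D (\<lambda>z. dist1 n (fst z) (snd z))"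
        by (intro continuous_on_dist1 continuous_on_fst continuous_on_snd continuous_on_id)
      from continuous_attains_inf[OF \<open>compact D\<close> False this]
      obtain z where z: "z \<in> D" "\<And>w. w \<in> D \<Longrightarrow> dist1 n (fst z) (snd z) \<le> dist1 n (fst w) (snd w)" by blast
      have "fst z \<noteq> snd z" using z(1) \<open>\<epsilon> > 0\<close> by (auto simp: D_def)
      then have "dist1 n (fst z) (snd z) \<noteq> 0"
        using z(1) C(2) by (subst dist1_eq_0_iff) (auto simp: D_def)
      then have "dist1 n (fst z) (snd z) > 0" using dist1_nonneg[of n "fst z" "snd z"] by linarith
      moreover have "\<bar>g x - g y\<bar> \<le> \<epsilon>"
        if "x \<in> C" "y \<in> C" "dist1 n x y < dist1 n (fst z) (snd z)" for x y
        using z(2)[of "(x, y)"] that by (force simp: D_def)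
      ultimately show ?thesis using that by blast
    qed
  qed
  \<comment> \<open>With this slope, points at distance at least \<open>\<delta>\<close> pay a
    penalty of at least \<open>2 * M\<close>, so they cannot bring the infimum below
    \<open>g x\<close>.\<close>
  define L where "L = 2 * M / \<delta>"
  have L: "L \<ge> 0" using M0 \<delta> by (simp add: L_def)
  define q where "q x = (INF y\<in>C. g y + L * dist1 n x y)" for x
  have bdd: "bdd_below ((\<lambda>y. g y + L * dist1 n x y) ` C)" for x
  proof (rule bdd_belowI2)
    fix y assume "y \<in> C"
    then show "- M \<le> g y + L * dist1 n x y" using M[of y] L mult_nonneg_nonneg[OF L dist1_nonneg[of n x y]] by linarith
  qed
  have le: "q x - q y \<le> L * dist1 n x y" for x y
  proof -
    have "q x - L * dist1 n x y \<le> g w + L * dist1 n y w" if "w \<in> C" for w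
    proof -
      have "q x \<le> g w + L * dist1 n x w" unfolding q_def by (rule cINF_lower[OF bdd that])
      also have "L * dist1 n x w \<le> L * (dist1 n x y + dist1 n y w)"
        using dist1_triangle L by (intro mult_left_mono) auto
      finally show ?thesis by (simp add: algebra_simps)
    qed
    then have "q x - L * dist1 n x y \<le> q y" unfolding q_def[of y] using False by (intro cINF_greatest) auto
    then show ?thesis by linarith
  qed
  have Lip: "\<bar>q x - q y\<bar> \<le> L * dist1 n x y" for x y
    using le[of x y] le[of y x] by (simp add: abs_le_iff dist1_commute)
  have "\<bar>q x - g x\<bar> \<le> \<epsilon>" if x: "x \<in> C" for x
  proof -
    have "q x \<le> g x + L * dist1 n x x" unfolding q_def by (rule cINF_lower[OF bdd x])
    moreover have "g x - \<epsilon> \<le> q x"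
      unfolding q_def
    proof (rule cINF_greatest[OF False])
      fix y assume y: "y \<in> C"
      show "g x - \<epsilon> \<le> g y + L * dist1 n x y"
      proof (cases "dist1 n x y < \<delta>")
        case True
        then show ?thesis using \<delta>(2)[OF x y] mult_nonneg_nonneg[OF L dist1_nonneg[of n x y]] by linarith
      next
        case False
        then have "L * \<delta> \<le> L * dist1 n x y" using L by (intro mult_left_mono) auto
        moreover have "L * \<delta> = 2 * M" using \<delta> by (simp add: L_def)
        ultimately show ?thesis using M[OF x] M[OF y] \<open>\<epsilon> > 0\<close> by linarith
      qed
    qed
    ultimately show ?thesis using \<open>\<epsilon> > 0\<close> by (simp add: abs_le_iff)
  qed
  then show ?thesis using that[of L q] L Lip by blast
qed

text \<open>Pigeonhole principle: if \<open>q\<close> hit all of the \<open>M ^ n\<close> grid points near \<open>c\<close> on the sphere, then the points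
  hit would have to differ in the label formed by the sign of the coordinate with index 0 and the
  roughly \<open>A * M\<close> possible positions of each of the \<open>n - 1\<close> other coordinates.\<close>

lemma Lipschitz_sphere_avoids:
  fixes q :: "(nat \<Rightarrow> real) \<Rightarrow> nat \<Rightarrow> real"
  assumes n: "n > 0" and L: "L \<ge> 0" "\<And>i x y. i < n \<Longrightarrow> \<bar>q x i - q y i\<bar> \<le> L * dist1 n x y"
    and r: "r > 0" and \<epsilon>: "\<epsilon> > 0"
  obtains v where "\<And>i. i < n \<Longrightarrow> \<bar>v i\<bar> \<le> \<epsilon>" "\<And>y. dist1 n x0 y = r \<Longrightarrow> \<exists>i<n. q y i \<noteq> c i + v i"
proof (rule ccontr)
  assume contr: "\<not> thesis"
  note obtained = that
  have hit: "\<exists>y. dist1 n x0 y = r \<and> (\<forall>i<n. q y i = c i + v i)" if "\<And>i. i < n \<Longrightarrow> \<bar>v i\<bar> \<le> \<epsilon>" for v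
    using contr obtained that by blast
  \<comment> \<open>The bound makes the grid spacing \<open>\<epsilon> / M\<close> larger than
    \<open>4 * n * L * r / (A * M)\<close>, which bounds the variation of a coordinate of
    \<open>q\<close> among points of the sphere with the same label.\<close>
  obtain A :: nat where A: "real A > 4 * n * L * r / \<epsilon>" "A \<ge> 1"
  proof -
    obtain A :: nat where "real A > max 1 (4 * n * L * r / \<epsilon>)" using reals_Archimedean2 by blast
    then show ?thesis using that[of A] by auto
  qed
  \<comment> \<open>There are \<open>2 * (m + 1) ^ (n - 1)\<close> labels, hence at most
    \<open>2 * (2 * A * M) ^ (n - 1)\<close>, and this choice makes \<open>M ^ n\<close> larger. The
    exponents differ by one because the sphere has one dimension less than the space.\<close>
  define M where "M = 2 * (2 * A) ^ (n - 1) + 1"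
  define m where "m = A * M"
  have M: "M \<ge> 1" and m: "m \<ge> 1" using A by (auto simp: M_def m_def)
  define G where "G = PiE {..<n} (\<lambda>_::nat. {..<M})"
  define v where "v k i = \<epsilon> * real (k i) / real M" for k :: "nat \<Rightarrow> nat" and i
  have "\<exists>y. dist1 n x0 y = r \<and> (\<forall>i<n. q y i = c i + v k i)" if "k \<in> G" for k
  proof (rule hit)
    fix i assume "i < n"
    then have "k i < M" using that by (auto simp: G_def)
    then have "\<epsilon> * real (k i) \<le> \<epsilon> * real M" using \<epsilon> by (intro mult_left_mono) auto
    then show "\<bar>v k i\<bar> \<le> \<epsilon>" using \<epsilon> M by (simp add: v_def divide_le_eq)
  qed
  then obtain y where y: "\<And>k. k \<in> G \<Longrightarrow> dist1 n x0 (y k) = r" "\<And>k i. \<lbrakk>k \<in> G; i < n\<rbrakk> \<Longrightarrow> q (y k) i = c i + v k i"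
    by metis
  \<comment> \<open>This numbers the slots of width \<open>2 * r / m\<close> that divide the
    interval from \<open>x0 i - r\<close> to \<open>x0 i + r\<close>. The right endpoint gets the
    number \<open>m\<close>, so there are \<open>m + 1\<close> values.\<close>
  define h where "h z i = nat \<lfloor>(z i - x0 i + r) * m / (2 * r)\<rfloor>" for z :: "nat \<Rightarrow> real" and i
  define lab where "lab z = (z 0 \<ge> x0 0, restrict (h z) {1..<n})" for z :: "nat \<Rightarrow> real"
  have h: "0 \<le> (z i - x0 i + r) * m / (2 * r)" "h z i \<le> m" if "dist1 n x0 z = r" "i < n" for z i
  proof -
    have "\<bar>x0 i - z i\<bar> \<le> r" using dist1_coord_le[of i n x0 z] that by simp
    then have 1: "0 \<le> z i - x0 i + r" "z i - x0 i + r \<le> 2 * r" by (simp_all add: abs_le_iff)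
    then show "0 \<le> (z i - x0 i + r) * m / (2 * r)" using r by simp
    have "(z i - x0 i + r) * m / (2 * r) \<le> m"
      using mult_right_mono[OF 1(2), of m] r by (simp add: divide_le_eq mult_ac)
    then have "\<lfloor>(z i - x0 i + r) * m / (2 * r)\<rfloor> \<le> int m" by (simp add: floor_le_iff)
    then show "h z i \<le> m" by (simp add: h_def)
  qed
  define \<eta> where "\<eta> = 2 * r / m"
  have \<eta>: "\<eta> > 0" using r m by (simp add: \<eta>_def)
  have close: "dist1 n z w \<le> 2 * n * \<eta>"
    if z: "dist1 n x0 z = r" and w: "dist1 n x0 w = r" and eq: "lab z = lab w" for z w
  proof -
    have c1: "\<bar>z i - w i\<bar> \<le> \<eta>" if i: "i \<in> {1..<n}" for i
    proof -
      have i': "i < n" using i by simp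
      have "h z i = h w i" using eq i unfolding lab_def by (metis Pair_inject restrict_apply')
      moreover have "0 \<le> \<lfloor>(z i - x0 i + r) * m / (2 * r)\<rfloor>" "0 \<le> \<lfloor>(w i - x0 i + r) * m / (2 * r)\<rfloor>"
        using h(1)[OF z i'] h(1)[OF w i'] by (simp_all only: zero_le_floor)
      ultimately have "\<lfloor>(z i - x0 i + r) * m / (2 * r)\<rfloor> = \<lfloor>(w i - x0 i + r) * m / (2 * r)\<rfloor>"
        by (simp add: h_def nat_eq_iff2 eq_nat_nat_iff)
      then have "\<bar>(z i - x0 i + r) * m / (2 * r) - (w i - x0 i + r) * m / (2 * r)\<bar> < 1"
        by linarith
      moreover have "(z i - x0 i + r) * m / (2 * r) - (w i - x0 i + r) * m / (2 * r) = (z i - w i) / \<eta>"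
        using r m by (simp add: \<eta>_def field_simps)
      ultimately show ?thesis using \<eta> by (simp add: abs_divide divide_less_eq)
    qed
    have split: "(\<Sum>i<n. g i) = g 0 + (\<Sum>i\<in>{1..<n}. g i)" for g :: "nat \<Rightarrow> real"
      using n by (metis atLeast0LessThan One_nat_def sum.atLeast_Suc_lessThan)
    have s1: "(\<Sum>i\<in>{1..<n}. \<bar>z i - w i\<bar>) \<le> (n - 1) * \<eta>"
      using sum_bounded_above[of "{1..<n}" "\<lambda>i. \<bar>z i - w i\<bar>" \<eta>] c1 by simp
    \<comment> \<open>On a sphere of the sum norm the absolute value of \<open>z 0 - x0 0\<close> is
      \<open>r\<close> minus the other terms, and the label fixes the sign.\<close>
    have "\<bar>z 0 - w 0\<bar> \<le> (\<Sum>i\<in>{1..<n}. \<bar>z i - w i\<bar>)"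
    proof -
      have "\<bar>x0 0 - z 0\<bar> + (\<Sum>i\<in>{1..<n}. \<bar>x0 i - z i\<bar>) = \<bar>x0 0 - w 0\<bar> + (\<Sum>i\<in>{1..<n}. \<bar>x0 i - w i\<bar>)"
        using z w unfolding dist1_def split by simp
      moreover have "(\<Sum>i\<in>{1..<n}. \<bar>x0 i - z i\<bar>) \<le> (\<Sum>i\<in>{1..<n}. \<bar>x0 i - w i\<bar>) + (\<Sum>i\<in>{1..<n}. \<bar>z i - w i\<bar>)"
        unfolding sum.distrib[symmetric] by (rule sum_mono) linarith
      moreover have "(\<Sum>i\<in>{1..<n}. \<bar>x0 i - w i\<bar>) \<le> (\<Sum>i\<in>{1..<n}. \<bar>x0 i - z i\<bar>) + (\<Sum>i\<in>{1..<n}. \<bar>z i - w i\<bar>)"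
        unfolding sum.distrib[symmetric] by (rule sum_mono) linarith
      moreover have "z 0 \<ge> x0 0 \<longleftrightarrow> w 0 \<ge> x0 0" using eq by (simp add: lab_def)
      ultimately show ?thesis by linarith
    qed
    then have "dist1 n z w \<le> 2 * ((n - 1) * \<eta>)" unfolding dist1_def split using s1 by linarith
    also have "\<dots> \<le> 2 * (n * \<eta>)" using \<eta> by (intro mult_left_mono mult_right_mono) auto
    finally show ?thesis by simp
  qed
  have inj: "inj_on (lab \<circ> y) G"
  proof (rule inj_onI)
    fix k l assume k: "k \<in> G" and l: "l \<in> G" and "(lab \<circ> y) k = (lab \<circ> y) l"
    then have d: "dist1 n (y k) (y l) \<le> 2 * n * \<eta>" using close y by auto
    have "k i = l i" if i: "i < n" for i
    proof (rule ccontr)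
      assume "k i \<noteq> l i"
      then have "\<bar>real (k i) - real (l i)\<bar> \<ge> 1" by linarith
      then have "\<epsilon> / M * 1 \<le> \<epsilon> / M * \<bar>real (k i) - real (l i)\<bar>" using \<epsilon> by (intro mult_left_mono) auto
      also have "\<dots> = \<bar>\<epsilon> / M * (real (k i) - real (l i))\<bar>" using \<epsilon> by (simp only: abs_mult) simp
      also have "\<epsilon> / M * (real (k i) - real (l i)) = q (y k) i - q (y l) i"
        using y(2) k l i by (simp add: v_def right_diff_distrib)
      also have "\<bar>q (y k) i - q (y l) i\<bar> \<le> L * dist1 n (y k) (y l)" using L(2)[OF i] .
      also have "\<dots> \<le> L * (2 * n * \<eta>)" using L(1) d by (intro mult_left_mono)
      also have "\<dots> = 4 * n * L * r / (A * M)" by (simp add: \<eta>_def m_def)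
      finally have "\<epsilon> * A \<le> 4 * n * L * r" using M A by (simp add: field_simps)
      moreover have "4 * n * L * r < \<epsilon> * A" using A(1) \<epsilon> by (simp add: divide_less_eq mult.commute)
      ultimately show False by linarith
    qed
    then show "k = l" using k l unfolding G_def by (metis PiE_ext lessThan_iff)
  qed
  have "(lab \<circ> y) ` G \<subseteq> UNIV \<times> PiE {1..<n} (\<lambda>_. {..m})"
    using h(2)[OF y(1)] by (auto simp: lab_def)
  then have "card G \<le> card ((UNIV :: bool set) \<times> PiE {1..<n} (\<lambda>_. {..m}))"
    by (rule card_inj_on_le[OF inj]) (auto intro: finite_PiE)
  then have "M ^ n \<le> 2 * (m + 1) ^ (n - 1)"
    by (simp add: G_def card_PiE card_cartesian_product card_UNIV_bool)
  also have "\<dots> \<le> 2 * (2 * A * M) ^ (n - 1)"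
    using m by (intro mult_left_mono power_mono) (auto simp: m_def)
  also have "\<dots> = (2 * (2 * A) ^ (n - 1)) * M ^ (n - 1)" by (simp add: power_mult_distrib)
  also have "\<dots> < M * M ^ (n - 1)" using M by (intro mult_strict_right_mono) (auto simp: M_def)
  also have "\<dots> = M ^ n" using n by (simp add: power_eq_if)
  finally show False by simp
qed

section \<open>Periodic maps of open sets in Euclidean space\<close>

lemma funpow_mod_on:
  assumes "f \<in> W \<rightarrow> W" "\<And>x. x \<in> W \<Longrightarrow> (f ^^ p) x = x" "x \<in> W"
  shows "(f ^^ m) x = (f ^^ (m mod p)) x"
proof -
  have "(f ^^ (p * k)) y = y" if "y \<in> W" for k y
    using that assms(2) by (induction k) (auto simp: funpow_add)
  then have "(f ^^ (m mod p + p * (m div p))) x = (f ^^ (m mod p)) x"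
    using assms(3) by (simp only: funpow_add o_apply)
  then show ?thesis by simp
qed

locale periodic_map =
  fixes n p :: nat and W :: "(nat \<Rightarrow> real) set" and f
  assumes open_W: "openin (top_of_set (Rn n)) W"
    and cont_f: "continuous_on W f" and f_W: "f \<in> W \<rightarrow> W"
    and period: "\<And>x. x \<in> W \<Longrightarrow> (f ^^ p) x = x"
    and p_pos: "p > 0"
begin

lemma W_Rn: "W \<subseteq> Rn n"
  using open_W openin_imp_subset by blast

lemma funpow_W: "x \<in> W \<Longrightarrow> (f ^^ j) x \<in> W"
  using funpow_mem[OF f_W] .

lemma cont_funpow: "continuous_on W (f ^^ j)"
  using continuous_on_funpow[OF cont_f f_W] .

lemma funpow_inverse: "\<lbrakk>x \<in> W; j \<le> p\<rbrakk> \<Longrightarrow> (f ^^ (p - j)) ((f ^^ j) x) = x"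
  using funpow_inverse_on[OF period] .

text \<open>The closed ball of radius \<open>2 * r\<close> is disjoint from its translates. The
  sphere of radius \<open>r\<close> is the one to be cleared of the level set; the shell out to
  \<open>2 * r\<close> leaves room for a cutoff function.\<close>

definition free_ball :: "(nat \<Rightarrow> real) \<Rightarrow> real \<Rightarrow> bool" where
  "free_ball x r \<longleftrightarrow> r > 0 \<and> x \<in> W \<and> {y \<in> Rn n. dist1 n x y \<le> 2 * r} \<subseteq> W \<and>
     (\<forall>j. 0 < j \<and> j < p \<longrightarrow> (\<forall>y \<in> Rn n. dist1 n x y \<le> 2 * r \<longrightarrow> dist1 n x ((f ^^ j) y) > 2 * r))"

definition inv_map :: "((nat \<Rightarrow> real) \<Rightarrow> nat \<Rightarrow> real) \<Rightarrow> bool" where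
  "inv_map F \<longleftrightarrow> continuous_on W F \<and> F \<in> W \<rightarrow> Rn n \<and> (\<forall>x \<in> W. F (f x) = F x)"

lemma inv_map_funpow: "\<lbrakk>inv_map F; x \<in> W\<rbrakk> \<Longrightarrow> F ((f ^^ j) x) = F x"
  by (induction j) (auto simp: inv_map_def funpow_W)

lemma free_ball_exists:
  assumes x: "x \<in> W" and free: "\<And>j. \<lbrakk>0 < j; j < p\<rbrakk> \<Longrightarrow> (f ^^ j) x \<noteq> x"
  obtains r where "free_ball x r"
proof -
  have "\<exists>\<delta>>0. \<forall>y \<in> Rn n. dist1 n x y < \<delta> \<longrightarrow> y \<in> W \<and> (0 < j \<and> j < p \<longrightarrow> dist1 n x ((f ^^ j) y) > \<delta>)" for j
  proof (cases "0 < j \<and> j < p")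
    case False
    obtain r where "r > 0" "{y \<in> Rn n. dist1 n x y < r} \<subseteq> W" by (rule dist1_ball_subset_open[OF open_W x])
    then show ?thesis using False by (intro exI[of _ r]) auto
  next
    case True
    define d where "d = dist1 n x ((f ^^ j) x)"
    have "d \<noteq> 0" using dist1_eq_0_iff[of x n "(f ^^ j) x"] free[of j] True x funpow_W W_Rn by (auto simp: d_def)
    then have d: "d > 0" using dist1_nonneg[of n x "(f ^^ j) x"] unfolding d_def by linarith
    let ?V = "W \<inter> (\<lambda>y. dist1 n x ((f ^^ j) y)) -` {d / 2<..}"
    have "continuous_on W (\<lambda>y. dist1 n x ((f ^^ j) y))"
      by (intro continuous_on_dist1 continuous_on_const cont_funpow)
    then have "openin (top_of_set W) ?V" by (intro continuous_openin_preimage_gen) auto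
    then have "openin (top_of_set (Rn n)) ?V" using open_W openin_trans by blast
    moreover have "x \<in> ?V" using x d by (simp add: d_def)
    ultimately obtain r where r: "r > 0" "{y \<in> Rn n. dist1 n x y < r} \<subseteq> ?V"
      by (rule dist1_ball_subset_open)
    have "y \<in> W \<and> dist1 n x ((f ^^ j) y) > min r (d / 2)" if "y \<in> Rn n" "dist1 n x y < min r (d / 2)" for y
    proof -
      have "y \<in> ?V" using that r(2) by auto
      then show ?thesis by auto
    qed
    then show ?thesis using r(1) d by (intro exI[of _ "min r (d / 2)"]) auto
  qed
  then obtain \<delta> where \<delta>: "\<And>j. \<delta> j > (0::real)"
    "\<And>j y. \<lbrakk>y \<in> Rn n; dist1 n x y < \<delta> j\<rbrakk> \<Longrightarrow> y \<in> W \<and> (0 < j \<and> j < p \<longrightarrow> dist1 n x ((f ^^ j) y) > \<delta> j)"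
    by metis
  \<comment> \<open>The factor 3 leaves room for the closed ball of radius \<open>2 * r\<close>. The
    index 0 makes the set nonempty and supplies the inclusion of the ball in
    \<open>W\<close>.\<close>
  define r where "r = Min (\<delta> ` {..<p}) / 3"
  have r: "r > 0" "\<And>j. j < p \<Longrightarrow> 3 * r \<le> \<delta> j"
  proof -
    have "{..<p} \<noteq> {}" using p_pos by auto
    then show "r > 0" using \<delta>(1) by (simp add: r_def)
  qed (simp add: r_def)
  have "free_ball x r" unfolding free_ball_def
  proof (intro conjI allI ballI impI subsetI)
    fix y assume "y \<in> {y \<in> Rn n. dist1 n x y \<le> 2 * r}"
    then show "y \<in> W" using \<delta>(2)[of y 0] r p_pos by force
  next
    fix j y assume "0 < j \<and> j < p" "y \<in> Rn n" "dist1 n x y \<le> 2 * r"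
    then show "2 * r < dist1 n x ((f ^^ j) y)" using \<delta>(2)[of y j] r(1) r(2)[of j] by force
  qed (use r x in auto)
  then show ?thesis by (rule that)
qed

text \<open>The correction \<open>u\<close> is supported in a ball that is disjoint from its translates. Summing it over
  the orbit keeps \<open>F\<close> invariant and leaves only one summand on the sphere.\<close>

lemma perturb_off_sphere:
  assumes n: "n > 0" and F: "inv_map F" and x: "free_ball x r" and \<epsilon>: "\<epsilon> > 0"
  obtains F' where "inv_map F'" "\<And>y. y \<in> W \<Longrightarrow> dist1 n (F y) (F' y) < \<epsilon>"
    "\<And>y. \<lbrakk>y \<in> Rn n; dist1 n x y = r\<rbrakk> \<Longrightarrow> F' y \<noteq> c"
proof -
  let ?C = "{y \<in> Rn n. dist1 n x y \<le> 2 * r}"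
  have r: "r > 0" and CW: "?C \<subseteq> W" and
    free: "\<And>j y. \<lbrakk>0 < j; j < p; y \<in> ?C\<rbrakk> \<Longrightarrow> dist1 n x ((f ^^ j) y) > 2 * r"
    using x by (auto simp: free_ball_def)
  \<comment> \<open>The change of \<open>F\<close> has \<open>n\<close> coordinates, each a sum of
    \<open>p\<close> terms of size at most \<open>\<epsilon>'\<close>; adding 1 in the denominator
    makes the resulting bound strict.\<close>
  define \<epsilon>' where "\<epsilon>' = \<epsilon> / (n * p + 1)"
  have \<epsilon>': "\<epsilon>' > 0" "n * p * \<epsilon>' < \<epsilon>"
  proof -
    have 1: "(0::real) < real n * real p + 1" using mult_nonneg_nonneg[of "real n" "real p"] by linarith
    then show "\<epsilon>' > 0" using \<epsilon> by (simp add: \<epsilon>'_def)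
    have "(n * p + 1) * \<epsilon>' = \<epsilon>" using 1 by (simp add: \<epsilon>'_def)
    then show "n * p * \<epsilon>' < \<epsilon>" using \<open>\<epsilon>' > 0\<close> by (simp add: algebra_simps)
  qed
  have cF: "continuous_on W (\<lambda>y. F y i)" for i
    by (rule continuous_on_product_then_coordinatewise) (use F in \<open>simp add: inv_map_def\<close>)
  define approx where "approx i q L \<longleftrightarrow> L \<ge> 0 \<and> (\<forall>y z. \<bar>q y - q z\<bar> \<le> L * dist1 n y z) \<and>
      (\<forall>y \<in> ?C. \<bar>q y - F y i\<bar> \<le> \<epsilon>' / 2)" for i q L
  have "\<exists>q L. approx i q L" for i
  proof -
    have pos: "\<epsilon>' / 2 > 0" and sub: "?C \<subseteq> Rn n" using \<epsilon>' by auto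
    obtain q L where "L \<ge> 0" "\<And>y z. \<bar>q y - q z\<bar> \<le> L * dist1 n y z" "\<And>y. y \<in> ?C \<Longrightarrow> \<bar>q y - F y i\<bar> \<le> \<epsilon>' / 2"
      by (rule Lipschitz_approximation[OF compact_dist1_cball sub continuous_on_subset[OF cF CW] pos]) (rule that)
    then show ?thesis unfolding approx_def by blast
  qed
  then obtain q0 L0 where approx: "\<And>i. approx i (q0 i) (L0 i)" by metis
  have q0: "L0 i \<ge> 0" "\<bar>q0 i y - q0 i z\<bar> \<le> L0 i * dist1 n y z" "y \<in> ?C \<Longrightarrow> \<bar>q0 i y - F y i\<bar> \<le> \<epsilon>' / 2" for i y z
    using approx[of i] by (simp_all add: approx_def)
  define L where "L = (\<Sum>i<n. L0 i)"
  have L: "L \<ge> 0" using q0 by (simp add: L_def sum_nonneg)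
  have q0_L: "\<bar>q0 i y - q0 i z\<bar> \<le> L * dist1 n y z" if "i < n" for i y z
  proof -
    have "L0 i \<le> L" unfolding L_def using that q0(1) by (intro member_le_sum) auto
    then show ?thesis using q0(2)[of i y z] mult_right_mono[of "L0 i" L "dist1 n y z"] by force
  qed
  have pos: "\<epsilon>' / 2 > 0" using \<epsilon>' by simp
  \<comment> \<open>The Lipschitz approximation \<open>q0\<close> of \<open>F\<close> misses a point
    \<open>c + v\<close> close to \<open>c\<close> on the sphere of radius \<open>r\<close>; hence
    \<open>q0 - v\<close> misses \<open>c\<close> there.\<close>
  obtain v where v: "\<And>i. i < n \<Longrightarrow> \<bar>v i\<bar> \<le> \<epsilon>' / 2"
     "\<And>y. dist1 n x y = r \<Longrightarrow> \<exists>i<n. q0 i y \<noteq> c i + v i"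
    by (rule Lipschitz_sphere_avoids[OF n L q0_L r pos, where ?x0.0 = x and c = c]) (assumption | rule that)+
  define \<beta> where "\<beta> y = max 0 (min 1 (2 - dist1 n x y / r))" for y
  define u where "u y i = (if i < n then \<beta> y * (q0 i y - v i - F y i) else 0)" for y and i :: nat
  define F' where "F' y i = F y i + (\<Sum>j<p. u ((f ^^ j) y) i)" for y i
  have \<beta>: "0 \<le> \<beta> y" "\<beta> y \<le> 1" for y by (auto simp: \<beta>_def)
  have \<beta>1: "\<beta> y = 1" if "dist1 n x y \<le> r" for y
  proof -
    have "dist1 n x y / r \<le> 1" using that r by simp
    then show ?thesis by (simp add: \<beta>_def)
  qed
  have \<beta>0: "\<beta> y = 0" if "dist1 n x y \<ge> 2 * r" for y
  proof -
    have "dist1 n x y / r \<ge> 2" using that r by (simp add: le_divide_eq)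
    then show ?thesis by (simp add: \<beta>_def)
  qed
  have u_le: "\<bar>u y i\<bar> \<le> \<epsilon>'" if y: "y \<in> W" for y i
  proof (cases "i < n \<and> y \<in> ?C")
    case True
    then have "\<bar>q0 i y - F y i\<bar> \<le> \<epsilon>' / 2" "\<bar>v i\<bar> \<le> \<epsilon>' / 2" using q0(3)[of y i] v(1)[of i] by auto
    then have "\<bar>q0 i y - v i - F y i\<bar> \<le> \<epsilon>'" by linarith
    then have "\<beta> y * \<bar>q0 i y - v i - F y i\<bar> \<le> 1 * \<epsilon>'" using \<beta>[of y] by (intro mult_mono) auto
    then show ?thesis using True \<beta>(1)[of y] by (simp add: u_def abs_mult)
  next
    case False
    then have "u y i = 0" using \<beta>0[of y] y W_Rn by (auto simp: u_def)
    then show ?thesis using \<epsilon>' by simp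
  qed
  have cont_u: "continuous_on W (\<lambda>y. u y i)" for i
  proof (cases "i < n")
    case True
    have "continuous_on W (\<lambda>y. q0 i y)" by (rule continuous_on_dist1_Lipschitz[OF q0(2)])
    then have "continuous_on W (\<lambda>y. \<beta> y * (q0 i y - v i - F y i))"
      unfolding \<beta>_def using r
      by (intro continuous_on_mult continuous_on_diff continuous_on_const cF continuous_on_max continuous_on_min
          continuous_on_divide continuous_on_dist1 continuous_on_id) auto
    then show ?thesis using True by (simp add: u_def)
  qed (simp add: u_def)
  have "inv_map F'" unfolding inv_map_def
  proof (intro conjI ballI)
    have uj: "continuous_on W (\<lambda>y. u ((f ^^ j) y) i)" for i j
      by (rule continuous_on_compose2[OF cont_u cont_funpow]) (use funpow_W in auto)
    show "continuous_on W F'" unfolding F'_def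
      by (intro continuous_on_coordinatewise_then_product continuous_on_add continuous_on_sum cF uj)
    show "F' \<in> W \<rightarrow> Rn n" using F by (auto simp: inv_map_def F'_def Rn_def u_def Pi_iff)
    fix y assume y: "y \<in> W"
    have "(\<Sum>j<p. u ((f ^^ j) (f y)) i) = (\<Sum>j<p. u ((f ^^ j) y) i)" for i
    proof -
      have "(\<Sum>j<p. u ((f ^^ j) (f y)) i) + u y i = (\<Sum>j<Suc p. u ((f ^^ j) y) i)"
        by (simp only: sum.lessThan_Suc_shift funpow_Suc_right o_apply funpow_0)
      also have "\<dots> = (\<Sum>j<p. u ((f ^^ j) y) i) + u y i" using period[OF y] by simp
      finally show ?thesis by simp
    qed
    then show "F' (f y) = F' y" using F y by (simp add: F'_def inv_map_def fun_eq_iff)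
  qed
  moreover have "dist1 n (F y) (F' y) < \<epsilon>" if y: "y \<in> W" for y
  proof -
    have "\<bar>F y i - F' y i\<bar> \<le> p * \<epsilon>'" for i
    proof -
      have "\<bar>\<Sum>j<p. u ((f ^^ j) y) i\<bar> \<le> (\<Sum>j<p. \<bar>u ((f ^^ j) y) i\<bar>)" by (rule sum_abs)
      also have "\<dots> \<le> (\<Sum>j<p. \<epsilon>')" using u_le funpow_W[OF y] by (intro sum_mono) auto
      finally show ?thesis by (simp add: F'_def)
    qed
    then have "dist1 n (F y) (F' y) \<le> (\<Sum>i<n. p * \<epsilon>')" unfolding dist1_def by (intro sum_mono) auto
    then show ?thesis using \<epsilon>'(2) by (simp add: mult.assoc)
  qed
  moreover have "F' y \<noteq> c" if y: "y \<in> Rn n" "dist1 n x y = r" for y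
  proof -
    have yC: "y \<in> ?C" using y r by auto
    have "F' y i = q0 i y - v i" if i: "i < n" for i
    proof -
      have "u ((f ^^ j) y) i = 0" if "j \<in> {..<p} - {0}" for j
        using \<beta>0[of "(f ^^ j) y"] free[of j y] that yC by (simp add: u_def)
      then have "(\<Sum>j<p. u ((f ^^ j) y) i) = u y i"
        using p_pos by (simp add: sum.remove[of "{..<p}" 0])
      also have "\<dots> = q0 i y - v i - F y i" using i \<beta>1[of y] y by (simp add: u_def)
      finally show ?thesis by (simp add: F'_def)
    qed
    moreover obtain i where "i < n" "q0 i y \<noteq> c i + v i" using v(2) y by blast
    ultimately show ?thesis by force
  qed
  ultimately show ?thesis using that by blast
qed

text \<open>The balls are treated one after the other. The spheres already cleared form a compact
  set on which the map keeps a distance \<open>\<delta>\<close> from \<open>c\<close>, so a further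
  perturbation smaller than \<open>\<delta>\<close> does not undo the earlier ones.\<close>

lemma perturb_off_spheres:
  assumes n: "n > 0" and c: "c \<in> Rn n" and F: "inv_map F"
    and T: "finite T" "\<And>x. x \<in> T \<Longrightarrow> free_ball x (\<rho> x)" and \<epsilon>: "\<epsilon> > 0"
  shows "\<exists>F'. inv_map F' \<and> (\<forall>y \<in> W. dist1 n (F y) (F' y) < \<epsilon>) \<and>
    (\<forall>x \<in> T. \<forall>y \<in> Rn n. dist1 n x y = \<rho> x \<longrightarrow> F' y \<noteq> c)"
  using T \<epsilon>
proof (induction T arbitrary: \<epsilon> rule: finite_induct)
  case empty
  then show ?case using F by auto
next
  case (insert x T)
  obtain F1 where F1: "inv_map F1" "\<And>y. y \<in> W \<Longrightarrow> dist1 n (F y) (F1 y) < \<epsilon> / 2"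
      "\<And>z y. \<lbrakk>z \<in> T; y \<in> Rn n; dist1 n z y = \<rho> z\<rbrakk> \<Longrightarrow> F1 y \<noteq> c"
    using insert.IH[of "\<epsilon> / 2"] insert.prems by auto
  define S where "S = (\<Union>z\<in>T. {y \<in> Rn n. dist1 n z y \<le> \<rho> z} \<inter> {y. dist1 n z y = \<rho> z})"
  have SW: "S \<subseteq> W" using insert.prems(1) by (force simp: S_def free_ball_def)
  have "compact S" unfolding S_def
  proof (rule compact_UN[OF insert.hyps(1)])
    fix z assume "z \<in> T"
    show "compact ({y \<in> Rn n. dist1 n z y \<le> \<rho> z} \<inter> {y. dist1 n z y = \<rho> z})"
      by (intro compact_Int_closed compact_dist1_cball closed_Collect_eq continuous_on_dist1_right continuous_on_const)
  qed
  obtain \<delta> where \<delta>: "\<delta> > 0" "\<And>y. y \<in> S \<Longrightarrow> \<delta> \<le> dist1 n (F1 y) c"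
  proof (cases "S = {}")
    case False
    have "continuous_on S (\<lambda>y. dist1 n (F1 y) c)"
      using F1(1) SW by (intro continuous_on_dist1 continuous_on_const) (auto simp: inv_map_def intro: continuous_on_subset)
    from continuous_attains_inf[OF \<open>compact S\<close> False this] obtain y0 where
      y0: "y0 \<in> S" "\<And>y. y \<in> S \<Longrightarrow> dist1 n (F1 y0) c \<le> dist1 n (F1 y) c" by blast
    have "F1 y0 \<noteq> c" using F1(3) y0(1) by (auto simp: S_def)
    moreover have "F1 y0 \<in> Rn n" using F1(1) y0(1) SW by (auto simp: inv_map_def)
    ultimately have "dist1 n (F1 y0) c \<noteq> 0" using dist1_eq_0_iff c by blast
    then have "dist1 n (F1 y0) c > 0" using dist1_nonneg[of n "F1 y0" c] by linarith
    then show ?thesis using that y0(2) by blast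
  qed (use that[of 1] in auto)
  have "min (\<epsilon> / 2) \<delta> > 0" using \<delta> insert.prems by simp
  from perturb_off_sphere[OF n F1(1) insert.prems(1)[of x, simplified] this, of c]
  obtain F2 where F2: "inv_map F2" "\<And>y. y \<in> W \<Longrightarrow> dist1 n (F1 y) (F2 y) < min (\<epsilon> / 2) \<delta>"
    "\<And>y. \<lbrakk>y \<in> Rn n; dist1 n x y = \<rho> x\<rbrakk> \<Longrightarrow> F2 y \<noteq> c" by blast
  have "dist1 n (F y) (F2 y) < \<epsilon>" if "y \<in> W" for y
    using F1(2)[OF that] F2(2)[OF that] dist1_triangle[of n "F y" "F2 y" "F1 y"] by linarith
  moreover have "F2 y \<noteq> c" if "z \<in> T" "y \<in> Rn n" "dist1 n z y = \<rho> z" for z y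
  proof -
    have "y \<in> S" unfolding S_def using that by (intro UN_I[of z]) auto
    then show ?thesis using \<delta>(2)[of y] F2(2)[of y] SW by auto
  qed
  ultimately show ?case using F2 by (intro exI[of _ F2]) auto
qed

text \<open>Using all iterates makes stability under \<open>f\<close> immediate. For subsets of
  \<open>W\<close>, periodicity reduces the union to the first \<open>p\<close> images, the form
  that shows openness and compactness to be preserved.\<close>

definition saturate :: "(nat \<Rightarrow> real) set \<Rightarrow> (nat \<Rightarrow> real) set" where
  "saturate A = (\<Union>m. (f ^^ m) ` A)"

lemma saturate_mod: "A \<subseteq> W \<Longrightarrow> saturate A = (\<Union>j<p. (f ^^ j) ` A)"
proof (intro equalityI subsetI)
  fix x assume A: "A \<subseteq> W" and "x \<in> saturate A"
  then obtain m a where "a \<in> A" "x = (f ^^ m) a" by (auto simp: saturate_def)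
  then have "x = (f ^^ (m mod p)) a" using funpow_mod_on[OF f_W period, of a m] A by auto
  then show "x \<in> (\<Union>j<p. (f ^^ j) ` A)" using \<open>a \<in> A\<close> p_pos by auto
qed (auto simp: saturate_def)

lemma saturate_superset: "A \<subseteq> saturate A"
  by (auto simp: saturate_def intro!: exI[of _ 0])

lemma saturate_mono: "A \<subseteq> B \<Longrightarrow> saturate A \<subseteq> saturate B"
  by (auto simp: saturate_def)

lemma saturate_funpow: "x \<in> saturate A \<Longrightarrow> (f ^^ j) x \<in> saturate A"
proof -
  assume "x \<in> saturate A"
  then obtain m a where "a \<in> A" "x = (f ^^ m) a" by (auto simp: saturate_def)
  then have "(f ^^ j) x = (f ^^ (j + m)) a" by (simp add: funpow_add)
  then show ?thesis using \<open>a \<in> A\<close> by (auto simp: saturate_def)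
qed

lemma saturate_funpow_iff:
  assumes "A \<subseteq> W" "x \<in> W"
  shows "(f ^^ j) x \<in> saturate A \<longleftrightarrow> x \<in> saturate A"
proof
  assume *: "(f ^^ j) x \<in> saturate A"
  have "(f ^^ (p - j mod p)) ((f ^^ (j mod p)) x) = x"
    using funpow_inverse[OF assms(2)] p_pos by (simp add: less_imp_le)
  then show "x \<in> saturate A"
    using saturate_funpow[OF *, of "p - j mod p"] funpow_mod_on[OF f_W period assms(2), of j] by simp
qed (rule saturate_funpow)

lemma openin_funpow_image:
  assumes "openin (top_of_set W) A" "j \<le> p"
  shows "openin (top_of_set W) ((f ^^ j) ` A)"
proof -
  have AW: "A \<subseteq> W" using assms openin_imp_subset by blast
  have "(f ^^ j) ` A = W \<inter> (f ^^ (p - j)) -` A"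
  proof (intro equalityI subsetI)
    fix x assume x: "x \<in> W \<inter> (f ^^ (p - j)) -` A"
    then have "(f ^^ j) ((f ^^ (p - j)) x) = x"
      using funpow_inverse[of x "p - j"] assms(2) by simp
    then show "x \<in> (f ^^ j) ` A" using x by (metis IntD2 image_eqI vimageD)
  next
    fix x assume "x \<in> (f ^^ j) ` A"
    then obtain y where "y \<in> A" "x = (f ^^ j) y" by blast
    then show "x \<in> W \<inter> (f ^^ (p - j)) -` A"
      using funpow_inverse[of y j] assms(2) AW funpow_W by auto
  qed
  moreover have "(f ^^ (p - j)) \<in> W \<rightarrow> W" using funpow_W by auto
  ultimately show ?thesis using continuous_openin_preimage[OF cont_funpow _ assms(1)] by metis
qed

lemma openin_saturate:
  assumes "openin (top_of_set W) A"
  shows "openin (top_of_set W) (saturate A)"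
  unfolding saturate_mod[OF openin_imp_subset[OF assms]]
  using openin_funpow_image[OF assms] by auto

lemma compact_saturate:
  assumes "compact A" "A \<subseteq> W"
  shows "compact (saturate A)"
  unfolding saturate_mod[OF assms(2)]
  by (intro compact_UN compact_continuous_image[OF continuous_on_subset[OF cont_funpow assms(2)] assms(1)]) auto

text \<open>\<open>P\<close> grows ball by ball: the new open ball is added after removal of
  \<open>SC\<close>, the orbits of the earlier closed balls. Removing closed balls keeps the result
  open, and as \<open>SC\<close> is invariant and contains the old \<open>P\<close>, old and new
  translates are disjoint. Only orbits of boundary spheres get lost, and by \<open>avoid\<close>
  these contain no point of the level set.\<close>

lemma separate_level_set:
  assumes F: "inv_map F" and T: "finite T" "\<And>x. x \<in> T \<Longrightarrow> free_ball x (\<rho> x)"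
    and avoid: "\<And>x y. \<lbrakk>x \<in> T; y \<in> Rn n; dist1 n x y = \<rho> x\<rbrakk> \<Longrightarrow> F y \<noteq> c"
  shows "\<exists>P. openin (top_of_set W) P \<and> disjoint_family_on (\<lambda>j. (f ^^ j) ` P) {..<p} \<and>
     P \<subseteq> saturate (\<Union>x\<in>T. {y \<in> Rn n. dist1 n x y < \<rho> x}) \<and>
     {y \<in> W. F y = c} \<inter> saturate (\<Union>x\<in>T. {y \<in> Rn n. dist1 n x y < \<rho> x}) \<subseteq> saturate P"
  using T avoid
proof (induction T rule: finite_induct)
  case empty
  show ?case by (intro exI[of _ "{}"]) (auto simp: disjoint_family_on_def saturate_def)
next
  case (insert x T)
  let ?O = "\<lambda>x. {y \<in> Rn n. dist1 n x y < \<rho> x}" and ?C = "\<lambda>x. {y \<in> Rn n. dist1 n x y \<le> \<rho> x}"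
  have fb: "free_ball z (\<rho> z)" if "z \<in> insert x T" for z using insert.prems(1) that .
  have CW: "?C z \<subseteq> W" if "z \<in> insert x T" for z using fb[OF that] by (force simp: free_ball_def)
  have OC: "?O z \<subseteq> ?C z" for z by auto
  have OW: "?O z \<subseteq> W" if "z \<in> insert x T" for z using CW[OF that] by auto
  have UO: "(\<Union>z\<in>T. ?O z) \<subseteq> W" using OW by blast
  obtain P where P: "openin (top_of_set W) P" "disjoint_family_on (\<lambda>j. (f ^^ j) ` P) {..<p}"
     "P \<subseteq> saturate (\<Union>z\<in>T. ?O z)" "{y \<in> W. F y = c} \<inter> saturate (\<Union>z\<in>T. ?O z) \<subseteq> saturate P"
    using insert.IH insert.prems by auto
  have PW: "P \<subseteq> W" using P(1) openin_imp_subset by blast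
  define SC where "SC = saturate (\<Union>z\<in>T. ?C z)"
  define N where "N = ?O x - SC"
  have UC: "(\<Union>z\<in>T. ?C z) \<subseteq> W" using CW by blast
  have NW: "N \<subseteq> W" using OW[of x] by (auto simp: N_def)
  have "compact (\<Union>z\<in>T. ?C z)" by (intro compact_UN insert.hyps compact_dist1_cball)
  then have "closed SC" unfolding SC_def using UC compact_saturate compact_imp_closed by blast
  have "openin (top_of_set W) N"
  proof -
    have "openin (top_of_set W) (?O x)"
      using openin_dist1_ball[of n x "\<rho> x"] OW[of x] W_Rn by (auto intro: openin_subset_trans)
    moreover have "N = ?O x - SC \<inter> W" using OW[of x] by (auto simp: N_def)
    moreover have "closedin (top_of_set W) (SC \<inter> W)" using \<open>closed SC\<close> by (metis closedin_closed_Int inf.commute)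
    ultimately show ?thesis by (simp add: openin_diff)
  qed
  then have 1: "openin (top_of_set W) (P \<union> N)" using P(1) by blast
  have PS: "P \<subseteq> SC"
    using P(3) saturate_mono[of "\<Union>z\<in>T. ?O z" "\<Union>z\<in>T. ?C z"] OC unfolding SC_def by blast
  \<comment> \<open>Applying \<open>f ^^ (p - i)\<close> turns an equality into
    \<open>a = (f ^^ (j - i)) b\<close> with \<open>0 < j - i < p\<close>, which the free ball
    excludes.\<close>
  have disjN: "(f ^^ i) a \<noteq> (f ^^ j) b" if "a \<in> N" "b \<in> N" "i < j" "j < p" for a b i j
  proof
    assume "(f ^^ i) a = (f ^^ j) b"
    then have "(f ^^ (p - i)) ((f ^^ i) a) = (f ^^ (p - i)) ((f ^^ j) b)" by simp
    moreover have "(f ^^ (p - i)) ((f ^^ i) a) = a" using funpow_inverse[of a i] that NW by auto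
    moreover have "(f ^^ (p - i)) ((f ^^ j) b) = (f ^^ (p - i + j)) b" by (simp add: funpow_add)
    moreover have "(f ^^ (p - i + j)) b = (f ^^ ((p - i + j) mod p)) b"
      using that NW by (intro funpow_mod_on[OF f_W period]) auto
    moreover have "(p - i + j) mod p = j - i"
    proof -
      have "p - i + j = p + (j - i)" "j - i < p" using that by auto
      then show ?thesis by simp
    qed
    ultimately have "a = (f ^^ (j - i)) b" by simp
    moreover have "dist1 n x ((f ^^ (j - i)) b) > 2 * \<rho> x"
      using fb[of x] that by (auto simp: free_ball_def N_def)
    ultimately show False using that(1) fb[of x] by (auto simp: N_def free_ball_def)
  qed
  have disjPN: "(f ^^ i) a \<noteq> (f ^^ j) b" if "a \<in> P" "b \<in> N" for a b i j
  proof
    assume eq: "(f ^^ i) a = (f ^^ j) b"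
    have "(f ^^ i) a \<in> SC" using that PS saturate_funpow unfolding SC_def by blast
    then have "b \<in> SC" unfolding eq using saturate_funpow_iff[OF UC, of b j] that NW unfolding SC_def by blast
    then show False using that by (auto simp: N_def)
  qed
  have 2: "disjoint_family_on (\<lambda>j. (f ^^ j) ` (P \<union> N)) {..<p}"
    unfolding disjoint_family_on_def
  proof (intro ballI impI)
    fix i j assume ij: "i \<in> {..<p}" "j \<in> {..<p}" "i \<noteq> j"
    have PP: "(f ^^ i) ` P \<inter> (f ^^ j) ` P = {}"
      using P(2) ij by (auto simp: disjoint_family_on_def)
    have NN: "(f ^^ i) a \<noteq> (f ^^ j) b" if "a \<in> N" "b \<in> N" for a b
      using disjN[of a b i j] disjN[of b a j i] that ij by (metis lessThan_iff linorder_neqE_nat)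
    have "(f ^^ i) a \<noteq> (f ^^ j) b" if "a \<in> P \<union> N" "b \<in> P \<union> N" for a b
      using that
    proof (elim UnE)
      assume "a \<in> P" "b \<in> P" then show ?thesis using PP by blast
    next
      assume "a \<in> N" "b \<in> P" then show ?thesis using disjPN[of b a j i] by simp
    qed (use disjPN NN in auto)
    then show "(f ^^ i) ` (P \<union> N) \<inter> (f ^^ j) ` (P \<union> N) = {}" by blast
  qed
  have 3: "P \<union> N \<subseteq> saturate (\<Union>z\<in>insert x T. ?O z)"
  proof -
    have "saturate (\<Union>z\<in>T. ?O z) \<subseteq> saturate (\<Union>z\<in>insert x T. ?O z)" by (rule saturate_mono) auto
    moreover have "N \<subseteq> saturate (\<Union>z\<in>insert x T. ?O z)"
      using saturate_superset[of "\<Union>z\<in>insert x T. ?O z"] by (auto simp: N_def)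
    ultimately show ?thesis using P(3) by blast
  qed
  have 4: "{y \<in> W. F y = c} \<inter> saturate (\<Union>z\<in>insert x T. ?O z) \<subseteq> saturate (P \<union> N)"
  proof
    fix k assume k: "k \<in> {y \<in> W. F y = c} \<inter> saturate (\<Union>z\<in>insert x T. ?O z)"
    then obtain m z b where b: "z \<in> insert x T" "b \<in> ?O z" "k = (f ^^ m) b"
      unfolding saturate_def by blast
    have bW: "b \<in> W" using b OW by blast
    have Fb: "F b = c" using inv_map_funpow[OF F bW, of m] k b by auto
    have bT: "b \<in> saturate (P \<union> N)" if "b \<in> saturate (\<Union>z\<in>T. ?O z)"
      using that P(4) bW Fb saturate_mono[of P "P \<union> N"] by blast
    have "b \<in> saturate (P \<union> N)"
    proof (cases "b \<in> SC")
      case True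
      then obtain l w a where a: "w \<in> T" "a \<in> ?C w" "b = (f ^^ l) a" unfolding SC_def saturate_def by blast
      have "a \<in> W" using a CW by blast
      then have "F a = c" using inv_map_funpow[OF F, of a l] a Fb by simp
      then have "dist1 n w a \<noteq> \<rho> w" using insert.prems(2)[of w a] a by auto
      then have "a \<in> ?O w" using a by auto
      then show ?thesis using a(1,3) by (intro bT) (auto simp: saturate_def)
    next
      case False
      show ?thesis
      proof (cases "z = x")
        case True
        then have "b \<in> N" using b(2) False by (simp add: N_def)
        then show ?thesis by (intro subsetD[OF saturate_superset]) simp
      next
        case z: False
        then have "b \<in> (\<Union>z\<in>T. ?O z)" using b by blast
        then show ?thesis by (intro bT subsetD[OF saturate_superset])
      qed
    qed
    then show "k \<in> saturate (P \<union> N)" using saturate_funpow b(3) by simp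
  qed
  show ?case using 1 2 3 4 by blast
qed

definition orbit_mean :: "(nat \<Rightarrow> real) \<Rightarrow> nat \<Rightarrow> real" where
  "orbit_mean x i = (\<Sum>j<p. (f ^^ j) x i) / p"

lemma inv_map_orbit_mean: "inv_map orbit_mean"
  unfolding inv_map_def
proof (intro conjI ballI)
  have "continuous_on W (\<lambda>x. (f ^^ j) x i)" for i j
    by (rule continuous_on_product_then_coordinatewise[OF cont_funpow])
  then have "continuous_on W (\<lambda>x. orbit_mean x i)" for i
    unfolding orbit_mean_def using p_pos by (intro continuous_on_divide continuous_on_sum continuous_on_const) auto
  then show "continuous_on W orbit_mean" by (rule continuous_on_coordinatewise_then_product)
  have "(f ^^ j) x \<in> Rn n" if "x \<in> W" for x j using funpow_W[OF that] W_Rn by blast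
  then show "orbit_mean \<in> W \<rightarrow> Rn n" by (auto simp: orbit_mean_def Rn_def)
  fix x assume x: "x \<in> W"
  have "(\<Sum>j<p. (f ^^ j) (f x) i) = (\<Sum>j<p. (f ^^ j) x i)" for i
  proof -
    have "(\<Sum>j<p. (f ^^ j) (f x) i) + x i = (\<Sum>j<Suc p. (f ^^ j) x i)"
      by (simp only: sum.lessThan_Suc_shift funpow_Suc_right o_apply funpow_0)
    also have "\<dots> = (\<Sum>j<p. (f ^^ j) x i) + x i" using period[OF x] by simp
    finally show ?thesis by simp
  qed
  then show "orbit_mean (f x) = orbit_mean x" by (simp add: orbit_mean_def fun_eq_iff)
qed

text \<open>Balls of the sum norm are convex, and the mean is a convex combination of orbit
  points.\<close>

lemma dist1_orbit_mean_le:
  assumes "\<And>j. dist1 n x ((f ^^ j) x) \<le> t"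
  shows "dist1 n x (orbit_mean x) \<le> t"
proof -
  have "\<bar>x i - orbit_mean x i\<bar> \<le> (\<Sum>j<p. \<bar>x i - (f ^^ j) x i\<bar>) / p" for i
  proof -
    have "x i - orbit_mean x i = (\<Sum>j<p. x i - (f ^^ j) x i) / p"
      using p_pos by (simp add: orbit_mean_def sum_subtractf diff_divide_distrib)
    then show ?thesis by (simp add: abs_divide divide_right_mono)
  qed
  then have "dist1 n x (orbit_mean x) \<le> (\<Sum>i<n. (\<Sum>j<p. \<bar>x i - (f ^^ j) x i\<bar>) / p)"
    unfolding dist1_def by (rule sum_mono)
  also have "\<dots> = (\<Sum>j<p. dist1 n x ((f ^^ j) x)) / p"
    unfolding dist1_def sum_divide_distrib[symmetric] by (subst sum.swap) (rule refl)
  also have "\<dots> \<le> (\<Sum>j<p. t) / p" using assms by (intro divide_right_mono sum_mono) auto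
  finally show ?thesis using p_pos by simp
qed

text \<open>A point of the level set at \<open>c\<close> of the orbit mean is either \<open>c\<close> itself or not fixed by \<open>f\<close>; hence,
  if \<open>c\<close> is not fixed, \<open>f\<close> acts freely near this level set.\<close>

theorem small_orbits_fix_centre:
  assumes p: "prime p" and c: "c \<in> Rn n" and r: "0 < r" "r < R"
    and ball: "{y \<in> Rn n. dist1 n c y < R} \<subseteq> W"
    and move: "\<And>x j. x \<in> W \<Longrightarrow> dist1 n x ((f ^^ j) x) \<le> r / 8"
  shows "f c = c"
proof (rule ccontr)
  assume nf: "f c \<noteq> c"
  have cW: "c \<in> W" using c r ball by auto
  have n: "n > 0"
  proof (rule ccontr)
    assume "\<not> n > 0"
    moreover have "f c \<in> Rn n" using funpow_W[OF cW, of 1] W_Rn by auto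
    ultimately show False using nf c by (auto simp: Rn_def)
  qed
  let ?F = orbit_mean
  have F: "inv_map ?F" by (rule inv_map_orbit_mean)
  have moveF: "dist1 n x (?F x) \<le> r / 8" if "x \<in> W" for x
    by (rule dist1_orbit_mean_le) (rule move[OF that])
  let ?B = "{y \<in> Rn n. dist1 n c y \<le> r / 2}"
  have BW: "?B \<subseteq> W" using ball r by force
  define K where "K = {x \<in> ?B. ?F x = c}"
  have cF: "continuous_on ?B ?F" using F BW by (auto simp: inv_map_def intro: continuous_on_subset)
  have "compact K"
    unfolding K_def by (rule closedin_compact[OF compact_dist1_cball continuous_closedin_preimage_constant[OF cF]])
  have free: "(f ^^ j) x \<noteq> x" if x: "x \<in> K" and j: "0 < j" "j < p" for x j
  proof
    assume eq: "(f ^^ j) x = x"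
    have xW: "x \<in> W" using x BW by (auto simp: K_def)
    \<comment> \<open>Primality enters here: \<open>j\<close> is invertible modulo \<open>p\<close>,
      so a fixed point of \<open>f ^^ j\<close> is fixed by \<open>f\<close>; it then equals its
      orbit mean, which is \<open>c\<close>, but \<open>c\<close> is not fixed.\<close>
    have "coprime j p" using p j by (metis coprime_commute nat_dvd_not_less prime_imp_coprime)
    then obtain k where "[j * k = Suc 0] (mod p)" using cong_solve_coprime_nat by blast
    then have k: "(j * k) mod p = 1" using p prime_gt_1_nat by (auto simp: cong_def)
    have "(f ^^ (j * k)) x = x" using eq by (induction k) (auto simp: funpow_add)
    then have fx: "f x = x" using funpow_mod_on[OF f_W period xW, of "j * k"] k by simp
    then have "(f ^^ j) x = x" for j by (induction j) auto
    then have "?F x = x" using p_pos by (simp add: orbit_mean_def fun_eq_iff)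
    then show False using x fx nf by (simp add: K_def)
  qed
  have "\<exists>\<rho>. free_ball x \<rho>" if xK: "x \<in> K" for x
  proof -
    have "x \<in> W" using xK BW by (auto simp: K_def)
    then obtain t where "free_ball x t" by (rule free_ball_exists[OF _ free[OF xK]])
    then show ?thesis ..
  qed
  then obtain \<rho> where \<rho>: "\<And>x. x \<in> K \<Longrightarrow> free_ball x (\<rho> x)" by metis
  have cover: "K \<subseteq> (\<Union>x\<in>K. {y. dist1 n x y < \<rho> x})" using \<rho> by (auto simp: free_ball_def)
  have op: "open {y. dist1 n x y < \<rho> x}" for x
    by (intro open_Collect_less continuous_on_dist1_right continuous_on_const)
  obtain T where T: "T \<subseteq> K" "finite T" "K \<subseteq> (\<Union>x\<in>T. {y. dist1 n x y < \<rho> x})"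
    by (rule compactE_image[where f = "\<lambda>x. {y. dist1 n x y < \<rho> x}", OF \<open>compact K\<close> op cover])
  have fb: "free_ball x (\<rho> x)" if "x \<in> T" for x using T(1) \<rho> that by blast
  let ?O = "\<Union>x\<in>T. {y \<in> Rn n. dist1 n x y < \<rho> x}"
  have OW: "{y \<in> Rn n. dist1 n x y < \<rho> x} \<subseteq> W" if "x \<in> T" for x
    using fb[OF that] by (force simp: free_ball_def)
  have "openin (top_of_set W) ?O"
    using OW W_Rn by (intro openin_Union) (auto intro!: openin_subset_trans[OF openin_dist1_ball])
  then have "openin (top_of_set W) (saturate ?O)" by (rule openin_saturate)
  then have "openin (top_of_set ?B) (?B \<inter> saturate ?O)"
  proof -
    obtain V where "open V" "saturate ?O = W \<inter> V"
      using \<open>openin (top_of_set W) (saturate ?O)\<close> by (auto simp only: openin_open)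
    moreover from this have "?B \<inter> saturate ?O = ?B \<inter> V" using BW by blast
    ultimately show ?thesis by (simp only: openin_open_Int)
  qed
  then have "closedin (top_of_set ?B) (?B - ?B \<inter> saturate ?O)" by (intro closedin_diff) auto
  then have comp: "compact (?B - ?B \<inter> saturate ?O)" by (rule closedin_compact[OF compact_dist1_cball])
  \<comment> \<open>Within \<open>?B\<close> but off the saturated cover the orbit mean keeps a
    distance \<open>\<eta>\<close> from \<open>c\<close>, so a perturbation by less than
    \<open>\<eta>\<close> creates no point of the level set there.\<close>
  obtain \<eta> where \<eta>: "\<eta> > 0" "\<And>y. y \<in> ?B - ?B \<inter> saturate ?O \<Longrightarrow> \<eta> \<le> dist1 n (?F y) c"
  proof (cases "?B - ?B \<inter> saturate ?O = {}")
    case False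
    have "continuous_on (?B - ?B \<inter> saturate ?O) (\<lambda>y. dist1 n (?F y) c)"
      using cF by (intro continuous_on_dist1 continuous_on_const) (auto intro: continuous_on_subset)
    from continuous_attains_inf[OF comp False this] obtain y0 where
      y0: "y0 \<in> ?B - ?B \<inter> saturate ?O" "\<And>y. y \<in> ?B - ?B \<inter> saturate ?O \<Longrightarrow> dist1 n (?F y0) c \<le> dist1 n (?F y) c"
      by blast
    have "y0 \<notin> K"
    proof
      assume "y0 \<in> K"
      then have "y0 \<in> ?O" using T(3) by (auto simp: K_def)
      then show False using y0(1) subsetD[OF saturate_superset, of y0 ?O] by blast
    qed
    then have "?F y0 \<noteq> c" using y0(1) by (auto simp: K_def)
    moreover have "?F y0 \<in> Rn n" using F y0(1) BW by (auto simp: inv_map_def)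
    ultimately have "dist1 n (?F y0) c \<noteq> 0" using dist1_eq_0_iff c by blast
    then have "dist1 n (?F y0) c > 0" using dist1_nonneg[of n "?F y0" c] by linarith
    then show ?thesis using that y0(2) by blast
  qed (use that[of 1] in auto)
  \<comment> \<open>The bound \<open>r / 8\<close> keeps the perturbed mean within
    \<open>r / 4\<close> of the identity, so its level set stays in \<open>?B\<close>.\<close>
  have "min (r / 8) \<eta> > 0" using r \<eta> by simp
  from perturb_off_spheres[OF n c F T(2) fb this] obtain F' where F': "inv_map F'"
    "\<And>y. y \<in> W \<Longrightarrow> dist1 n (?F y) (F' y) < min (r / 8) \<eta>"
    "\<And>x y. \<lbrakk>x \<in> T; y \<in> Rn n; dist1 n x y = \<rho> x\<rbrakk> \<Longrightarrow> F' y \<noteq> c" by blast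
  have moveF': "dist1 n x (F' x) \<le> r / 4" if "x \<in> W" for x
    using moveF[OF that] F'(2)[OF that] dist1_triangle[of n x "F' x" "?F x"] by linarith
  have "\<exists>P. openin (top_of_set W) P \<and> disjoint_family_on (\<lambda>j. (f ^^ j) ` P) {..<p} \<and>
     P \<subseteq> saturate ?O \<and> {y \<in> W. F' y = c} \<inter> saturate ?O \<subseteq> saturate P"
  proof (rule separate_level_set[OF F'(1) T(2)])
    show "free_ball x (\<rho> x)" if "x \<in> T" for x by (rule fb[OF that])
    show "F' y \<noteq> c" if "x \<in> T" "y \<in> Rn n" "dist1 n x y = \<rho> x" for x y by (rule F'(3)[OF that])
  qed
  then obtain P where P: "openin (top_of_set W) P" "disjoint_family_on (\<lambda>j. (f ^^ j) ` P) {..<p}"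
     "{y \<in> W. F' y = c} \<inter> saturate ?O \<subseteq> saturate P"
    by (elim exE conjE) (rule that)
  have PW: "P \<subseteq> W" using P(1) openin_imp_subset by blast
  have "{y \<in> W. F' y = c} \<subseteq> saturate ?O"
  proof
    fix y assume y: "y \<in> {y \<in> W. F' y = c}"
    then have yR: "y \<in> Rn n" using W_Rn by auto
    have "dist1 n c y \<le> r / 2" using moveF'[of y] y r by (auto simp: dist1_commute)
    then have "y \<in> ?B" using yR by simp
    moreover have "dist1 n (?F y) c < \<eta>" using F'(2)[of y] y by auto
    ultimately show "y \<in> saturate ?O" using \<eta>(2)[of y] by force
  qed
  then have "{y \<in> W. F' y = c} \<subseteq> (\<Union>j<p. (f ^^ j) ` P)"
    using P(3) unfolding saturate_mod[OF PW] by blast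
  moreover have "dist1 n x ((f ^^ j) x) \<le> r / 4" if "x \<in> W" for x j using move[OF that, of j] r by linarith
  moreover have "dist1 n x (F' x) \<le> r / 2" if "x \<in> W" for x using moveF'[OF that] r by linarith
  ultimately have "p = 1"
    using periodic_map_degree[OF open_W cont_f f_W period p_pos _ _ _ c r ball _ _ P(1,2), of F'] F'(1)
    unfolding inv_map_def by auto
  then show False using p by simp
qed

end

section \<open>Newman's theorem for compact manifolds\<close>

text \<open>A Lebesgue number argument: finitely many balls on which the local hypothesis applies
  cover \<open>Z\<close>, and the least of their radii works everywhere.\<close>

lemma (in Metric_space) compactin_uniform_radius:
  assumes Z: "compactin mtopology Z"
    and loc: "\<And>z. z \<in> Z \<Longrightarrow> \<exists>e>0. \<forall>y\<in>M. \<forall>y'\<in>M. d z y < e \<and> d y y' < e \<longrightarrow> Q y y'"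
  shows "\<exists>e>0. \<forall>y\<in>Z. \<forall>y'\<in>M. d y y' < e \<longrightarrow> Q y y'"
proof -
  have ZM: "Z \<subseteq> M" using compactin_subset_topspace[OF Z] by simp
  obtain e where e: "\<And>z. z \<in> Z \<Longrightarrow> e z > 0"
    "\<And>z y y'. \<lbrakk>z \<in> Z; y \<in> M; y' \<in> M; d z y < e z; d y y' < e z\<rbrakk> \<Longrightarrow> Q y y'"
    using loc by metis
  have "\<exists>F. finite F \<and> F \<subseteq> (\<lambda>z. mball z (e z)) ` Z \<and> Z \<subseteq> \<Union>F"
  proof (rule compactinD[OF Z])
    show "Z \<subseteq> \<Union> ((\<lambda>z. mball z (e z)) ` Z)" using e(1) ZM by force
  qed auto
  then obtain F where F: "finite F" "F \<subseteq> (\<lambda>z. mball z (e z)) ` Z" "Z \<subseteq> \<Union>F" by blast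
  obtain T where T: "finite T" "T \<subseteq> Z" "Z \<subseteq> (\<Union>z\<in>T. mball z (e z))"
    using finite_subset_image[OF F(1,2)] F(3) by blast
  define \<epsilon> where "\<epsilon> = Min (insert 1 (e ` T))"
  have \<epsilon>: "\<epsilon> > 0" "\<And>z. z \<in> T \<Longrightarrow> \<epsilon> \<le> e z" using T e(1) by (auto simp: \<epsilon>_def)
  have "Q y y'" if "y \<in> Z" "y' \<in> M" "d y y' < \<epsilon>" for y y'
  proof -
    obtain z where z: "z \<in> T" "y \<in> mball z (e z)" using T(3) \<open>y \<in> Z\<close> by blast
    have "d y y' < e z" using that(3) \<epsilon>(2)[OF z(1)] by linarith
    then show ?thesis using e(2)[of z y y'] z T(2) that by auto
  qed
  then show ?thesis using \<epsilon>(1) by blast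
qed

text \<open>One \<open>\<epsilon>\<close> has to serve all primes and all maps. The notion refers to
  a single point \<open>y\<close> so that it can be verified in a chart and then extended by
  compactness, taking the least of finitely many constants.\<close>

definition Newman_constant :: "'a topology \<Rightarrow> ('a \<Rightarrow> 'a \<Rightarrow> real) \<Rightarrow> real \<Rightarrow> 'a \<Rightarrow> bool" where
  "Newman_constant X d \<epsilon> y \<longleftrightarrow> (\<forall>(f :: 'a \<Rightarrow> 'a) p. prime p \<and> continuous_map X X f \<and>
     (\<forall>x \<in> topspace X. (f ^^ p) x = x) \<and> (\<forall>x \<in> topspace X. \<forall>j. d x ((f ^^ j) x) < \<epsilon>) \<longrightarrow> f y = y)"

lemma Newman_constant_mono: "\<lbrakk>Newman_constant X d \<epsilon> y; \<epsilon>' \<le> \<epsilon>\<rbrakk> \<Longrightarrow> Newman_constant X d \<epsilon>' y"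
  unfolding Newman_constant_def by (meson less_le_trans)

text \<open>Orbits are short, so those that meet a small coordinate ball stay in the chart. Their
  points form an open invariant set \<open>A\<close>, on which \<open>f\<close> becomes a periodic
  map in Euclidean space. The ball is centred at the point under consideration, which varies near
  \<open>x0\<close>, so that one \<open>\<epsilon>\<close> serves a whole neighbourhood.\<close>

lemma Newman_constant_chart:
  fixes X :: "'a topology"
  assumes M: "Metric_space (topspace X) d" "Metric_space.mtopology (topspace X) d = X"
    and U: "openin X U" and V: "openin (Euclidean_space n) V"
    and hk: "homeomorphic_maps (subtopology X U) (subtopology (Euclidean_space n) V) h k"
    and x0: "x0 \<in> U"
  shows "\<exists>N \<epsilon>. openin X N \<and> x0 \<in> N \<and> \<epsilon> > 0 \<and> (\<forall>y \<in> N. Newman_constant X d \<epsilon> y)"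
proof -
  interpret Metric_space "topspace X" d by (rule M)
  let ?E = "top_of_set (Rn n)"
  have VE: "openin ?E V" using V by (simp add: Euclidean_space_eq_top_of_set)
  have VR: "V \<subseteq> Rn n" using openin_imp_subset[OF VE] .
  have UX: "U \<subseteq> topspace X" using openin_subset[OF U] .
  have subV: "subtopology (Euclidean_space n) V = top_of_set V"
    using VR by (simp add: Euclidean_space_eq_top_of_set subtopology_subtopology Int_absorb1)
  have hk': "homeomorphic_maps (subtopology X U) (top_of_set V) h k" using hk by (simp add: subV)
  have h: "continuous_map (subtopology X U) (top_of_set V) h" and k: "continuous_map (top_of_set V) (subtopology X U) k"
    and kh: "\<And>x. x \<in> U \<Longrightarrow> k (h x) = x" and hk: "\<And>y. y \<in> V \<Longrightarrow> h (k y) = y"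
    using hk' UX by (auto simp: homeomorphic_maps_def)
  have hV: "h x \<in> V" if "x \<in> U" for x using continuous_map_funspace[OF h] that UX by auto
  have kU: "k y \<in> U" if "y \<in> V" for y using continuous_map_funspace[OF k] that by auto
  have h_open: "openin ?E (h ` A)" if "openin X A" "A \<subseteq> U" for A
  proof -
    have "openin (subtopology X U) A" using that by (simp add: openin_open_subtopology[OF U])
    moreover have "open_map (subtopology X U) (top_of_set V) h"
      using hk' homeomorphic_map_maps homeomorphic_imp_open_map by blast
    ultimately have "openin (top_of_set V) (h ` A)" by (auto simp: open_map_def)
    then show ?thesis using VE openin_trans by blast
  qed
  have k_open: "openin X (k ` B)" if "openin ?E B" "B \<subseteq> V" for B
  proof -
    have "openin (top_of_set V) B" using that VR by (auto intro: openin_subset_trans)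
    moreover have "open_map (top_of_set V) (subtopology X U) k"
      using hk' homeomorphic_map_maps homeomorphic_imp_open_map homeomorphic_maps_sym by blast
    ultimately have "openin (subtopology X U) (k ` B)" by (auto simp: open_map_def)
    then show ?thesis using openin_open_subtopology[OF U] by blast
  qed
  obtain R where R: "R > 0" "{y \<in> Rn n. dist1 n (h x0) y < R} \<subseteq> V"
    by (rule dist1_ball_subset_open[OF VE hV[OF x0]])
  \<comment> \<open>Balls of radius \<open>3 * s\<close> around points within \<open>s\<close> of
    \<open>h x0\<close> fit into the compact ball \<open>C\<close> of radius \<open>4 * s\<close>,
    which lies in the chart because \<open>4 * s < R\<close>.\<close>
  define s where "s = R / 8"
  have s: "s > 0" using R by (simp add: s_def)
  define C where "C = {y \<in> Rn n. dist1 n (h x0) y \<le> 4 * s}"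
  have CV: "C \<subseteq> V" using R s by (auto simp: C_def s_def)
  have "compactin mtopology (k ` C)"
  proof -
    have "compactin (top_of_set V) C" using compact_dist1_cball CV by (simp add: compactin_subtopology C_def)
    then have "compactin (subtopology X U) (k ` C)" by (rule image_compactin[OF _ k])
    then show ?thesis using M(2) by (simp add: compactin_subtopology)
  qed
  moreover have "\<exists>e>0. \<forall>y\<in>topspace X. \<forall>y'\<in>topspace X. d z y < e \<and> d y y' < e \<longrightarrow> y' \<in> U \<and> dist1 n (h y) (h y') \<le> s / 8"
    if "z \<in> k ` C" for z
  proof -
    have zU: "z \<in> U" using that kU CV by blast
    define A where "A = {y \<in> topspace (subtopology X U). h y \<in> V \<inter> {w \<in> Rn n. dist1 n (h z) w < s / 16}}"
    have "openin (top_of_set V) (V \<inter> {w \<in> Rn n. dist1 n (h z) w < s / 16})"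
    proof -
      obtain Q where Q: "open Q" "{w \<in> Rn n. dist1 n (h z) w < s / 16} = Rn n \<inter> Q"
        using openin_dist1_ball[of n "h z" "s / 16"] by (auto simp only: openin_open)
      have "V \<inter> (Rn n \<inter> Q) = V \<inter> Q" using VR by blast
      then show ?thesis using Q by (simp only: openin_open_Int)
    qed
    then have "openin (subtopology X U) A" unfolding A_def by (rule openin_continuous_map_preimage[OF h])
    then have "openin mtopology A" using openin_open_subtopology[OF U] M(2) by simp
    moreover have "z \<in> A" using zU UX hV[OF zU] VR s by (auto simp: A_def)
    ultimately obtain e where e: "e > 0" "mball z e \<subseteq> A" unfolding openin_mtopology by blast
    have "y' \<in> U \<and> dist1 n (h y) (h y') \<le> s / 8"
      if y: "y \<in> topspace X" "y' \<in> topspace X" "d z y < e / 2 \<and> d y y' < e / 2" for y y'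
    proof -
      have zX: "z \<in> topspace X" using zU UX by blast
      have "d z y' < e" using triangle[OF zX y(1,2)] y(3) by linarith
      moreover have "d z y < e" using y(3) e(1) by linarith
      ultimately have "y \<in> A" "y' \<in> A" using e(2) y zX by auto
      then have "y' \<in> U" "dist1 n (h z) (h y) < s / 16" "dist1 n (h z) (h y') < s / 16" by (auto simp: A_def)
      then show ?thesis using dist1_triangle[of n "h y" "h y'" "h z"] dist1_commute[of n "h z" "h y"] by simp
    qed
    then show ?thesis using e(1) by (intro exI[of _ "e / 2"]) auto
  qed
  ultimately obtain \<epsilon> where \<epsilon>: "\<epsilon> > 0"
    "\<And>y y'. \<lbrakk>y \<in> k ` C; y' \<in> topspace X; d y y' < \<epsilon>\<rbrakk> \<Longrightarrow> y' \<in> U \<and> dist1 n (h y) (h y') \<le> s / 8"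
    using compactin_uniform_radius[of "k ` C" "\<lambda>y y'. y' \<in> U \<and> dist1 n (h y) (h y') \<le> s / 8"] by blast
  define N where "N = k ` {y \<in> Rn n. dist1 n (h x0) y < s}"
  have "{y \<in> Rn n. dist1 n (h x0) y < s} \<subseteq> V" using CV s by (auto simp: C_def)
  then have "openin X N" unfolding N_def by (intro k_open openin_dist1_ball)
  moreover have "x0 \<in> N"
    unfolding N_def using kh[OF x0] hV[OF x0] VR s by (intro image_eqI[of _ _ "h x0"]) auto
  moreover have "Newman_constant X d \<epsilon> y0" if y0N: "y0 \<in> N" for y0
    unfolding Newman_constant_def
  proof (intro allI impI, elim conjE)
    fix f :: "'a \<Rightarrow> 'a" and p :: nat
    assume p: "prime p" and f: "continuous_map X X f" and period: "\<forall>x \<in> topspace X. (f ^^ p) x = x"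
      and small: "\<forall>x \<in> topspace X. \<forall>j. d x ((f ^^ j) x) < \<epsilon>"
    have p0: "p > 0" using p prime_gt_0_nat by blast
    obtain c where c: "c \<in> Rn n" "dist1 n (h x0) c < s" "y0 = k c" using y0N by (auto simp: N_def)
    define B where "B = {y \<in> Rn n. dist1 n c y < 3 * s}"
    have BC: "B \<subseteq> C"
    proof
      fix y assume "y \<in> B"
      then show "y \<in> C" using dist1_triangle[of n "h x0" y c] c by (auto simp: B_def C_def)
    qed
    have fX: "(f ^^ j) x \<in> topspace X" if "x \<in> topspace X" for x j
      using that continuous_map_funspace[OF f] by (induction j) auto
    have cfj: "continuous_map X X (f ^^ j)" for j
    proof (induction j)
      case (Suc j)
      then show ?case using continuous_map_compose[OF _ f, of X "f ^^ j"] by (simp add: o_def)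
    qed simp
    have kBX: "k ` B \<subseteq> topspace X" using kU BC CV UX by blast
    have near: "(f ^^ j) x \<in> U" "dist1 n (h x) (h ((f ^^ j) x)) \<le> s / 8" if "x \<in> k ` B" for x j
    proof -
      have "x \<in> k ` C" "x \<in> topspace X" using that BC kBX by auto
      then show "(f ^^ j) x \<in> U" "dist1 n (h x) (h ((f ^^ j) x)) \<le> s / 8"
        using \<epsilon>(2)[of x "(f ^^ j) x"] fX small by auto
    qed
    define A where "A = {x \<in> topspace X. \<exists>j. (f ^^ j) x \<in> k ` B}"
    have from_ball: "\<exists>m. \<exists>b \<in> k ` B. x = (f ^^ m) b" if "x \<in> A" for x
    proof -
      obtain j where j: "(f ^^ j) x \<in> k ` B" and x: "x \<in> topspace X" using \<open>x \<in> A\<close> by (auto simp: A_def)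
      \<comment> \<open>\<open>p * j\<close> is a multiple of the period, so
        \<open>p * j - j\<close> further steps lead from \<open>(f ^^ j) x\<close> back to
        \<open>x\<close>.\<close>
      have "(f ^^ (p * j - j)) ((f ^^ j) x) = (f ^^ (p * j - j + j)) x" by (simp add: funpow_add)
      also have "p * j - j + j = p * j" using p0 by simp
      also have "(f ^^ (p * j)) x = (f ^^ ((p * j) mod p)) x"
        using fX[of _ 1] period x by (intro funpow_mod_on[where W = "topspace X"]) auto
      finally show ?thesis using j by (metis funpow_0 mod_mult_self1_is_0)
    qed
    have AU: "A \<subseteq> U" using from_ball near(1) by blast
    have fA: "f x \<in> A" if x: "x \<in> A" for x
    proof -
      obtain j where j: "(f ^^ j) x \<in> k ` B" and xX: "x \<in> topspace X" using x by (auto simp: A_def)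
      have "(f ^^ (j + (p - 1))) (f x) = (f ^^ (j + p)) x"
        using p0 by (metis Suc_diff_1 add_Suc_right funpow_swap1 funpow_simps_right(2) o_apply)
      also have "\<dots> = (f ^^ j) x" using period xX by (simp add: funpow_add)
      finally have "(f ^^ (j + (p - 1))) (f x) \<in> k ` B" using j by simp
      moreover have "f x \<in> topspace X" using xX fX[of x 1] by simp
      ultimately show ?thesis unfolding A_def by blast
    qed
    have kBA: "k ` B \<subseteq> A" using kBX by (auto simp: A_def intro!: exI[of _ 0])
    have "openin X A"
    proof -
      have "openin X (k ` B)" unfolding B_def using BC CV by (intro k_open openin_dist1_ball) (auto simp: B_def)
      then have "openin X {x \<in> topspace X. (f ^^ j) x \<in> k ` B}" for j
        by (rule openin_continuous_map_preimage[OF cfj])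
      moreover have "A = (\<Union>j. {x \<in> topspace X. (f ^^ j) x \<in> k ` B})" by (auto simp: A_def)
      ultimately show ?thesis by auto
    qed
    define g where "g = h \<circ> f \<circ> k"
    have gh: "(g ^^ j) (h x) = h ((f ^^ j) x)" if "x \<in> A" for x j
    proof (induction j)
      case (Suc j)
      have "(f ^^ j) x \<in> A" using that fA by (induction j) auto
      then show ?case using Suc AU kh by (auto simp: g_def)
    qed simp
    interpret periodic_map n p "h ` A" g
    proof
      show "openin (top_of_set (Rn n)) (h ` A)" by (rule h_open[OF \<open>openin X A\<close> AU])
      show "g \<in> h ` A \<rightarrow> h ` A" using gh[of _ 1] fA by auto
      have "continuous_map (top_of_set (h ` A)) (subtopology X A) k"
      proof -
        have "continuous_map (subtopology (top_of_set V) (h ` A)) (subtopology X U) k"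
          by (rule continuous_map_from_subtopology[OF k])
        moreover have "V \<inter> h ` A = h ` A" using AU hV by blast
        moreover have "k \<in> h ` A \<rightarrow> A" using kh AU by auto
        ultimately show ?thesis by (auto simp: continuous_map_in_subtopology subtopology_subtopology)
      qed
      moreover have "continuous_map (subtopology X A) (subtopology X A) f"
        using continuous_map_from_subtopology[OF f] fA by (auto simp: continuous_map_in_subtopology)
      moreover have "continuous_map (subtopology X A) (top_of_set V) h"
        using continuous_map_from_subtopology_mono[OF h AU] .
      ultimately have "continuous_map (top_of_set (h ` A)) (top_of_set V) (h \<circ> (f \<circ> k))"
        by (blast intro: continuous_map_compose)
      then show "continuous_on (h ` A) g" by (simp add: g_def comp_assoc)
      show "(g ^^ p) x = x" if "x \<in> h ` A" for x
      proof -
        obtain a where "a \<in> A" "x = h a" using \<open>x \<in> h ` A\<close> by blast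
        then show ?thesis using gh[of a p] period by (auto simp: A_def)
      qed
    qed (rule p0)
    have "g c = c"
    proof (rule small_orbits_fix_centre[OF p c(1), of "2 * s" "3 * s"])
      show "{y \<in> Rn n. dist1 n c y < 3 * s} \<subseteq> h ` A"
      proof
        fix y assume y: "y \<in> {y \<in> Rn n. dist1 n c y < 3 * s}"
        then have "h (k y) = y" "k y \<in> A" using hk BC CV kBA by (auto simp: B_def)
        then show "y \<in> h ` A" by (metis image_eqI)
      qed
      fix x j assume "x \<in> h ` A"
      then obtain a where a: "a \<in> A" "x = h a" by blast
      obtain m b where b: "b \<in> k ` B" "a = (f ^^ m) b" using from_ball[OF a(1)] by blast
      have "dist1 n (h b) (h ((f ^^ (j + m)) b)) \<le> s / 8" "dist1 n (h b) (h a) \<le> s / 8"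
        using near(2)[OF b(1)] b(2) by auto
      moreover have "(g ^^ j) x = h ((f ^^ (j + m)) b)" using gh[OF a(1)] a(2) b(2) by (simp add: funpow_add)
      ultimately show "dist1 n x ((g ^^ j) x) \<le> 2 * s / 8"
        using dist1_triangle[of n x "(g ^^ j) x" "h b"] a(2) dist1_commute[of n "h a" "h b"] by simp
    qed (use s in auto)
    moreover have y0A: "y0 \<in> A" using kBA c s by (auto simp: B_def)
    moreover have "h (k c) = c" using hk[of c] c s CV by (auto simp: C_def)
    ultimately have "h (f y0) = h y0" by (simp add: g_def c(3))
    then show "f y0 = y0" using kh y0A fA AU by (metis subsetD)
  qed
  ultimately show ?thesis using \<epsilon>(1) by blast
qed

theorem Newman:
  assumes X: "manifold_with_metric n X d" "compact_space X"
  obtains \<epsilon> where "\<epsilon> > 0" "\<And>y. y \<in> topspace X \<Longrightarrow> Newman_constant X d \<epsilon> y"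
proof -
  have "\<exists>N \<epsilon>. openin X N \<and> x \<in> N \<and> \<epsilon> > 0 \<and> (\<forall>y \<in> N. Newman_constant X d \<epsilon> y)" if x: "x \<in> topspace X" for x
  proof -
    obtain U V where UV: "openin X U" "x \<in> U" "openin (Euclidean_space n) V"
      "subtopology X U homeomorphic_space subtopology (Euclidean_space n) V"
      using X(1) x unfolding manifold_with_metric_def topological_manifold_def by blast
    then obtain h k where "homeomorphic_maps (subtopology X U) (subtopology (Euclidean_space n) V) h k"
      unfolding homeomorphic_space_def by blast
    then show ?thesis
      using Newman_constant_chart[OF _ _ UV(1,3) _ UV(2)] X(1) by (auto simp: manifold_with_metric_def)
  qed
  then obtain N e where N: "\<And>x. x \<in> topspace X \<Longrightarrow> openin X (N x) \<and> x \<in> N x \<and> e x > (0::real)"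
    "\<And>x y. \<lbrakk>x \<in> topspace X; y \<in> N x\<rbrakk> \<Longrightarrow> Newman_constant X d (e x) y"
    by metis
  have "\<exists>F. finite F \<and> F \<subseteq> N ` topspace X \<and> topspace X \<subseteq> \<Union>F"
    using X(2) N(1) by (intro compactinD[of X]) (auto simp: compact_space_def)
  then obtain F where F: "finite F" "F \<subseteq> N ` topspace X" "topspace X \<subseteq> \<Union>F" by blast
  obtain T where T: "finite T" "T \<subseteq> topspace X" "topspace X \<subseteq> (\<Union>x\<in>T. N x)"
    using finite_subset_image[OF F(1,2)] F(3) by blast
  \<comment> \<open>Inserting 1 keeps the minimum defined when \<open>X\<close> is empty.\<close>
  define \<epsilon> where "\<epsilon> = Min (insert 1 (e ` T))"
  have \<epsilon>: "\<epsilon> > 0" "\<And>z. z \<in> T \<Longrightarrow> \<epsilon> \<le> e z" using T N(1) by (auto simp: \<epsilon>_def)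
  have "Newman_constant X d \<epsilon> y" if y: "y \<in> topspace X" for y
  proof -
    obtain z where z: "z \<in> T" "y \<in> N z" using T(3) y by blast
    then have "z \<in> topspace X" using T(2) by blast
    from Newman_constant_mono[OF N(2)[OF this z(2)] \<epsilon>(2)[OF z(1)]] show ?thesis .
  qed
  then show ?thesis using that \<epsilon>(1) by blast
qed

section \<open>Limits of actions\<close>

text \<open>\<open>\<Psi>\<close> is a cluster point of the net of the \<open>\<Phi> b\<close> in
  the product space, taken from the intersection of the closures of its tails; directedness gives
  these the finite intersection property. The product topology controls finitely many coordinates at
  a time, hence the finite \<open>J\<close>.\<close>

lemma compact_product_cluster_point:
  assumes X: "compact_space X" and I: "\<And>l. l \<in> L \<Longrightarrow> \<Phi> l \<in> I \<rightarrow> topspace X"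
    and L: "L \<noteq> {}" "\<And>a. a \<in> L \<Longrightarrow> leq a a"
      "\<And>a b c. \<lbrakk>a \<in> L; b \<in> L; c \<in> L; leq a b; leq b c\<rbrakk> \<Longrightarrow> leq a c"
      "\<And>a b. \<lbrakk>a \<in> L; b \<in> L\<rbrakk> \<Longrightarrow> \<exists>c \<in> L. leq a c \<and> leq b c"
  shows "\<exists>\<Psi> \<in> I \<rightarrow> topspace X. \<forall>J U. \<forall>a \<in> L.
    finite J \<and> J \<subseteq> I \<and> (\<forall>j \<in> J. openin X (U j) \<and> \<Psi> j \<in> U j) \<longrightarrow>
      (\<exists>b \<in> L. leq a b \<and> (\<forall>j \<in> J. \<Phi> b j \<in> U j))"
proof -
  let ?P = "product_topology (\<lambda>_. X) I"
  define tail where "tail a = (\<lambda>b. restrict (\<Phi> b) I) ` {b \<in> L. leq a b}" for a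
  have tailP: "tail a \<subseteq> topspace ?P" for a using I by (fastforce simp: tail_def Pi_iff)
  have P: "compact_space ?P" using X by (simp add: compact_space_product_topology)
  have "\<Inter> ((\<lambda>a. ?P closure_of tail a) ` L) \<noteq> {}"
  proof (rule compact_space_fip[THEN iffD1, OF P, rule_format], intro conjI ballI allI impI)
    show "closedin ?P C" if "C \<in> (\<lambda>a. ?P closure_of tail a) ` L" for C using that by auto
    fix \<F> assume F: "finite \<F> \<and> \<F> \<subseteq> (\<lambda>a. ?P closure_of tail a) ` L"
    then obtain A where A: "A \<subseteq> L" "finite A" "\<F> = (\<lambda>a. ?P closure_of tail a) ` A"
      using finite_subset_image[of \<F> "\<lambda>a. ?P closure_of tail a" L] by blast
    have "\<exists>c \<in> L. \<forall>a \<in> A. leq a c"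
      using A(2,1)
    proof (induction A rule: finite_induct)
      case (insert a A)
      then obtain c where "c \<in> L" "\<forall>a \<in> A. leq a c" by auto
      moreover obtain e where "e \<in> L" "leq a e" "leq c e" using L(4)[of a c] insert.prems \<open>c \<in> L\<close> by auto
      ultimately show ?case using L(3) insert.prems by (intro bexI[of _ e]) blast+
    qed (use L(1) in auto)
    then obtain c where c: "c \<in> L" "\<forall>a \<in> A. leq a c" by blast
    have "restrict (\<Phi> c) I \<in> ?P closure_of tail a" if "a \<in> A" for a
    proof -
      have "restrict (\<Phi> c) I \<in> tail a" using c that by (auto simp: tail_def)
      then show ?thesis using closure_of_subset[OF tailP] by blast
    qed
    then show "\<Inter> \<F> \<noteq> {}" unfolding A(3) by blast
  qed
  then obtain \<Psi> where \<Psi>: "\<And>a. a \<in> L \<Longrightarrow> \<Psi> \<in> ?P closure_of tail a" by blast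
  have \<Psi>P: "\<Psi> \<in> topspace ?P" using \<Psi> L(1) closure_of_subset_topspace by fastforce
  have near: "\<exists>b \<in> L. leq a b \<and> (\<forall>j \<in> J. \<Phi> b j \<in> U j)"
    if J: "finite J" "J \<subseteq> I" and a: "a \<in> L" and U: "\<And>j. j \<in> J \<Longrightarrow> openin X (U j) \<and> \<Psi> j \<in> U j" for J U a
  proof -
    let ?S = "\<lambda>j. if j \<in> J then U j else topspace X"
    have "finite {i \<in> I. ?S i \<noteq> topspace X}" using J by (rule_tac finite_subset[of _ J]) auto
    then have "openin ?P (PiE I ?S)" using U by (auto simp: openin_PiE_gen)
    moreover have "\<Psi> \<in> PiE I ?S" using \<Psi>P U by (auto simp: PiE_iff)
    ultimately obtain \<omega> where "\<omega> \<in> tail a" "\<omega> \<in> PiE I ?S"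
      using \<Psi>[OF a] unfolding in_closure_of by blast
    then obtain b where b: "b \<in> L" "leq a b" "restrict (\<Phi> b) I \<in> PiE I ?S" by (auto simp: tail_def)
    have "\<Phi> b j \<in> U j" if "j \<in> J" for j
    proof -
      have "j \<in> I" using J(2) that by blast
      from PiE_mem[OF b(3) this] show ?thesis using that \<open>j \<in> I\<close> by simp
    qed
    then show ?thesis using b by blast
  qed
  have "\<Psi> \<in> I \<rightarrow> topspace X" using \<Psi>P by auto
  then show ?thesis using near by (intro bexI[of _ \<Psi>]) auto
qed

text \<open>Inverse elements supply bijectivity. Extensionality is asked for because the elements of
  \<open>BijGroup E\<close> are extensional functions on \<open>E\<close>.\<close>

lemma group_actionI:
  assumes G: "group G"
    and closed: "\<And>g x. \<lbrakk>g \<in> carrier G; x \<in> E\<rbrakk> \<Longrightarrow> \<phi> g x \<in> E"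
    and ext: "\<And>g. g \<in> carrier G \<Longrightarrow> \<phi> g \<in> extensional E"
    and one: "\<And>x. x \<in> E \<Longrightarrow> \<phi> \<one>\<^bsub>G\<^esub> x = x"
    and mult: "\<And>g h x. \<lbrakk>g \<in> carrier G; h \<in> carrier G; x \<in> E\<rbrakk> \<Longrightarrow> \<phi> (g \<otimes>\<^bsub>G\<^esub> h) x = \<phi> g (\<phi> h x)"
  shows "group_action G E \<phi>"
proof -
  interpret group G by (rule G)
  have inv: "\<phi> (inv\<^bsub>G\<^esub> g) (\<phi> g x) = x" "\<phi> g (\<phi> (inv\<^bsub>G\<^esub> g) x) = x" if "g \<in> carrier G" "x \<in> E" for g x
    using mult[of "inv\<^bsub>G\<^esub> g" g x] mult[of g "inv\<^bsub>G\<^esub> g" x] one that by auto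
  have Bij: "\<phi> g \<in> Bij E" if "g \<in> carrier G" for g
  proof -
    have "bij_betw (\<phi> g) E E"
      by (rule bij_betw_byWitness[where f' = "\<phi> (inv\<^bsub>G\<^esub> g)"]) (use inv closed that in auto)
    then show ?thesis using ext that by (simp add: Bij_def)
  qed
  have "\<phi> \<in> hom G (BijGroup E)"
  proof (rule homI)
    show "\<phi> g \<in> carrier (BijGroup E)" if "g \<in> carrier G" for g using Bij that by (simp add: BijGroup_def)
    show "\<phi> (g \<otimes>\<^bsub>G\<^esub> h) = \<phi> g \<otimes>\<^bsub>BijGroup E\<^esub> \<phi> h" if "g \<in> carrier G" "h \<in> carrier G" for g h
    proof -
      have "\<phi> (g \<otimes>\<^bsub>G\<^esub> h) = compose E (\<phi> g) (\<phi> h)"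
        using that mult ext by (intro extensionalityI[of _ E]) (auto simp: compose_def)
      then show ?thesis using Bij that by (simp add: BijGroup_def)
    qed
  qed
  then show ?thesis
    by (simp add: group_action_def group_hom_def group_hom_axioms_def group_BijGroup G)
qed

lemma (in group_action) action_pow:
  assumes "g \<in> carrier G" "x \<in> E"
  shows "\<phi> (g [^] (j::nat)) x = (\<phi> g ^^ j) x"
proof -
  interpret group G using group_hom by (simp add: group_hom_def)
  show ?thesis using assms(2)
  proof (induction j arbitrary: x)
    case 0
    then show ?case using fun_cong[OF id_eq_one, of x] by simp
  next
    case (Suc j)
    have "\<phi> g x \<in> E" using element_image[OF assms(1) Suc.prems] by simp
    then show ?case using Suc assms(1) composition_rule[of x "g [^] j" g]
      by (simp add: funpow_swap1)
  qed
qed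

text \<open>If \<open>N\<close> is the order of \<open>g\<close> and \<open>p\<close> a prime
  divisor of it, then \<open>k = N / p\<close> lies strictly between 0 and \<open>N\<close>.\<close>

lemma (in group) prime_order_power:
  assumes g: "g \<in> carrier G" "g \<noteq> \<one>" and tor: "(m::nat) > 0" "g [^] m = \<one>"
  obtains k p :: nat where "prime p" "g [^] k \<noteq> \<one>" "(g [^] k) [^] p = \<one>"
proof -
  define N where "N = (LEAST m::nat. m > 0 \<and> g [^] m = \<one>)"
  have N: "N > 0" "g [^] N = \<one>" using LeastI[of "\<lambda>m. m > 0 \<and> g [^] m = \<one>" m] tor by (auto simp: N_def)
  have least: "g [^] k \<noteq> \<one>" if "0 < k" "k < N" for k
    using not_less_Least[of k "\<lambda>m. m > 0 \<and> g [^] m = \<one>"] that by (auto simp: N_def)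
  have "N \<noteq> 1" using N(2) g by auto
  then obtain p where p: "prime p" "p dvd N" using prime_factor_nat by blast
  then obtain k where k: "N = k * p" by (metis dvd_def mult.commute)
  have "p > 1" "k > 0" using p N(1) k prime_gt_1_nat by auto
  then have "g [^] k \<noteq> \<one>" by (intro least) (auto simp: k)
  moreover have "(g [^] k) [^] p = \<one>" using N(2) g by (simp add: nat_pow_pow k)
  ultimately show ?thesis using that p(1) by blast
qed

lemma (in Metric_space) mdist_le_zero_imp_eq:
  assumes "x \<in> M" "y \<in> M" "0 \<le> C" "\<And>e. e > 0 \<Longrightarrow> d x y \<le> C * e"
  shows "x = y"
proof (rule ccontr)
  assume "x \<noteq> y"
  then have pos: "d x y > 0" using assms by simp
  have "d x y \<le> C * (d x y / (2 * (C + 1)))" using pos assms(3) by (intro assms(4)) simp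
  also have "\<dots> \<le> (C + 1) * (d x y / (2 * (C + 1)))" using pos assms(3) by (intro mult_right_mono) auto
  also have "\<dots> = d x y / 2" using assms(3) by (simp add: field_simps)
  finally show False using pos by simp
qed

section \<open>The action of the direct limit\<close>

theorem theorem19:
  fixes n :: nat and X :: "'a topology" and d :: "'a \<Rightarrow> 'a \<Rightarrow> real" and K :: real
    and \<Lambda> :: "'i set" and leq :: "'i \<Rightarrow> 'i \<Rightarrow> bool"
    and G :: "'i \<Rightarrow> ('g, 'm) monoid_scheme" and i :: "'i \<Rightarrow> 'i \<Rightarrow> 'g \<Rightarrow> 'g"
  assumes "manifold_with_metric n X d" "compact_space X" "connected_space X"
    and "K > 0"
    and "direct_system \<Lambda> leq G i"
    and "\<And>\<alpha>. \<alpha> \<in> \<Lambda> \<Longrightarrow> torsion_group (G \<alpha>)"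
    and "\<And>\<alpha> \<beta>. \<lbrakk>\<alpha> \<in> \<Lambda>; \<beta> \<in> \<Lambda>; leq \<alpha> \<beta>\<rbrakk> \<Longrightarrow> i \<alpha> \<beta> \<in> mon (G \<alpha>) (G \<beta>)"
    and "\<And>\<alpha>. \<alpha> \<in> \<Lambda> \<Longrightarrow>
           \<exists>\<phi>. effective_action (G \<alpha>) (topspace X) d \<phi> \<and> Lipschitz_action K (G \<alpha>) (topspace X) d \<phi>"
  shows "\<exists>\<psi>. effective_action (direct_limit \<Lambda> leq G i) (topspace X) d \<psi> \<and>
             Lipschitz_action K (direct_limit \<Lambda> leq G i) (topspace X) d \<psi>"
proof -
  interpret direct_system \<Lambda> leq G i by (rule assms(5))
  have mX: "Metric_space (topspace X) d" "Metric_space.mtopology (topspace X) d = X"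
    using assms(1) by (auto simp: manifold_with_metric_def)
  interpret Metric_space "topspace X" d by (rule mX)
  define S where "S = topspace X"
  have K: "K > 0" by (rule assms(4))
  obtain \<phi> where \<phi>: "\<And>\<alpha>. \<alpha> \<in> \<Lambda> \<Longrightarrow> effective_action (G \<alpha>) S d (\<phi> \<alpha>) \<and> Lipschitz_action K (G \<alpha>) S d (\<phi> \<alpha>)"
    using assms(8) unfolding S_def by metis
  have act: "group_action (G \<alpha>) S (\<phi> \<alpha>)" if "\<alpha> \<in> \<Lambda>" for \<alpha>
    using \<phi>[OF that] by (simp add: effective_action_def)
  have effective: "\<exists>x \<in> S. d x (\<phi> \<alpha> g x) > 0" if "\<alpha> \<in> \<Lambda>" "g \<in> carrier (G \<alpha>)" "g \<noteq> \<one>\<^bsub>G \<alpha>\<^esub>" for \<alpha> g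
    using \<phi>[OF that(1)] that by (auto simp: effective_action_def)
  have Lip: "d (\<phi> \<alpha> g x) (\<phi> \<alpha> g y) \<le> K * d x y"
    if "\<alpha> \<in> \<Lambda>" "g \<in> carrier (G \<alpha>)" "x \<in> S" "y \<in> S" for \<alpha> g x y
    using \<phi>[OF that(1)] that by (auto simp: Lipschitz_action_def)
  have \<phi>S: "\<phi> \<alpha> g x \<in> S" if "\<alpha> \<in> \<Lambda>" "g \<in> carrier (G \<alpha>)" "x \<in> S" for \<alpha> g x
    using group_action.element_image[OF act[OF that(1)] that(2,3)] by simp
  have inj: "inj_on (i \<alpha> \<beta>) (carrier (G \<alpha>))" if "\<alpha> \<in> \<Lambda>" "\<beta> \<in> \<Lambda>" "leq \<alpha> \<beta>" for \<alpha> \<beta>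
    using assms(7)[OF that] by (simp add: mon_def)
  have inc_inj: "x = y" if "\<alpha> \<in> \<Lambda>" "x \<in> carrier (G \<alpha>)" "y \<in> carrier (G \<alpha>)" "inc \<alpha> x = inc \<alpha> y" for \<alpha> x y
    using that inc_eq_iff[of \<alpha> x \<alpha> y] inj inj_onD by metis
  \<comment> \<open>As the transition maps are injective, an element of the limit has at most one
    representative in \<open>G \<beta>\<close>.\<close>
  define rep where "rep \<beta> A = (SOME x. x \<in> carrier (G \<beta>) \<and> inc \<beta> x = A)" for \<beta> A
  have rep: "rep \<beta> (inc \<beta> x) = x" if "\<beta> \<in> \<Lambda>" "x \<in> carrier (G \<beta>)" for \<beta> x
    unfolding rep_def using that inc_inj by (intro some_equality) blast+
  \<comment> \<open>Each index gives a point of the power of \<open>X\<close> indexed by pairs of a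
    limit element and a point. An element not represented in \<open>G \<beta>\<close> acts as the
    identity by default; beyond an index at which it is represented, this case no longer
    arises.\<close>
  define \<Phi> where "\<Phi> \<beta> = (\<lambda>(A, x). if A \<in> inc \<beta> ` carrier (G \<beta>) then \<phi> \<beta> (rep \<beta> A) x else x)" for \<beta>
  have \<Phi>_inc: "\<Phi> \<beta> (inc \<alpha> a, x) = \<phi> \<beta> (i \<alpha> \<beta> a) x"
    if "\<alpha> \<in> \<Lambda>" "\<beta> \<in> \<Lambda>" "leq \<alpha> \<beta>" "a \<in> carrier (G \<alpha>)" for \<alpha> \<beta> a x
  proof -
    have "inc \<alpha> a = inc \<beta> (i \<alpha> \<beta> a)" "i \<alpha> \<beta> a \<in> carrier (G \<beta>)"
      using that inc_compat trans_closed by auto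
    then show ?thesis using rep[OF that(2)] by (auto simp: \<Phi>_def)
  qed
  let ?I = "carrier dlim \<times> S"
  have \<Phi>S: "\<Phi> \<beta> \<in> ?I \<rightarrow> S" if "\<beta> \<in> \<Lambda>" for \<beta>
    using that rep \<phi>S by (auto simp: \<Phi>_def)
  then have \<Phi>X: "\<Phi> \<beta> \<in> ?I \<rightarrow> topspace X" if "\<beta> \<in> \<Lambda>" for \<beta> using that by (simp only: S_def)
  have "\<exists>\<Psi> \<in> ?I \<rightarrow> topspace X. \<forall>J U. \<forall>a \<in> \<Lambda>.
    finite J \<and> J \<subseteq> ?I \<and> (\<forall>j \<in> J. openin X (U j) \<and> \<Psi> j \<in> U j) \<longrightarrow>
      (\<exists>b \<in> \<Lambda>. leq a b \<and> (\<forall>j \<in> J. \<Phi> b j \<in> U j))"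
  proof (rule compact_product_cluster_point[OF assms(2) \<Phi>X nonempty leq_refl _ directed])
    fix a b c assume "a \<in> \<Lambda>" "b \<in> \<Lambda>" "c \<in> \<Lambda>" "leq a b" "leq b c"
    then show "leq a c" by (rule leq_trans)
  qed
  then obtain \<Psi> where \<Psi>S: "\<Psi> \<in> ?I \<rightarrow> topspace X" and \<Psi>: "\<forall>J U. \<forall>a \<in> \<Lambda>.
    finite J \<and> J \<subseteq> ?I \<and> (\<forall>j \<in> J. openin X (U j) \<and> \<Psi> j \<in> U j) \<longrightarrow>
      (\<exists>b \<in> \<Lambda>. leq a b \<and> (\<forall>j \<in> J. \<Phi> b j \<in> U j))" by (rule bexE)
  have near: "\<exists>\<beta> \<in> \<Lambda>. leq \<alpha> \<beta> \<and> (\<forall>j \<in> J. d (\<Psi> j) (\<Phi> \<beta> j) < e)"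
    if J: "finite J" "J \<subseteq> ?I" and \<alpha>: "\<alpha> \<in> \<Lambda>" and e: "e > 0" for J \<alpha> e
  proof -
    have "openin X (mball (\<Psi> j) e) \<and> \<Psi> j \<in> mball (\<Psi> j) e" if "j \<in> J" for j
    proof -
      have "\<Psi> j \<in> topspace X" using \<Psi>S J(2) that by blast
      then show ?thesis using openin_mball[of "\<Psi> j" e] mX(2) e by simp
    qed
    then have "\<exists>b \<in> \<Lambda>. leq \<alpha> b \<and> (\<forall>j \<in> J. \<Phi> b j \<in> mball (\<Psi> j) e)"
      using \<Psi>[THEN spec[where x = J], THEN spec[where x = "\<lambda>j. mball (\<Psi> j) e"], THEN bspec, OF \<alpha>] J e by simp
    then show ?thesis by auto
  qed
  define \<psi> where "\<psi> A = (\<lambda>x\<in>S. \<Psi> (A, x))" for A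
  have \<psi>S: "\<psi> A x \<in> S" if "A \<in> carrier dlim" "x \<in> S" for A x
    using \<Psi>S that by (auto simp: \<psi>_def S_def)
  \<comment> \<open>One index \<open>\<beta>\<close>, beyond any given \<open>\<alpha>\<close>,
    approximates \<open>\<psi>\<close> at all the chosen pairs at once. The laws of an action and
    the Lipschitz bound pass to \<open>\<psi>\<close> through such indices.\<close>
  have \<psi>_near: "\<exists>\<beta> \<in> \<Lambda>. leq \<alpha> \<beta> \<and> (\<forall>(a, x) \<in> J. d (\<psi> (inc \<alpha> a) x) (\<phi> \<beta> (i \<alpha> \<beta> a) x) < e)"
    if J: "finite J" "J \<subseteq> carrier (G \<alpha>) \<times> S" and \<alpha>: "\<alpha> \<in> \<Lambda>" and e: "e > 0" for J \<alpha> e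
  proof -
    have "(\<lambda>(a, x). (inc \<alpha> a, x)) ` J \<subseteq> ?I" using J(2) inc_closed[OF \<alpha>] by auto
    from near[OF finite_imageI[OF J(1)] this \<alpha> e] obtain \<beta> where
      \<beta>: "\<beta> \<in> \<Lambda>" "leq \<alpha> \<beta>" "\<And>a x. (a, x) \<in> J \<Longrightarrow> d (\<Psi> (inc \<alpha> a, x)) (\<Phi> \<beta> (inc \<alpha> a, x)) < e" by fastforce
    have "d (\<psi> (inc \<alpha> a) x) (\<phi> \<beta> (i \<alpha> \<beta> a) x) < e" if "(a, x) \<in> J" for a x
    proof -
      have "a \<in> carrier (G \<alpha>)" "x \<in> S" using J(2) that by auto
      then show ?thesis using \<beta>(3)[OF that] \<Phi>_inc[OF \<alpha> \<beta>(1,2)] by (simp add: \<psi>_def)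
    qed
    then show ?thesis using \<beta>(1,2) by blast
  qed
  note tri = triangle[folded S_def]
  have \<psi>_mult: "\<psi> (A \<otimes>\<^bsub>dlim\<^esub> B) x = \<psi> A (\<psi> B x)" if AB: "A \<in> carrier dlim" "B \<in> carrier dlim" and x: "x \<in> S" for A B x
  proof -
    obtain \<alpha> a b where \<alpha>: "\<alpha> \<in> \<Lambda>" "a \<in> carrier (G \<alpha>)" "b \<in> carrier (G \<alpha>)" "A = inc \<alpha> a" "B = inc \<alpha> b"
      using lift_common[OF AB] .
    have AB_eq: "A \<otimes>\<^bsub>dlim\<^esub> B = inc \<alpha> (a \<otimes>\<^bsub>G \<alpha>\<^esub> b)" using \<alpha> mult_inc_same by simp
    have ab: "a \<otimes>\<^bsub>G \<alpha>\<^esub> b \<in> carrier (G \<alpha>)" using \<alpha> mult_closed by simp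
    have ABc: "A \<otimes>\<^bsub>dlim\<^esub> B \<in> carrier dlim" unfolding AB_eq by (rule inc_closed[OF \<alpha>(1) ab])
    let ?y = "\<psi> B x"
    have y: "?y \<in> S" using \<psi>S AB x by blast
    have "d (\<psi> (A \<otimes>\<^bsub>dlim\<^esub> B) x) (\<psi> A ?y) \<le> (2 + K) * e" if e: "e > 0" for e
    proof -
      have "{(a \<otimes>\<^bsub>G \<alpha>\<^esub> b, x), (b, x), (a, ?y)} \<subseteq> carrier (G \<alpha>) \<times> S" using \<alpha> ab x y by auto
      from \<psi>_near[OF _ this \<alpha>(1) e] obtain \<beta> where \<beta>: "\<beta> \<in> \<Lambda>" "leq \<alpha> \<beta>"
        and d1: "d (\<psi> (A \<otimes>\<^bsub>dlim\<^esub> B) x) (\<phi> \<beta> (i \<alpha> \<beta> (a \<otimes>\<^bsub>G \<alpha>\<^esub> b)) x) < e"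
        and d2: "d ?y (\<phi> \<beta> (i \<alpha> \<beta> b) x) < e" and d3: "d (\<psi> A ?y) (\<phi> \<beta> (i \<alpha> \<beta> a) ?y) < e"
        unfolding AB_eq unfolding \<alpha>(4,5) by auto
      have c: "i \<alpha> \<beta> a \<in> carrier (G \<beta>)" "i \<alpha> \<beta> b \<in> carrier (G \<beta>)" using trans_closed \<alpha> \<beta> by auto
      let ?w = "\<phi> \<beta> (i \<alpha> \<beta> b) x"
      have w: "?w \<in> S" using \<phi>S \<beta> c x by blast
      have eq: "\<phi> \<beta> (i \<alpha> \<beta> (a \<otimes>\<^bsub>G \<alpha>\<^esub> b)) x = \<phi> \<beta> (i \<alpha> \<beta> a) ?w"
        using trans_mult[OF \<alpha>(1) \<beta> \<alpha>(2,3)] group_action.composition_rule[OF act[OF \<beta>(1)] x c] by simp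
      \<comment> \<open>Equicontinuity is used here: the inner point \<open>?y\<close> comes from
        \<open>\<psi>\<close> and differs from \<open>?w\<close>, its approximation at
        \<open>\<beta>\<close>, by less than \<open>e\<close>.\<close>
      have "d (\<phi> \<beta> (i \<alpha> \<beta> a) ?w) (\<phi> \<beta> (i \<alpha> \<beta> a) ?y) \<le> K * d ?w ?y" using Lip \<beta> c w y by blast
      also have "\<dots> \<le> K * e" using d2 K commute[of ?w ?y] by (intro mult_left_mono) auto
      finally have d4: "d (\<phi> \<beta> (i \<alpha> \<beta> a) ?w) (\<phi> \<beta> (i \<alpha> \<beta> a) ?y) \<le> K * e" .
      have in_S: "\<psi> (A \<otimes>\<^bsub>dlim\<^esub> B) x \<in> S" "\<psi> A ?y \<in> S" "\<phi> \<beta> (i \<alpha> \<beta> a) ?w \<in> S" "\<phi> \<beta> (i \<alpha> \<beta> a) ?y \<in> S"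
        using \<psi>S \<phi>S \<beta> c x y w AB ABc by blast+
      have "d (\<psi> (A \<otimes>\<^bsub>dlim\<^esub> B) x) (\<psi> A ?y) \<le> d (\<psi> (A \<otimes>\<^bsub>dlim\<^esub> B) x) (\<phi> \<beta> (i \<alpha> \<beta> a) ?w) + d (\<phi> \<beta> (i \<alpha> \<beta> a) ?w) (\<psi> A ?y)"
        by (rule tri) (use in_S in auto)
      also have "d (\<phi> \<beta> (i \<alpha> \<beta> a) ?w) (\<psi> A ?y) \<le> d (\<phi> \<beta> (i \<alpha> \<beta> a) ?w) (\<phi> \<beta> (i \<alpha> \<beta> a) ?y) + d (\<phi> \<beta> (i \<alpha> \<beta> a) ?y) (\<psi> A ?y)"
        by (rule tri) (use in_S in auto)
      finally have "d (\<psi> (A \<otimes>\<^bsub>dlim\<^esub> B) x) (\<psi> A ?y) \<le> e + (K * e + e)"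
        using d1[unfolded eq] d3 d4 commute[of "\<psi> A ?y" "\<phi> \<beta> (i \<alpha> \<beta> a) ?y"] by linarith
      then show ?thesis by (simp add: algebra_simps)
    qed
    then show ?thesis
      using mdist_le_zero_imp_eq[of "\<psi> (A \<otimes>\<^bsub>dlim\<^esub> B) x" "\<psi> A ?y" "2 + K"] K \<psi>S[OF ABc x] \<psi>S[OF AB(1) y]
      by (simp add: S_def)
  qed
  have \<psi>_one: "\<psi> \<one>\<^bsub>dlim\<^esub> x = x" if x: "x \<in> S" for x
  proof -
    obtain \<alpha> where \<alpha>: "\<alpha> \<in> \<Lambda>" using nonempty by blast
    have one: "\<one>\<^bsub>dlim\<^esub> = inc \<alpha> \<one>\<^bsub>G \<alpha>\<^esub>" "\<one>\<^bsub>G \<alpha>\<^esub> \<in> carrier (G \<alpha>)" using one_dlim one_closed \<alpha> by auto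
    have "d (\<psi> \<one>\<^bsub>dlim\<^esub> x) x \<le> 1 * e" if e: "e > 0" for e
    proof -
      have "{(\<one>\<^bsub>G \<alpha>\<^esub>, x)} \<subseteq> carrier (G \<alpha>) \<times> S" using one x by auto
      from \<psi>_near[OF _ this \<alpha> e] obtain \<beta> where \<beta>: "\<beta> \<in> \<Lambda>" "leq \<alpha> \<beta>"
        and d1: "d (\<psi> \<one>\<^bsub>dlim\<^esub> x) (\<phi> \<beta> (i \<alpha> \<beta> \<one>\<^bsub>G \<alpha>\<^esub>) x) < e" unfolding one(1) by auto
      have "\<phi> \<beta> (i \<alpha> \<beta> \<one>\<^bsub>G \<alpha>\<^esub>) x = x"
        using trans_one[OF \<alpha> \<beta>] fun_cong[OF group_action.id_eq_one[OF act[OF \<beta>(1)]], of x] x by simp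
      then show ?thesis using d1 by simp
    qed
    moreover have "\<psi> \<one>\<^bsub>dlim\<^esub> x \<in> S" using \<psi>S[OF _ x] inc_closed[OF \<alpha> one(2)] one(1) by simp
    ultimately show ?thesis
      using mdist_le_zero_imp_eq[of "\<psi> \<one>\<^bsub>dlim\<^esub> x" x 1] x by (simp add: S_def)
  qed
  have ga: "group_action dlim S \<psi>"
    by (rule group_actionI[OF group_dlim \<psi>S _ \<psi>_one \<psi>_mult]) (simp_all only: \<psi>_def restrict_extensional)
  have \<psi>_Lip: "d (\<psi> A x) (\<psi> A y) \<le> K * d x y" if A: "A \<in> carrier dlim" and x: "x \<in> S" and y: "y \<in> S" for A x y
  proof (rule field_le_epsilon)
    fix e :: real assume e: "e > 0"
    obtain \<alpha> a where \<alpha>: "\<alpha> \<in> \<Lambda>" "a \<in> carrier (G \<alpha>)" "A = inc \<alpha> a" using A carrier_dlim by blast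
    have "{(a, x), (a, y)} \<subseteq> carrier (G \<alpha>) \<times> S" "e / 2 > 0" using \<alpha> x y e by auto
    from \<psi>_near[OF _ this(1) \<alpha>(1) this(2)] obtain \<beta> where \<beta>: "\<beta> \<in> \<Lambda>" "leq \<alpha> \<beta>"
      and d1: "d (\<psi> A x) (\<phi> \<beta> (i \<alpha> \<beta> a) x) < e / 2" and d2: "d (\<psi> A y) (\<phi> \<beta> (i \<alpha> \<beta> a) y) < e / 2"
      unfolding \<alpha>(3) by auto
    have c: "i \<alpha> \<beta> a \<in> carrier (G \<beta>)" using trans_closed \<alpha> \<beta> by auto
    let ?x = "\<phi> \<beta> (i \<alpha> \<beta> a) x" and ?y = "\<phi> \<beta> (i \<alpha> \<beta> a) y"
    have in_S: "\<psi> A x \<in> S" "\<psi> A y \<in> S" "?x \<in> S" "?y \<in> S" using \<psi>S \<phi>S \<beta> c x y A by blast+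
    have "d (\<psi> A x) (\<psi> A y) \<le> d (\<psi> A x) ?x + d ?x (\<psi> A y)" by (rule tri) (use in_S in auto)
    also have "d ?x (\<psi> A y) \<le> d ?x ?y + d ?y (\<psi> A y)" by (rule tri) (use in_S in auto)
    finally show "d (\<psi> A x) (\<psi> A y) \<le> K * d x y + e"
      using d1 d2 Lip[OF \<beta>(1) c x y] commute[of "\<psi> A y" ?y] by linarith
  qed
  obtain \<epsilon> where \<epsilon>: "\<epsilon> > 0" "\<And>y. y \<in> S \<Longrightarrow> Newman_constant X d \<epsilon> y"
    using Newman[OF assms(1,2)] unfolding S_def by blast
  have "\<exists>x \<in> S. d x (\<psi> A x) > 0" if A: "A \<in> carrier dlim" "A \<noteq> \<one>\<^bsub>dlim\<^esub>" for A
  proof (rule ccontr)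
    assume contr: "\<not> (\<exists>x \<in> S. d x (\<psi> A x) > 0)"
    have \<psi>A: "\<psi> A x = x" if "x \<in> S" for x
      using contr that \<psi>S[OF A(1) that] by (auto simp: S_def)
    obtain \<alpha> a where \<alpha>: "\<alpha> \<in> \<Lambda>" "a \<in> carrier (G \<alpha>)" "A = inc \<alpha> a" using A carrier_dlim by blast
    interpret G\<alpha>: group "G \<alpha>" by (rule group[OF \<alpha>(1)])
    have "a \<noteq> \<one>\<^bsub>G \<alpha>\<^esub>" using A(2) \<alpha> one_dlim by auto
    moreover obtain m :: nat where "m > 0" "a [^]\<^bsub>G \<alpha>\<^esub> m = \<one>\<^bsub>G \<alpha>\<^esub>"
      using assms(6)[OF \<alpha>(1)] \<alpha>(2) by (auto simp: torsion_group_def)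
    ultimately obtain k p :: nat where p: "prime p" "a [^]\<^bsub>G \<alpha>\<^esub> k \<noteq> \<one>\<^bsub>G \<alpha>\<^esub>"
      "(a [^]\<^bsub>G \<alpha>\<^esub> k) [^]\<^bsub>G \<alpha>\<^esub> p = \<one>\<^bsub>G \<alpha>\<^esub>"
      using G\<alpha>.prime_order_power[OF \<alpha>(2)] by metis
    define b where "b = a [^]\<^bsub>G \<alpha>\<^esub> k"
    have b: "b \<in> carrier (G \<alpha>)" using \<alpha>(2) by (simp add: b_def)
    have bj: "b [^]\<^bsub>G \<alpha>\<^esub> (j::nat) \<in> carrier (G \<alpha>)" for j using b by simp
    have \<psi>a: "\<psi> (inc \<alpha> (a [^]\<^bsub>G \<alpha>\<^esub> (m::nat))) x = x" if x: "x \<in> S" for m x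
    proof (induction m)
      case 0
      then show ?case using \<psi>_one[OF x] one_dlim[OF \<alpha>(1)] by simp
    next
      case (Suc m)
      have am: "a [^]\<^bsub>G \<alpha>\<^esub> m \<in> carrier (G \<alpha>)" using \<alpha>(2) by simp
      have "inc \<alpha> (a [^]\<^bsub>G \<alpha>\<^esub> Suc m) = inc \<alpha> (a [^]\<^bsub>G \<alpha>\<^esub> m) \<otimes>\<^bsub>dlim\<^esub> A"
        using mult_inc_same[OF \<alpha>(1) am \<alpha>(2)] \<alpha>(3) by simp
      then show ?case
        using \<psi>_mult[OF inc_closed[OF \<alpha>(1) am] A(1) x] \<psi>A[OF x] Suc.IH by simp
    qed
    have \<psi>b: "\<psi> (inc \<alpha> (b [^]\<^bsub>G \<alpha>\<^esub> (j::nat))) x = x" if "x \<in> S" for j x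
      using \<psi>a[OF that, of "k * j"] \<alpha>(2) by (simp add: b_def G\<alpha>.nat_pow_pow)
    \<comment> \<open>The displacement of a point is estimated through a net point \<open>t\<close>:
      \<open>e\<close> for reaching \<open>t\<close>, \<open>e\<close> for the displacement of
      \<open>t\<close>, and \<open>K * e\<close> for the distance between the images.\<close>
    define e where "e = \<epsilon> / (2 + K)"
    have e: "e > 0" "(2 + K) * e = \<epsilon>" using \<epsilon> K by (auto simp: e_def)
    have "compactin mtopology S" using assms(2) mX(2) by (simp add: compact_space_def S_def)
    then have "\<exists>T. finite T \<and> T \<subseteq> S \<and> S \<subseteq> (\<Union>t\<in>T. mball t e)"
      using compactin_imp_mtotally_bounded e(1) by (simp only: mtotally_bounded_def)
    then obtain T where T: "finite T" "T \<subseteq> S" "S \<subseteq> (\<Union>t\<in>T. mball t e)" by (elim exE conjE)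
    \<comment> \<open>Finitely many pairs suffice: the powers of \<open>b\<close> repeat with period
      \<open>p\<close>, and the Lipschitz bound extends the estimate from \<open>T\<close> to all
      points.\<close>
    have "(\<lambda>j. b [^]\<^bsub>G \<alpha>\<^esub> j) ` {..<p} \<times> T \<subseteq> carrier (G \<alpha>) \<times> S" using bj T by auto
    from \<psi>_near[OF _ this \<alpha>(1) e(1)] T(1) obtain \<beta> where \<beta>: "\<beta> \<in> \<Lambda>" "leq \<alpha> \<beta>"
      and dT: "\<And>j t. \<lbrakk>j < p; t \<in> T\<rbrakk> \<Longrightarrow>
         d (\<psi> (inc \<alpha> (b [^]\<^bsub>G \<alpha>\<^esub> j)) t) (\<phi> \<beta> (i \<alpha> \<beta> (b [^]\<^bsub>G \<alpha>\<^esub> j)) t) < e" by auto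
    interpret G\<beta>: group "G \<beta>" by (rule group[OF \<beta>(1)])
    define g where "g = i \<alpha> \<beta> b"
    have g: "g \<in> carrier (G \<beta>)" using trans_closed \<alpha> \<beta> b by (simp add: g_def)
    have gj: "i \<alpha> \<beta> (b [^]\<^bsub>G \<alpha>\<^esub> j) = g [^]\<^bsub>G \<beta>\<^esub> j" for j :: nat
      using trans_one[OF \<alpha>(1) \<beta>] trans_mult[OF \<alpha>(1) \<beta> _ b] bj by (induction j) (auto simp: g_def)
    \<comment> \<open>Injectivity of the transition map keeps the image of \<open>b\<close>
      nontrivial, so the effective action at \<open>\<beta>\<close> makes it move a point.\<close>
    have g1: "g \<noteq> \<one>\<^bsub>G \<beta>\<^esub>"
      using inj_onD[OF inj[OF \<alpha>(1) \<beta>], of b "\<one>\<^bsub>G \<alpha>\<^esub>"] p(2) b trans_one[OF \<alpha>(1) \<beta>] by (auto simp: g_def b_def)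
    let ?f = "\<phi> \<beta> g"
    have pow: "\<phi> \<beta> (g [^]\<^bsub>G \<beta>\<^esub> j) x = (?f ^^ j) x" if "x \<in> S" for j :: nat and x
      by (rule group_action.action_pow[OF act[OF \<beta>(1)] g that])
    have period: "(?f ^^ p) x = x" if "x \<in> S" for x
    proof -
      have "g [^]\<^bsub>G \<beta>\<^esub> p = \<one>\<^bsub>G \<beta>\<^esub>" using gj[of p] p(3) trans_one[OF \<alpha>(1) \<beta>] by (simp add: b_def)
      then show ?thesis
        using pow[OF that, of p] fun_cong[OF group_action.id_eq_one[OF act[OF \<beta>(1)]], of x] that by simp
    qed
    have fS: "?f \<in> S \<rightarrow> S" using \<phi>S \<beta>(1) g by auto
    have "d x ((?f ^^ j) x) < \<epsilon>" if x: "x \<in> S" for x j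
    proof -
      let ?j = "j mod p"
      have fj: "(?f ^^ j) x = (?f ^^ ?j) x" by (rule funpow_mod_on[OF fS period x])
      obtain t where t: "t \<in> T" "d t x < e" using T(3) x by auto
      have tS: "t \<in> S" using t T by blast
      have jp: "?j < p" using p(1) prime_gt_0_nat by auto
      have "d t ((?f ^^ ?j) t) < e"
        using dT[OF jp t(1)] \<psi>b[OF tS] gj pow[OF tS] by simp
      moreover have "d ((?f ^^ ?j) t) ((?f ^^ ?j) x) \<le> K * d t x"
        using Lip[OF \<beta>(1) _ tS x, of "g [^]\<^bsub>G \<beta>\<^esub> ?j"] g pow[OF tS] pow[OF x] by simp
      moreover have "K * d t x < K * e" using K t by simp
      moreover have in_S: "(?f ^^ ?j) t \<in> S" "(?f ^^ ?j) x \<in> S" using funpow_mem[OF fS] tS x by auto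
      moreover have "d x ((?f ^^ ?j) x) \<le> d x t + d t ((?f ^^ ?j) x)" by (rule tri) (use in_S tS x in auto)
      moreover have "d t ((?f ^^ ?j) x) \<le> d t ((?f ^^ ?j) t) + d ((?f ^^ ?j) t) ((?f ^^ ?j) x)"
        by (rule tri) (use in_S tS in auto)
      ultimately have "d x ((?f ^^ ?j) x) < e + (e + K * e)" using t(2) commute[of x t] by linarith
      then show ?thesis using e(2) fj by (simp add: algebra_simps)
    qed
    moreover have "continuous_map X X ?f"
    proof -
      have "\<exists>\<delta>>0. \<forall>y. y \<in> topspace X \<and> d x y < \<delta> \<longrightarrow> d (?f x) (?f y) < \<eta>"
        if "x \<in> topspace X" "\<eta> > 0" for x \<eta>
      proof -
        have "d (?f x) (?f y) < \<eta>" if y: "y \<in> topspace X" "d x y < \<eta> / K" for y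
        proof -
          have "d (?f x) (?f y) \<le> K * d x y"
            using Lip[OF \<beta>(1) g] y \<open>x \<in> topspace X\<close> by (simp add: S_def)
          also have "\<dots> < \<eta>" using y(2) K by (simp add: less_divide_eq mult.commute)
          finally show ?thesis .
        qed
        then show ?thesis using K that(2) by (intro exI[of _ "\<eta> / K"]) auto
      qed
      then have "continuous_map mtopology mtopology ?f"
        using metric_continuous_map[OF mX(1), of ?f] fS unfolding S_def by auto
      then show ?thesis using mX(2) by simp
    qed
    ultimately have "?f y = y" if "y \<in> S" for y
      using \<epsilon>(2)[OF that] p(1) period unfolding Newman_constant_def S_def by blast
    moreover obtain x where "x \<in> S" "d x (?f x) > 0" using effective[OF \<beta>(1) g g1] by blast
    ultimately show False by (simp add: S_def)
  qed
  then have "effective_action dlim S d \<psi>" using ga by (simp add: effective_action_def)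
  moreover have "Lipschitz_action K dlim S d \<psi>" using ga \<psi>_Lip by (simp add: Lipschitz_action_def)
  ultimately show ?thesis unfolding S_def by blast
qed

end
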